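(* Let $\ell_0\ge2$. There is a constant $C>0$ (depending only on $\ell_0$) such that the following holds. Let $R_{\alpha,\gamma,\gamma'}^{t(\alpha)}$ be the annular region obtained by gluing two nonstandard half-collars $R_{\alpha,\gamma}$ and $R_{\alpha',\gamma'}$ with twist $t(\alpha)$ and with $\ell(\gamma)=\ell(\gamma')=\infty$. If $\ell(\alpha)\ge\ell_0$ and $-\frac12\le t(\alpha)<\frac12$, then $$\lambda\big(R_{\alpha,\gamma,\gamma'}^{t(\alpha)}\big)\ge C\,e^{-\left(\frac12-\frac{|t(\alpha)|}2\right)\ell(\alpha)}.$$
   Context: Let $P$ be a complete hyperbolic (curvature $-1$) pair of pants with a boundary closed geodesic $\alpha$, a puncture $\alpha_1$, and a third boundary component $\alpha_2$ (a closed geodesic or a puncture). Let $\gamma$ be the simple geodesic ray in $P$ from $\alpha$, orthogonal to $\alpha$, going out the puncture $\alpha_1$ (so $\ell(\gamma)=\infty$), and let $\beta$ be the simple bi-infinite geodesic going out the puncture $\alpha_1$ in both directions and orthogonal to the simple orthogeodesic from $\alpha$ to $\alpha_2$. The nonstandard half-collar $R_{\alpha,\gamma}$ is the annular region of $P$ between $\alpha$ and $\beta$. $R_{\alpha',\gamma'}$ is an analogous half-collar in a second pair of pants, with $\ell(\alpha')=\ell(\alpha)$. Gluing with twist $t(\alpha)$: $\alpha$ and $\alpha'$ are identified by an isometry, with the two half-collars on opposite sides, such that the shorter arc of $\alpha\equiv\alpha'$ between the foot of $\gamma$ and the foot of $\gamma'$ has length $|t(\alpha)|\ell(\alpha)$.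 For a doubly connected region $R$, $\lambda(R)$ is the extremal length of the family of curves in $R$ connecting its two boundary components. *)

theory Defs
  imports "HOL-Analysis.Analysis"
begin

section \<open>The hyperbolic plane\<close>

text \<open>Upper half-plane model, curvature -1.\<close>

definition uhp :: "complex set" where
  "uhp = {z. Im z > 0}"

definition hdist :: "complex \<Rightarrow> complex \<Rightarrow> real" where
  "hdist z w = arcosh (1 + (cmod (z - w))\<^sup>2 / (2 * Im z * Im w))"

definition hisometry :: "(complex \<Rightarrow> complex) \<Rightarrow> bool" where
  "hisometry f \<longleftrightarrow> bij_betw f uhp uhp \<and>
     (\<forall>z\<in>uhp. \<forall>w\<in>uhp. hdist (f z) (f w) = hdist z w)"

text \<open>Unit-speed geodesics parametrised by an interval \<open>I\<close>. In the hyperbolic plane every geodesic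
  is globally distance-realising.\<close>

definition hgeodesic :: "real set \<Rightarrow> (real \<Rightarrow> complex) \<Rightarrow> bool" where
  "hgeodesic I c \<longleftrightarrow> c ` I \<subseteq> uhp \<and>
     (\<forall>s\<in>I. \<forall>t\<in>I. hdist (c s) (c t) = \<bar>s - t\<bar>)"

definition hconvex :: "complex set \<Rightarrow> bool" where
  "hconvex N \<longleftrightarrow> (\<forall>c m. m \<ge> 0 \<longrightarrow> hgeodesic {0..m} c \<longrightarrow> c 0 \<in> N \<longrightarrow> c m \<in> N \<longrightarrow> c ` {0..m} \<subseteq> N)"

text \<open>The model is conformal, so hyperbolic and Euclidean orthogonality of tangent vectors agree.\<close>

definition meets_orthogonally ::
  "real set \<Rightarrow> (real \<Rightarrow> complex) \<Rightarrow> real \<Rightarrow> real set \<Rightarrow> (real \<Rightarrow> complex) \<Rightarrow> real \<Rightarrow> bool" where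
  "meets_orthogonally I c s J d u \<longleftrightarrow> s \<in> I \<and> u \<in> J \<and> c s = d u \<and>
     vector_derivative c (at s within I) \<bullet> vector_derivative d (at u within J) = 0"


section \<open>Complete hyperbolic pairs of pants\<close>

text \<open>The underlying space is a labelled planar model. The boundary geodesic \<open>\<alpha>\<close> is the unit circle,
  the puncture \<open>\<alpha>\<^sub>1\<close> is the missing point \<open>0\<close>, and \<open>\<alpha>\<^sub>2\<close> is the missing point \<open>1/2\<close> if \<open>cusp2\<close> holds
  and the circle of radius \<open>1/4\<close> about \<open>1/2\<close> otherwise. Only the topology of this planar set is used;
  all geometry comes from the universal covering.\<close>

definition pants :: "bool \<Rightarrow> complex set" where
  "pants cusp2 = cball 0 1 - {0} - (if cusp2 then {1/2} else ball (1/2) (1/4))"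

abbreviation alpha_circle :: "complex set" where
  "alpha_circle \<equiv> sphere 0 1"

abbreviation alpha2_circle :: "complex set" where
  "alpha2_circle \<equiv> sphere (1/2) (1/4)"

text \<open>The end \<open>q\<close> of the quotient of \<open>N\<close> is a puncture: it has a neighbourhood isometric to the
  standard cusp, i.e. the half-plane \<open>Im z > y\<close> modulo \<open>z \<mapsto> z + 1\<close>. This rules out funnels.\<close>

definition cusp_at :: "complex set \<Rightarrow> (complex \<Rightarrow> complex) \<Rightarrow> complex \<Rightarrow> bool" where
  "cusp_at N p q \<longleftrightarrow> (\<exists>h y. hisometry h \<and> y > 0 \<and> h ` {z. Im z > y} \<subseteq> N \<and>
     (\<forall>z w. Im z > y \<longrightarrow> Im w > y \<longrightarrow> (p (h z) = p (h w) \<longleftrightarrow> w - z \<in> \<int>)) \<and>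
     ((\<lambda>z. p (h z)) \<longlongrightarrow> q) (filtercomap Im at_top))"

definition geodesic_boundary :: "complex set \<Rightarrow> (complex \<Rightarrow> complex) \<Rightarrow> complex set \<Rightarrow> bool" where
  "geodesic_boundary N p K \<longleftrightarrow>
     (\<forall>z\<in>N. p z \<in> K \<longrightarrow> (\<exists>e u. hgeodesic UNIV e \<and> range e \<subseteq> N \<and> p ` range e = K \<and> e u = z))"

text \<open>A complete hyperbolic structure with geodesic boundary on the model, given by its universal
  covering \<open>p\<close>: the covering space \<open>N\<close> is a closed convex region of the hyperbolic plane, the fibres
  of \<open>p\<close> are the orbits of the isometries that preserve \<open>N\<close> and commute with \<open>p\<close>, the boundary curves
  are closed geodesics and the other ends are cusps.\<close>

definition hyperbolic_pants :: "bool \<Rightarrow> complex set \<Rightarrow> (complex \<Rightarrow> complex) \<Rightarrow> bool" where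
  "hyperbolic_pants cusp2 N p \<longleftrightarrow>
     closedin (top_of_set uhp) N \<and> hconvex N \<and>
     covering_space N p (pants cusp2) \<and>
     (\<forall>z\<in>N. \<forall>w\<in>N. p z = p w \<longrightarrow>
        (\<exists>f. hisometry f \<and> f ` N = N \<and> (\<forall>x\<in>N. p (f x) = p x) \<and> f z = w)) \<and>
     geodesic_boundary N p alpha_circle \<and>
     cusp_at N p 0 \<and>
     (if cusp2 then cusp_at N p (1/2) else geodesic_boundary N p alpha2_circle)"

text \<open>\<open>a\<close> is a unit-speed lift of the closed geodesic \<open>\<alpha>\<close> and \<open>l\<close> is its length.\<close>

definition lifts_alpha ::
  "complex set \<Rightarrow> (complex \<Rightarrow> complex) \<Rightarrow> (real \<Rightarrow> complex) \<Rightarrow> real \<Rightarrow> bool" where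
  "lifts_alpha N p a l \<longleftrightarrow> hgeodesic UNIV a \<and> range a \<subseteq> N \<and> p ` range a = alpha_circle \<and> l > 0 \<and>
     (\<forall>s t. p (a s) = p (a t) \<longleftrightarrow> (\<exists>k::int. t - s = of_int k * l))"

text \<open>A geodesic of the pair of pants is the projection of a geodesic contained in \<open>N\<close>; it is
  represented by such a lift, and it is simple if its projection is injective. The next predicate says
  that the lift \<open>c\<close> meets, at parameter \<open>s\<close>, a lift of the boundary geodesic \<open>K\<close> at a right angle.\<close>

definition orthogonal_to_boundary ::
  "complex set \<Rightarrow> (complex \<Rightarrow> complex) \<Rightarrow> complex set \<Rightarrow> real set \<Rightarrow> (real \<Rightarrow> complex) \<Rightarrow> real \<Rightarrow> bool" where
  "orthogonal_to_boundary N p K I c s \<longleftrightarrow>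
     (\<exists>e u. hgeodesic UNIV e \<and> range e \<subseteq> N \<and> p ` range e = K \<and> meets_orthogonally I c s UNIV e u)"

text \<open>The ray \<open>\<gamma>\<close>, represented by a lift \<open>g\<close> that starts on the chosen lift \<open>a\<close> of \<open>\<alpha>\<close>,
  at parameter \<open>s\<close>.\<close>

definition gamma_ray ::
  "complex set \<Rightarrow> (complex \<Rightarrow> complex) \<Rightarrow> (real \<Rightarrow> complex) \<Rightarrow> real \<Rightarrow> (real \<Rightarrow> complex) \<Rightarrow> bool" where
  "gamma_ray N p a s g \<longleftrightarrow> hgeodesic {0..} g \<and> g ` {0..} \<subseteq> N \<and> inj_on (p \<circ> g) {0..} \<and>
     meets_orthogonally {0..} g 0 UNIV a s \<and> ((p \<circ> g) \<longlongrightarrow> 0) at_top"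

text \<open>The simple orthogeodesic from \<open>\<alpha>\<close> to \<open>\<alpha>\<^sub>2\<close>: a ray going out the puncture if \<open>\<alpha>\<^sub>2\<close> is one.\<close>

definition simple_orthogeodesic ::
  "bool \<Rightarrow> complex set \<Rightarrow> (complex \<Rightarrow> complex) \<Rightarrow> real set \<Rightarrow> (real \<Rightarrow> complex) \<Rightarrow> bool" where
  "simple_orthogeodesic cusp2 N p I d \<longleftrightarrow>
     hgeodesic I d \<and> d ` I \<subseteq> N \<and> inj_on (p \<circ> d) I \<and>
     orthogonal_to_boundary N p alpha_circle I d 0 \<and>
     (if cusp2 then I = {0..} \<and> ((p \<circ> d) \<longlongrightarrow> 1/2) at_top
      else (\<exists>m>0. I = {0..m} \<and> orthogonal_to_boundary N p alpha2_circle I d m))"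

text \<open>The bi-infinite geodesic \<open>\<beta>\<close>, represented by a lift \<open>b\<close>.\<close>

definition beta_geodesic ::
  "bool \<Rightarrow> complex set \<Rightarrow> (complex \<Rightarrow> complex) \<Rightarrow> (real \<Rightarrow> complex) \<Rightarrow> bool" where
  "beta_geodesic cusp2 N p b \<longleftrightarrow> hgeodesic UNIV b \<and> range b \<subseteq> N \<and> inj (p \<circ> b) \<and>
     ((p \<circ> b) \<longlongrightarrow> 0) at_top \<and> ((p \<circ> b) \<longlongrightarrow> 0) at_bot \<and>
     (\<exists>I d s u. simple_orthogeodesic cusp2 N p I d \<and> meets_orthogonally UNIV b s I d u)"


section \<open>Nonstandard half-collars and their gluing\<close>

text \<open>The half-collar is the part of the pair of pants between \<open>\<alpha>\<close> and \<open>\<beta>\<close>: the component containing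
  \<open>\<alpha>\<close> (the point \<open>1\<close> lies on \<open>\<alpha>\<close>) of the complement of \<open>\<beta>\<close>. It contains \<open>\<alpha>\<close> but not \<open>\<beta>\<close>.\<close>

definition half_collar :: "bool \<Rightarrow> (complex \<Rightarrow> complex) \<Rightarrow> (real \<Rightarrow> complex) \<Rightarrow> complex set" where
  "half_collar cusp2 p b = connected_component_set (pants cusp2 - p ` range b) 1"

text \<open>The component, along the lift \<open>a\<close> of \<open>\<alpha>\<close>, of the preimage of the half-collar.\<close>

definition half_collar_cover ::
  "bool \<Rightarrow> complex set \<Rightarrow> (complex \<Rightarrow> complex) \<Rightarrow> (real \<Rightarrow> complex) \<Rightarrow> (real \<Rightarrow> complex) \<Rightarrow> complex set" where
  "half_collar_cover cusp2 N p a b = connected_component_set (N \<inter> p -` half_collar cusp2 p b) (a 0)"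

text \<open>\<open>a\<close> lifts \<open>\<alpha>\<close>, \<open>s\<close> is the parameter of the foot of \<open>\<gamma>\<close>, \<open>b\<close> lifts \<open>\<beta>\<close>.\<close>

definition nonstandard_half_collar ::
  "bool \<Rightarrow> complex set \<Rightarrow> (complex \<Rightarrow> complex) \<Rightarrow> (real \<Rightarrow> complex) \<Rightarrow> real \<Rightarrow> real \<Rightarrow> (real \<Rightarrow> complex) \<Rightarrow> bool" where
  "nonstandard_half_collar cusp2 N p a l s b \<longleftrightarrow>
     hyperbolic_pants cusp2 N p \<and> lifts_alpha N p a l \<and>
     (\<exists>g. gamma_ray N p a s g) \<and> beta_geodesic cusp2 N p b"

text \<open>Distance on a circle of length \<open>l\<close>, i.e. the length of the shorter arc between the points
  with arc-length parameters \<open>s\<close> and \<open>s'\<close>.\<close>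

definition circle_dist :: "real \<Rightarrow> real \<Rightarrow> real \<Rightarrow> real" where
  "circle_dist l s s' = (INF k::int. \<bar>s - s' + of_int k * l\<bar>)"

text \<open>Gluing. The universal coverings are placed in one hyperbolic plane so that both boundary
  geodesics have the same unit-speed lift \<open>a\<close> and the two regions lie on opposite sides of it. The
  identification of \<open>\<alpha>\<close> with \<open>\<alpha>'\<close> is then \<open>p (a s) \<mapsto> p' (a s)\<close>. As \<open>a\<close> is an arbitrary
  parametrisation of either curve, this covers every isometric identification.

  The glued annulus is the quotient of the region \<open>glued_cover\<close> by the equivalence relation
  \<open>glued_rel\<close>, and \<open>joining_curves\<close> are the lifts of the curves in it from \<open>\<beta>\<close> to \<open>\<beta>'\<close>.\<close>

definition glued_with_twist ::
  "real \<Rightarrow> bool \<Rightarrow> complex set \<Rightarrow> (complex \<Rightarrow> complex) \<Rightarrow> (real \<Rightarrow> complex) \<Rightarrow>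
   bool \<Rightarrow> complex set \<Rightarrow> (complex \<Rightarrow> complex) \<Rightarrow> (real \<Rightarrow> complex) \<Rightarrow> (real \<Rightarrow> complex) \<Rightarrow> real \<Rightarrow> bool" where
  "glued_with_twist t cusp2 N p b cusp2' N' p' b' a l \<longleftrightarrow>
     N \<inter> N' = range a \<and>
     (\<exists>s s'. nonstandard_half_collar cusp2 N p a l s b \<and>
             nonstandard_half_collar cusp2' N' p' a l s' b' \<and>
             circle_dist l s s' = \<bar>t\<bar> * l)"

definition glued_cover ::
  "bool \<Rightarrow> complex set \<Rightarrow> (complex \<Rightarrow> complex) \<Rightarrow> (real \<Rightarrow> complex) \<Rightarrow>
   bool \<Rightarrow> complex set \<Rightarrow> (complex \<Rightarrow> complex) \<Rightarrow> (real \<Rightarrow> complex) \<Rightarrow> (real \<Rightarrow> complex) \<Rightarrow> complex set" where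
  "glued_cover cusp2 N p b cusp2' N' p' b' a =
     half_collar_cover cusp2 N p a b \<union> half_collar_cover cusp2' N' p' a b'"

definition glued_rel ::
  "bool \<Rightarrow> complex set \<Rightarrow> (complex \<Rightarrow> complex) \<Rightarrow> (real \<Rightarrow> complex) \<Rightarrow>
   bool \<Rightarrow> complex set \<Rightarrow> (complex \<Rightarrow> complex) \<Rightarrow> (real \<Rightarrow> complex) \<Rightarrow> (real \<Rightarrow> complex) \<Rightarrow>
   (complex \<times> complex) set" where
  "glued_rel cusp2 N p b cusp2' N' p' b' a =
     {(z, w). (z \<in> half_collar_cover cusp2 N p a b \<and> w \<in> half_collar_cover cusp2 N p a b \<and> p z = p w) \<or>
              (z \<in> half_collar_cover cusp2' N' p' a b' \<and> w \<in> half_collar_cover cusp2' N' p' a b' \<and> p' z = p' w)}"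

definition joining_curves ::
  "bool \<Rightarrow> complex set \<Rightarrow> (complex \<Rightarrow> complex) \<Rightarrow> (real \<Rightarrow> complex) \<Rightarrow>
   bool \<Rightarrow> complex set \<Rightarrow> (complex \<Rightarrow> complex) \<Rightarrow> (real \<Rightarrow> complex) \<Rightarrow> (real \<Rightarrow> complex) \<Rightarrow>
   (real \<Rightarrow> complex) set" where
  "joining_curves cusp2 N p b cusp2' N' p' b' a =
     {c. valid_path c \<and>
         pathstart c \<in> N \<and> p (pathstart c) \<in> p ` range b \<and>
         pathfinish c \<in> N' \<and> p' (pathfinish c) \<in> p' ` range b' \<and>
         c ` {0<..<1} \<subseteq> glued_cover cusp2 N p b cusp2' N' p' b' a}"


section \<open>Extremal length on a quotient surface\<close>

text \<open>Let \<open>U / E\<close> be a surface with a hyperbolic metric \<open>ds\<close> covered by the region \<open>U\<close> of the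
  hyperbolic plane. A conformal metric on it is \<open>\<rho> ds\<close> for a Borel function \<open>\<rho>\<close> that is constant on
  \<open>E\<close>-classes. Curves are represented by lifts, and the area is computed on a Borel fundamental set
  \<open>F\<close>; it does not depend on \<open>F\<close> when \<open>E\<close> is induced by a countable group of isometries.\<close>

definition rho_length :: "(complex \<Rightarrow> ennreal) \<Rightarrow> (real \<Rightarrow> complex) \<Rightarrow> ennreal" where
  "rho_length \<rho> c =
     (\<integral>\<^sup>+t\<in>{0<..<1}. \<rho> (c t) * ennreal (cmod (vector_derivative c (at t)) / Im (c t)) \<partial>lborel)"

definition rho_area :: "(complex \<Rightarrow> ennreal) \<Rightarrow> complex set \<Rightarrow> ennreal" where
  "rho_area \<rho> F = (\<integral>\<^sup>+z\<in>F. (\<rho> z)\<^sup>2 * ennreal (1 / (Im z)\<^sup>2) \<partial>lborel)"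

definition invariant_density :: "complex set \<Rightarrow> (complex \<times> complex) set \<Rightarrow> (complex \<Rightarrow> ennreal) \<Rightarrow> bool" where
  "invariant_density U E \<rho> \<longleftrightarrow> \<rho> \<in> borel_measurable borel \<and>
     (\<forall>z\<in>U. \<forall>w\<in>U. (z, w) \<in> E \<longrightarrow> \<rho> z = \<rho> w)"

definition fundamental_set :: "complex set \<Rightarrow> (complex \<times> complex) set \<Rightarrow> complex set \<Rightarrow> bool" where
  "fundamental_set U E F \<longleftrightarrow> F \<in> sets borel \<and> F \<subseteq> U \<and> (\<forall>z\<in>U. \<exists>!w. w \<in> F \<and> (z, w) \<in> E)"

definition extremal_length ::
  "complex set \<Rightarrow> (complex \<times> complex) set \<Rightarrow> (real \<Rightarrow> complex) set \<Rightarrow> ennreal" where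
  "extremal_length U E \<C> =
     Sup {(INF c\<in>\<C>. rho_length \<rho> c)\<^sup>2 / rho_area \<rho> F | \<rho> F.
            invariant_density U E \<rho> \<and> fundamental_set U E F \<and>
            0 < rho_area \<rho> F \<and> rho_area \<rho> F < \<infinity>}"

text \<open>The extremal length of the family of curves joining the boundary components of the glued
  annulus.\<close>

definition glued_extremal_length ::
  "bool \<Rightarrow> complex set \<Rightarrow> (complex \<Rightarrow> complex) \<Rightarrow> (real \<Rightarrow> complex) \<Rightarrow>
   bool \<Rightarrow> complex set \<Rightarrow> (complex \<Rightarrow> complex) \<Rightarrow> (real \<Rightarrow> complex) \<Rightarrow> (real \<Rightarrow> complex) \<Rightarrow> ennreal" where
  "glued_extremal_length cusp2 N p b cusp2' N' p' b' a =
     extremal_length (glued_cover cusp2 N p b cusp2' N' p' b' a)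
       (glued_rel cusp2 N p b cusp2' N' p' b' a)
       (joining_curves cusp2 N p b cusp2' N' p' b' a)"

end

theory Submission
  imports Defs "HOL-Complex_Analysis.Complex_Analysis"
begin

text \<open>
  The extremal length is a supremum over conformal metrics, so one metric \<open>\<rho> ds\<close> suffices: it gives
  the lower bound \<open>L\<^sup>2 / A\<close>, where \<open>A\<close> is its area and \<open>L\<close> the infimum of the lengths of the joining
  curves. The metric lives in a thin collar about \<open>\<alpha>\<close>.

  \<^emph>\<open>How much room there is about \<open>\<alpha>\<close>.\<close> Carry the lift of \<open>\<alpha>\<close> to the imaginary axis. The lifts of \<open>\<gamma>\<close>
  that start on it become quarter circles centred at \<open>0\<close>, with logarithms of radii \<open>s + k l\<close>, where \<open>s\<close> is
  the foot of \<open>\<gamma>\<close>. Since \<open>\<gamma>\<close> and \<open>\<beta>\<close> do not meet (\<open>gamma_beta_disjoint\<close>), a lift of \<open>\<beta>\<close> lies between two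
  neighbouring quarter circles, and a complete geodesic trapped there passes at distance at least of order
  \<open>exp (- d u)\<close> from the axis at position \<open>u\<close>, where \<open>d u\<close> is the distance on \<open>\<alpha>\<close> from \<open>u\<close> to the foot of
  \<open>\<gamma>\<close> (\<open>beta_far\<close>). So a curve in the annulus from \<open>\<alpha>\<close> to \<open>\<beta>\<close> has to cross a collar of that width.

  \<^emph>\<open>Why \<open>\<gamma>\<close> and \<open>\<beta>\<close> do not meet.\<close> At the last crossing along \<open>\<gamma>\<close>, three geodesic rays out the puncture
  would start at one point and be disjoint otherwise. Two of them close up at the puncture to a Jordan
  curve. If it did not enclose the other end \<open>\<alpha>\<^sub>2\<close>, both rays would lie in a simply connected region and lift
  to rays from one point into the same cusp, where they would agree
  (\<open>cusp_ray_pair_encloses_second_end\<close>). Hence the winding numbers of the three closed-up rays about \<open>\<alpha>\<^sub>2\<close>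
  differ pairwise by \<open>1\<close> or \<open>-1\<close>, which parity forbids (\<open>no_three_cusp_rays\<close>).

  \<^emph>\<open>The metric.\<close> Let \<open>\<delta> u\<close> be the distance from \<open>u\<close> to the nearer one of the feet of \<open>\<gamma>\<close> and \<open>\<gamma>'\<close>, and let
  \<open>\<rho>\<close> be of order \<open>exp (\<delta> u)\<close> in the two collars and \<open>0\<close> elsewhere. A joining curve crosses both collars.
  If it moves by \<open>1\<close> along \<open>\<alpha>\<close> inside them, it has length at least \<open>1\<close>, as \<open>\<rho> \<ge> 1\<close> there. Otherwise \<open>\<rho>\<close>
  is constant up to a bounded factor along the crossing, and the wider collar has width of order
  \<open>exp (- \<delta> u)\<close>; in both cases the length is bounded below (\<open>crossing_length\<close>). A collar of width
  \<open>exp (- d u) \<le> exp (- \<delta> u)\<close> has area at most of order \<open>\<integral> exp (2 \<delta> u) exp (- \<delta> u) du = \<integral> exp (\<delta> u) du\<close> over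
  one period. On each of the two arcs between the feet \<open>\<delta>\<close> is a tent with slopes \<open>\<plusminus>1\<close>, so the integral is
  of the order of \<open>exp X\<close>, where \<open>X\<close> is the maximum of \<open>\<delta>\<close>, half the longer arc:
  \<open>X = (l - \<bar>t\<bar> l) / 2\<close> (\<open>weighted_collar_area\<close>). Thus \<open>L\<^sup>2 / A\<close> is at least of order \<open>exp (- X)\<close>.

  \<^emph>\<open>Passing to the quotient.\<close> A density has to be constant on the fibres of the covering, and the area is
  taken over a Borel set that meets each fibre once. The density is therefore the largest value of
  \<open>exp (\<delta> u)\<close>, rounded to integral exponents, over the points of a fibre in the collar, and the
  fundamental set picks from each fibre a point at which this largest value is attained
  (\<open>priority_section\<close>, \<open>collar_fundamental_set\<close>).
\<close>

section \<open>Geodesics and isometries of the hyperbolic plane\<close>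

definition mob :: "real \<Rightarrow> real \<Rightarrow> real \<Rightarrow> real \<Rightarrow> complex \<Rightarrow> complex" where
  "mob a b c d z = (of_real a * z + of_real b) / (of_real c * z + of_real d)"

definition iaxis :: "real \<Rightarrow> complex" where
  "iaxis t = Complex 0 (exp t)"

lemma iaxis_simps [simp]: "Re (iaxis t) = 0" "Im (iaxis t) = exp t" "iaxis t \<in> uhp" "cmod (iaxis t) = exp t"
  by (auto simp: iaxis_def uhp_def cmod_def)

lemma cosh_hdist:
  assumes "z \<in> uhp" "w \<in> uhp"
  shows "cosh (hdist z w) = 1 + (cmod (z - w))\<^sup>2 / (2 * Im z * Im w)"
  using assms by (simp add: hdist_def uhp_def)

lemma hdist_nonneg: "z \<in> uhp \<Longrightarrow> w \<in> uhp \<Longrightarrow> 0 \<le> hdist z w"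
  by (simp add: hdist_def uhp_def)

lemma hdist_refl [simp]: "hdist z z = 0"
  by (simp add: hdist_def)

lemma hdist_eq_iff:
  assumes "z \<in> uhp" "w \<in> uhp" "r \<ge> 0"
  shows "hdist z w = r \<longleftrightarrow> (cmod (z - w))\<^sup>2 = 2 * Im z * Im w * (cosh r - 1)"
proof -
  have "hdist z w = r \<longleftrightarrow> cosh (hdist z w) = cosh r"
    using assms hdist_nonneg[OF assms(1,2)] by (metis arcosh_cosh_real)
  also have "\<dots> \<longleftrightarrow> (cmod (z - w))\<^sup>2 = 2 * Im z * Im w * (cosh r - 1)"
    using assms by (auto simp: cosh_hdist uhp_def field_simps)
  finally show ?thesis .
qed

lemma mob_denom_nonzero:
  assumes "a * d - b * c = 1" "z \<in> uhp"
  shows "of_real c * z + of_real d \<noteq> 0"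
proof
  assume h: "of_real c * z + of_real d = 0"
  from arg_cong[OF h, of Im] have "c * Im z = 0" by simp
  with assms have "c = 0" by (auto simp: uhp_def)
  with h assms(1) show False by auto
qed

lemma mob_diff:
  assumes "a * d - b * c = 1" "z \<in> uhp" "w \<in> uhp"
  shows "mob a b c d z - mob a b c d w
    = (z - w) / ((of_real c * z + of_real d) * (of_real c * w + of_real d))"
proof -
  have "of_real a * of_real d - of_real b * of_real c = (1::complex)"
    using arg_cong[OF assms(1), of complex_of_real] by simp
  then have "(of_real a * z + of_real b) * (of_real c * w + of_real d)
      - (of_real a * w + of_real b) * (of_real c * z + of_real d) = z - w"
    by algebra
  then show ?thesis
    using mob_denom_nonzero[OF assms(1,2)] mob_denom_nonzero[OF assms(1,3)]
    by (simp add: mob_def diff_frac_eq)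
qed

lemma Im_mob:
  assumes "a * d - b * c = 1"
  shows "Im (mob a b c d z) = Im z / (cmod (of_real c * z + of_real d))\<^sup>2"
proof -
  have "Im (mob a b c d z) = (a * d - b * c) * Im z / (cmod (of_real c * z + of_real d))\<^sup>2"
    unfolding mob_def by (simp add: Im_divide cmod_power2 algebra_simps)
  then show ?thesis using assms by simp
qed

lemma mob_uhp:
  assumes "a * d - b * c = 1" "z \<in> uhp"
  shows "mob a b c d z \<in> uhp"
  using assms mob_denom_nonzero[OF assms] by (auto simp: uhp_def Im_mob)

lemma hdist_mob:
  assumes "a * d - b * c = 1" "z \<in> uhp" "w \<in> uhp"
  shows "hdist (mob a b c d z) (mob a b c d w) = hdist z w"
proof -
  define p q where "p = of_real c * z + of_real d" and "q = of_real c * w + of_real d"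
  have nz: "cmod p \<noteq> 0" "cmod q \<noteq> 0"
    using mob_denom_nonzero[OF assms(1,2)] mob_denom_nonzero[OF assms(1,3)] by (auto simp: p_def q_def)
  have "(cmod ((z - w) / (p * q)))\<^sup>2 / (2 * (Im z / (cmod p)\<^sup>2) * (Im w / (cmod q)\<^sup>2))
      = (cmod (z - w))\<^sup>2 / (2 * Im z * Im w)"
    using nz by (simp add: norm_divide norm_mult power_divide power_mult_distrib)
  then show ?thesis
    unfolding hdist_def mob_diff[OF assms] Im_mob[OF assms(1)] p_def q_def by (simp only:)
qed

lemma mob_compose:
  assumes "a' * d' - b' * c' = 1" "z \<in> uhp"
  shows "mob a b c d (mob a' b' c' d' z)
    = mob (a * a' + b * c') (a * b' + b * d') (c * a' + d * c') (c * b' + d * d') z"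
proof -
  define p q where "p = of_real a' * z + of_real b'" and "q = of_real c' * z + of_real d'"
  have q: "q \<noteq> 0" using mob_denom_nonzero[OF assms] by (simp add: q_def)
  have "of_real x * (p / q) + of_real y = (of_real x * p + of_real y * q) / q" for x y
    using q by (simp add: field_simps)
  then have "mob a b c d (p / q) = (of_real a * p + of_real b * q) / (of_real c * p + of_real d * q)"
    using q by (simp add: mob_def)
  then show ?thesis
    by (simp add: mob_def p_def q_def algebra_simps)
qed

lemma mob_det_compose:
  assumes "a * d - b * c = (1::real)" "a' * d' - b' * c' = 1"
  shows "(a * a' + b * c') * (c * b' + d * d') - (a * b' + b * d') * (c * a' + d * c') = 1"
  using assms by algebra

lemma mob_id: "mob 1 0 0 1 z = z"
  by (simp add: mob_def)

lemma mob_inverse: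
  assumes "a * d - b * c = 1" "z \<in> uhp"
  shows "mob d (-b) (-c) a (mob a b c d z) = z"
proof -
  have "mob d (-b) (-c) a (mob a b c d z) = mob 1 0 0 1 z"
    using assms by (simp add: mob_compose) (simp add: algebra_simps)
  then show ?thesis by (simp add: mob_id)
qed

lemma mob_inverse':
  assumes "a * d - b * c = 1" "z \<in> uhp"
  shows "mob a b c d (mob d (-b) (-c) a z) = z"
  using mob_inverse[of d a "-b" "-c" z] assms by (simp add: algebra_simps)

text \<open>Along the image of the imaginary axis these three quotients are combinations of \<open>exp t\<close> and
  \<open>exp (-t)\<close>, so inequalities between \<open>1\<close>, \<open>Re z\<close> and \<open>\<bar>z\<bar>\<^sup>2\<close> along a geodesic become inequalities between the
  coefficients.\<close>

lemma mob_coordinates: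
  assumes det: "a * d - b * c = 1" and z: "z = mob a b c d (iaxis t)"
  shows "1 / Im z = c\<^sup>2 * exp t + d\<^sup>2 * exp (-t)"
    and "Re z / Im z = a * c * exp t + b * d * exp (-t)"
    and "(cmod z)\<^sup>2 / Im z = a\<^sup>2 * exp t + b\<^sup>2 * exp (-t)"
proof -
  let ?q = "(cmod (of_real c * iaxis t + of_real d))\<^sup>2"
  have q: "?q = c\<^sup>2 * (exp t)\<^sup>2 + d\<^sup>2"
    by (simp add: cmod_power2 power_mult_distrib)
  have q0: "?q \<noteq> 0"
    using mob_denom_nonzero[OF det, of "iaxis t"] by simp
  have im: "Im z = exp t / ?q"
    unfolding z Im_mob[OF det] by simp
  have re: "Re z = (a * c * (exp t)\<^sup>2 + b * d) / ?q"
    unfolding z mob_def q by (simp add: Re_divide power_mult_distrib power2_eq_square algebra_simps)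
  have no: "(cmod z)\<^sup>2 = (a\<^sup>2 * (exp t)\<^sup>2 + b\<^sup>2) / ?q"
    unfolding z mob_def by (simp add: norm_divide power_divide cmod_power2 power_mult_distrib)
  have key: "(x * (exp t)\<^sup>2 + y) / exp t = x * exp t + y * exp (-t)" for x y :: real
    by (simp add: exp_minus field_simps power2_eq_square)
  have "1 / Im z = (c\<^sup>2 * (exp t)\<^sup>2 + d\<^sup>2) / exp t" unfolding im q by simp
  then show "1 / Im z = c\<^sup>2 * exp t + d\<^sup>2 * exp (-t)"
    unfolding key .
  show "Re z / Im z = a * c * exp t + b * d * exp (-t)"
  proof -
    have "Re z / Im z = (a * c * (exp t)\<^sup>2 + b * d) / exp t"
    proof -
      have "(x / y) / (w / y) = x / w" if "y \<noteq> 0" for x y w :: real using that by simp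
      then show ?thesis unfolding im re using q0 by blast
    qed
    then show ?thesis unfolding key .
  qed
  show "(cmod z)\<^sup>2 / Im z = a\<^sup>2 * exp t + b\<^sup>2 * exp (-t)"
  proof -
    have "(cmod z)\<^sup>2 / Im z = (a\<^sup>2 * (exp t)\<^sup>2 + b\<^sup>2) / exp t"
      unfolding im no using q0 by simp
    then show ?thesis unfolding key .
  qed
qed

lemma hdist_axis_eq:
  assumes "z \<in> uhp" "hdist z (iaxis s) = \<bar>r\<bar>"
  shows "(cmod z)\<^sup>2 + (exp s)\<^sup>2 = 2 * Im z * exp s * cosh r"
proof -
  have "(cmod (z - iaxis s))\<^sup>2 = 2 * Im z * exp s * (cosh r - 1)"
    using hdist_eq_iff[OF assms(1), of "iaxis s" "\<bar>r\<bar>"] assms(2) by simp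
  moreover have "(cmod (z - iaxis s))\<^sup>2 = (cmod z)\<^sup>2 - 2 * Im z * exp s + (exp s)\<^sup>2"
    unfolding cmod_power2 by (simp add: power2_eq_square algebra_simps)
  ultimately show ?thesis by (simp add: algebra_simps)
qed

lemma hdist_axis_axis: "hdist (iaxis s) (iaxis t) = \<bar>s - t\<bar>"
proof -
  have "(cmod (iaxis s - iaxis t))\<^sup>2 = (exp s - exp t)\<^sup>2"
    by (simp add: cmod_power2)
  moreover have "2 * exp s * exp t * (cosh (s - t) - 1) = (exp s - exp t)\<^sup>2"
    by (simp add: cosh_field_def exp_diff exp_minus field_simps power2_eq_square)
  ultimately show ?thesis
    by (subst hdist_eq_iff) auto
qed

text \<open>Distances to two points of a geodesic determine a point of that geodesic.\<close>

lemma axis_unique: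
  assumes z: "z \<in> uhp" and s: "s \<noteq> s'"
    and d1: "hdist z (iaxis s) = \<bar>t - s\<bar>" and d2: "hdist z (iaxis s') = \<bar>t - s'\<bar>"
  shows "z = iaxis t"
proof -
  have eq: "(cmod z)\<^sup>2 + (exp r)\<^sup>2 = Im z * (exp t + (exp r)\<^sup>2 / exp t)" if "hdist z (iaxis r) = \<bar>t - r\<bar>" for r
  proof -
    have "2 * exp r * cosh (t - r) = exp t + (exp r)\<^sup>2 / exp t"
      by (simp add: cosh_field_def exp_diff field_simps power2_eq_square)
    then show ?thesis using hdist_axis_eq[OF z that] by (simp add: mult.assoc)
  qed
  have ne: "(exp s)\<^sup>2 - (exp s')\<^sup>2 \<noteq> 0"
    using s by (simp add: power2_eq_iff) (smt (verit) exp_gt_zero)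
  have "((exp s)\<^sup>2 - (exp s')\<^sup>2) * (Im z / exp t) = (exp s)\<^sup>2 - (exp s')\<^sup>2"
    using eq[OF d1] eq[OF d2] by (simp add: field_simps)
  then have im: "Im z = exp t"
    using ne by (metis mult_cancel_left1 mult_cancel_left2 divide_eq_1_iff exp_not_eq_zero times_divide_eq_right)
  have "(cmod z)\<^sup>2 = (exp t)\<^sup>2"
    using eq[OF d1] im by (simp add: field_simps power2_eq_square)
  then have "Re z = 0" using im by (simp add: cmod_power2)
  then show ?thesis using im by (simp add: complex_eq_iff)
qed

text \<open>Move \<open>z\<close> to \<open>\<i>\<close> by an affine map; a rotation about \<open>\<i>\<close> then turns the image of \<open>w\<close> into the axis.\<close>

lemma two_points_normal_form:
  assumes "z \<in> uhp" "w \<in> uhp"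
  obtains a b c d where "a * d - b * c = 1" "z = mob a b c d (iaxis 0)"
    "w = mob a b c d (iaxis (hdist z w))"
proof (cases "z = w")
  case True
  define y where "y = Im z"
  have y: "y > 0" using assms by (simp add: y_def uhp_def)
  have "sqrt y * (1 / sqrt y) - Re z / sqrt y * 0 = 1" using y by simp
  moreover have "z = mob (sqrt y) (Re z / sqrt y) 0 (1 / sqrt y) (iaxis 0)"
    using y by (simp add: mob_def complex_eq_iff iaxis_def Re_divide Im_divide y_def power2_eq_square field_simps)
  ultimately show ?thesis using that[of "sqrt y" "1 / sqrt y" "Re z / sqrt y" 0] True y by simp
next
  case False
  define y where "y = Im z"
  have y: "y > 0" using assms by (simp add: y_def uhp_def)
  define A where "A = sqrt y"
  define B where "B = Re z / sqrt y"
  have det1: "A * (1/A) - B * 0 = 1" using y by (simp add: A_def)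
  have z1: "z = mob A B 0 (1/A) (iaxis 0)"
    using y by (simp add: A_def B_def mob_def complex_eq_iff iaxis_def Re_divide Im_divide y_def power2_eq_square field_simps)
  define w1 where "w1 = mob (1/A) (-B) 0 A w"
  have w1: "w1 \<in> uhp" unfolding w1_def by (rule mob_uhp) (use det1 assms in \<open>auto simp: mult_ac\<close>)
  have w1': "w = mob A B 0 (1/A) w1"
    unfolding w1_def using mob_inverse'[OF det1, of w] assms by simp
  have hd: "hdist (iaxis 0) w1 = hdist z w"
    using hdist_mob[OF det1, of "iaxis 0" w1] w1 z1 w1' by simp
  define h where "h = (\<lambda>x. Re (mob (cos x) (sin x) (- sin x) (cos x) w1))"
  have det2: "cos x * cos x - sin x * (- sin x) = 1" for x :: real
    by (metis add.commute diff_minus_eq_add mult_minus_right power2_eq_square sin_cos_squared_add)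
  have cont: "continuous_on {0..pi/2} h"
    unfolding h_def mob_def
    by (intro continuous_intros ballI mob_denom_nonzero[OF det2 w1])
  have h0: "h 0 = Re w1" by (simp add: h_def mob_def)
  \<comment> \<open>for \<open>x = pi / 2\<close> the rotation is \<open>z \<mapsto> - 1 / z\<close>, so \<open>h\<close> changes sign\<close>
  have h1: "h (pi/2) = - Re w1 / (cmod w1)\<^sup>2"
    by (simp add: h_def mob_def Re_divide cmod_power2)
  have "\<exists>x. h x = 0"
  proof (cases "Re w1 \<ge> 0")
    case True
    then have "h (pi/2) \<le> 0" by (simp add: h1)
    then have "\<exists>x. 0 \<le> x \<and> x \<le> pi/2 \<and> h x = 0"
      by (intro IVT2') (use True h0 cont in auto)
    then show ?thesis by blast
  next
    case False
    then have "h (pi/2) \<ge> 0" by (simp add: h1 divide_nonpos_nonneg)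
    then have "\<exists>x. 0 \<le> x \<and> x \<le> pi/2 \<and> h x = 0"
      by (intro IVT') (use False h0 cont in auto)
    then show ?thesis by blast
  qed
  then obtain x where hx: "h x = 0" ..
  have fix_i: "mob (cos y) (sin y) (- sin y) (cos y) (iaxis 0) = iaxis 0" for y
  proof -
    have "of_real (cos y) * iaxis 0 + of_real (sin y) = iaxis 0 * (of_real (- sin y) * iaxis 0 + of_real (cos y))"
      by (simp add: complex_eq_iff iaxis_def)
    then show ?thesis
      using mob_denom_nonzero[OF det2, of "iaxis 0" y] by (simp add: mob_def)
  qed
  define v where "v = mob (cos x) (sin x) (- sin x) (cos x) w1"
  have v: "v \<in> uhp" unfolding v_def by (rule mob_uhp[OF det2 w1])
  have "\<exists>y. mob (cos y) (sin y) (- sin y) (cos y) w1 = iaxis (hdist z w)"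
  proof (cases "Im v \<ge> 1")
    case True
    have vv: "v = iaxis (ln (Im v))"
      using hx v by (simp add: v_def[symmetric] h_def complex_eq_iff uhp_def)
    have "hdist (iaxis 0) v = ln (Im v)"
      using vv True hdist_axis_axis[of 0 "ln (Im v)"] by simp
    moreover have "hdist (iaxis 0) v = hdist (iaxis 0) w1"
      using hdist_mob[OF det2, of "iaxis 0" w1 x] fix_i[of x] w1 by (simp add: v_def)
    ultimately have "iaxis (hdist z w) = v" using vv hd by simp
    then show ?thesis unfolding v_def by metis
  next
    case False
    have vv: "v = iaxis (ln (Im v))"
      using hx v by (simp add: v_def[symmetric] h_def complex_eq_iff uhp_def)
    have neg: "ln (Im v) < 0" using False v by (simp add: uhp_def)
    have "hdist (iaxis 0) v = - ln (Im v)"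
      using vv neg hdist_axis_axis[of 0 "ln (Im v)"] by simp
    moreover have "hdist (iaxis 0) v = hdist (iaxis 0) w1"
      using hdist_mob[OF det2, of "iaxis 0" w1 x] fix_i[of x] w1 by (simp add: v_def)
    ultimately have e: "hdist z w = - ln (Im v)" using hd by simp
    \<comment> \<open>the rotated point is on the axis below \<open>\<i>\<close>; \<open>z \<mapsto> - 1 / z\<close> carries it above\<close>
    have "mob (cos (x + pi/2)) (sin (x + pi/2)) (- sin (x + pi/2)) (cos (x + pi/2)) w1
        = mob 0 1 (-1) 0 v"
      unfolding v_def using w1 det2[of x] by (subst mob_compose) (auto simp: cos_add sin_add)
    also have "\<dots> = mob 0 1 (-1) 0 (iaxis (ln (Im v)))" using vv by simp
    also have "\<dots> = iaxis (hdist z w)"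
      unfolding e by (simp add: mob_def complex_eq_iff Re_divide Im_divide exp_minus power2_eq_square field_simps)
    finally show ?thesis by blast
  qed
  then obtain y where yy: "mob (cos y) (sin y) (- sin y) (cos y) w1 = iaxis (hdist z w)" ..
  define C S where "C = cos y" and "S = sin y"
  have dCS: "C * C - S * (-S) = 1" unfolding C_def S_def by (rule det2)
  have dCS': "C * C - (-S) * S = 1" using dCS by simp
  have zz: "mob C (-S) S C (iaxis 0) = iaxis 0"
    using fix_i[of "-y"] by (simp add: C_def S_def)
  have ww: "mob C (-S) S C (iaxis (hdist z w)) = w1"
    using mob_inverse[OF dCS w1] yy by (simp add: C_def S_def)
  show ?thesis
  proof (rule that)
    show "(A * C + B * S) * (0 * (-S) + 1/A * C) - (A * (-S) + B * C) * (0 * C + 1/A * S) = 1"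
      using mob_det_compose[OF det1 dCS'] .
    show "z = mob (A * C + B * S) (A * (-S) + B * C) (0 * C + 1/A * S) (0 * (-S) + 1/A * C) (iaxis 0)"
      using mob_compose[OF dCS', of "iaxis 0" A B 0 "1/A"] zz z1 by simp
    show "w = mob (A * C + B * S) (A * (-S) + B * C) (0 * C + 1/A * S) (0 * (-S) + 1/A * C) (iaxis (hdist z w))"
      using mob_compose[OF dCS', of "iaxis (hdist z w)" A B 0 "1/A"] ww w1' by simp
  qed
qed

lemma mob_axis_shift:
  assumes "a * d - b * c = 1"
  obtains a' b' c' d' where "a' * d' - b' * c' = 1"
    "\<And>t. mob a' b' c' d' (iaxis t) = mob a b c d (iaxis (t - s))"
proof -
  have det: "exp (-s/2) * exp (s/2) - 0 * 0 = (1::real)"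
    by (simp add: exp_minus flip: exp_add)
  have "mob (exp (-s/2)) 0 0 (exp (s/2)) (iaxis t) = iaxis (t - s)" for t
    by (simp add: mob_def complex_eq_iff Im_divide power2_eq_square flip: exp_add exp_diff)
  then show ?thesis
    using that[OF mob_det_compose[OF assms det]] mob_compose[OF det, of "iaxis _" a b c d] by simp
qed

lemma hgeodesic_mob_axis:
  assumes "a * d - b * c = 1"
  shows "hgeodesic I (\<lambda>t. mob a b c d (iaxis t))"
  unfolding hgeodesic_def using assms by (auto simp: hdist_mob hdist_axis_axis mob_uhp)

text \<open>Normalise two points of the geodesic; every further point is then determined by its distances
  to these two.\<close>

lemma hgeodesic_normal_form:
  assumes g: "hgeodesic I g"
  obtains a b c d where "a * d - b * c = 1" "\<And>t. t \<in> I \<Longrightarrow> g t = mob a b c d (iaxis t)"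
proof (cases "\<exists>s\<in>I. \<exists>t\<in>I. s < t")
  case True
  then obtain s t where st: "s \<in> I" "t \<in> I" "s < t" by blast
  have in_uhp: "g r \<in> uhp" if "r \<in> I" for r using g that by (auto simp: hgeodesic_def)
  have dist: "hdist (g r) (g r') = \<bar>r - r'\<bar>" if "r \<in> I" "r' \<in> I" for r r'
    using g that by (auto simp: hgeodesic_def)
  obtain a b c d where 1: "a * d - b * c = 1" "g s = mob a b c d (iaxis 0)"
    "g t = mob a b c d (iaxis (hdist (g s) (g t)))"
    by (rule two_points_normal_form[OF in_uhp[OF st(1)] in_uhp[OF st(2)]])
  obtain a' b' c' d' where 2: "a' * d' - b' * c' = 1"
    "\<And>t. mob a' b' c' d' (iaxis t) = mob a b c d (iaxis (t - s))"
    by (rule mob_axis_shift[OF 1(1), where s = s]) blast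
  have "g r = mob a' b' c' d' (iaxis r)" if r: "r \<in> I" for r
  proof -
    define z where "z = mob d' (-b') (-c') a' (g r)"
    have det': "d' * a' - (-b') * (-c') = 1" using 2(1) by (simp add: algebra_simps)
    have z: "z \<in> uhp" unfolding z_def by (rule mob_uhp[OF det' in_uhp[OF r]])
    have gz: "g r = mob a' b' c' d' z"
      unfolding z_def using mob_inverse'[OF 2(1) in_uhp[OF r]] by simp
    have gs: "g s = mob a' b' c' d' (iaxis s)" using 1(2) 2(2) by simp
    have gt: "g t = mob a' b' c' d' (iaxis t)" using 1(3) 2(2) st dist[of s t] by simp
    have "z = iaxis r"
    proof (rule axis_unique[OF z])
      show "s \<noteq> t" using st by simp
      show "hdist z (iaxis s) = \<bar>r - s\<bar>"
        using dist[OF r st(1)] hdist_mob[OF 2(1) z, of "iaxis s"] gz gs by simp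
      show "hdist z (iaxis t) = \<bar>r - t\<bar>"
        using dist[OF r st(2)] hdist_mob[OF 2(1) z, of "iaxis t"] gz gt by simp
    qed
    with gz show ?thesis by simp
  qed
  with 2(1) show ?thesis using that by blast
next
  case False
  then have single: "\<exists>s. I \<subseteq> {s}"
  proof (cases "I = {}")
    case False
    then obtain s where "s \<in> I" by blast
    then have "I \<subseteq> {s}" using \<open>\<not> (\<exists>s\<in>I. \<exists>t\<in>I. s < t)\<close> by (metis linorder_less_linear singletonI subsetI)
    then show ?thesis ..
  qed simp
  then obtain s where s: "I \<subseteq> {s}" by blast
  define z where "z = (if s \<in> I then g s else iaxis 0)"
  have zu: "z \<in> uhp" using g by (auto simp: z_def hgeodesic_def)
  obtain a b c d where 1: "a * d - b * c = 1" "z = mob a b c d (iaxis 0)"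
    by (rule two_points_normal_form[OF zu zu]) blast
  obtain a' b' c' d' where 2: "a' * d' - b' * c' = 1"
    "\<And>t. mob a' b' c' d' (iaxis t) = mob a b c d (iaxis (t - s))"
    by (rule mob_axis_shift[OF 1(1), where s = s]) blast
  show ?thesis
  proof (rule that[OF 2(1)])
    fix t assume t: "t \<in> I"
    then have "t = s" using s by blast
    then show "g t = mob a' b' c' d' (iaxis t)" using 1(2) 2(2)[of s] t by (simp add: z_def)
  qed
qed

lemma hgeodesic_unique:
  assumes f: "hgeodesic I f" and g: "hgeodesic I g"
    and st: "s \<in> I" "t \<in> I" "s \<noteq> t" "f s = g s" "f t = g t" and r: "r \<in> I"
  shows "f r = g r"
proof -
  obtain a b c d where 1: "a * d - b * c = 1" "\<And>t. t \<in> I \<Longrightarrow> g t = mob a b c d (iaxis t)"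
    by (rule hgeodesic_normal_form[OF g]) blast
  have fr: "f r \<in> uhp" using f r by (auto simp: hgeodesic_def)
  have dist: "hdist (f r) (f r') = \<bar>r - r'\<bar>" if "r' \<in> I" for r'
    using f that r by (auto simp: hgeodesic_def)
  define z where "z = mob d (-b) (-c) a (f r)"
  have det': "d * a - (-b) * (-c) = 1" using 1(1) by (simp add: algebra_simps)
  have z: "z \<in> uhp" unfolding z_def by (rule mob_uhp[OF det' fr])
  have fz: "f r = mob a b c d z"
    unfolding z_def using mob_inverse'[OF 1(1) fr] by simp
  have "z = iaxis r"
    using axis_unique[OF z st(3), of r] dist[OF st(1)] dist[OF st(2)]
      hdist_mob[OF 1(1) z, of "iaxis s"] hdist_mob[OF 1(1) z, of "iaxis t"] fz st 1(2)
    by simp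
  then show ?thesis using fz 1(2)[OF r] by simp
qed

lemma continuous_on_axis [continuous_intros]: "continuous_on A iaxis"
  unfolding iaxis_def complex_eq by (intro continuous_intros)

lemma continuous_on_mob:
  assumes "a * d - b * c = 1" shows "continuous_on uhp (mob a b c d)"
  unfolding mob_def by (intro continuous_intros ballI mob_denom_nonzero[OF assms])

lemma hgeodesic_continuous:
  assumes g: "hgeodesic I g" shows "continuous_on I g"
proof -
  obtain a b c d where 1: "a * d - b * c = 1" "\<And>t. t \<in> I \<Longrightarrow> g t = mob a b c d (iaxis t)"
    by (rule hgeodesic_normal_form[OF g]) blast
  have "continuous_on I (\<lambda>t. mob a b c d (iaxis t))"
    by (rule continuous_on_compose2[OF continuous_on_mob[OF 1(1)] continuous_on_axis]) auto
  then show ?thesis using 1(2) by (simp cong: continuous_on_cong)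
qed

lemma hgeodesic_inj:
  assumes "hgeodesic I g" shows "inj_on g I"
proof (rule inj_onI)
  fix s t assume st: "s \<in> I" "t \<in> I" "g s = g t"
  then have "\<bar>s - t\<bar> = hdist (g s) (g t)" using assms unfolding hgeodesic_def by metis
  then show "s = t" using st by simp
qed

text \<open>Equality holds if \<open>w\<close> is vertically above \<open>z\<close>. The bound makes hyperbolic isometries continuous
  in the Euclidean topology.\<close>

lemma norm_diff_le_hdist:
  assumes "z \<in> uhp" "w \<in> uhp"
  shows "cmod (z - w) \<le> Im z * (exp (hdist z w) - 1)"
proof (rule ccontr)
  define d where "d = hdist z w"
  define x where "x = cmod (z - w) / Im z"
  define m where "m = exp d - 1"
  have pos: "Im z > 0" "Im w > 0" using assms by (auto simp: uhp_def)
  have d0: "d \<ge> 0" using assms by (simp add: d_def hdist_nonneg)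
  assume "\<not> ?thesis"
  then have xm: "x > m" using pos by (simp add: x_def m_def d_def field_simps)
  have m0: "m \<ge> 0" using d0 by (simp add: m_def)
  have "Im w \<le> Im z + cmod (z - w)"
    using abs_Im_le_cmod[of "w - z"] by (simp add: norm_minus_commute)
  moreover have "Im z * (1 + x) = Im z + cmod (z - w)" using pos by (simp add: x_def field_simps)
  ultimately have w: "Im w \<le> Im z * (1 + x)" by simp
  have "(cmod (z - w))\<^sup>2 = 2 * Im z * Im w * (cosh d - 1)"
    using hdist_eq_iff[OF assms d0] by (simp add: d_def)
  then have "(x * Im z)\<^sup>2 = 2 * Im z * Im w * (cosh d - 1)"
    using pos by (simp add: x_def)
  also have "\<dots> \<le> 2 * Im z * (Im z * (1 + x)) * (cosh d - 1)"
    using pos w cosh_real_ge_1[of d] by (intro mult_right_mono mult_left_mono) auto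
  finally have "(Im z)\<^sup>2 * x\<^sup>2 \<le> (Im z)\<^sup>2 * ((1 + x) * (2 * (cosh d - 1)))"
    by (simp add: power2_eq_square algebra_simps)
  then have x2: "x\<^sup>2 \<le> (1 + x) * (2 * (cosh d - 1))"
    using pos by (simp add: mult_le_cancel_left_pos)
  have c: "2 * (cosh d - 1) = m\<^sup>2 / (1 + m)"
    by (simp add: m_def cosh_field_def exp_minus field_simps power2_eq_square)
  have "x\<^sup>2 * (1 + m) \<le> (1 + x) * m\<^sup>2"
    using x2 m0 unfolding c by (simp add: field_simps)
  moreover have "(1 + x) * m\<^sup>2 < x\<^sup>2 * (1 + m)"
  proof -
    have "x\<^sup>2 * (1 + m) - (1 + x) * m\<^sup>2 = (x - m) * (x + m + x * m)"
      by (simp add: power2_eq_square algebra_simps)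
    moreover have "(x - m) * (x + m + x * m) > 0"
      using xm m0 by (intro mult_pos_pos) (auto intro: add_pos_nonneg)
    ultimately show ?thesis by linarith
  qed
  ultimately show False by linarith
qed

lemma open_uhp: "open uhp"
  unfolding uhp_def by (simp add: open_halfspace_Im_gt)

lemma hisometry_uhp: "hisometry f \<Longrightarrow> z \<in> uhp \<Longrightarrow> f z \<in> uhp"
  by (auto simp: hisometry_def bij_betw_def)

lemma hisometry_continuous:
  assumes f: "hisometry f" shows "continuous_on uhp f"
  unfolding continuous_on_def
proof
  fix z assume z: "z \<in> uhp"
  have ev: "eventually (\<lambda>w. w \<in> uhp) (at z within uhp)"
    by (simp add: eventually_at_filter)
  have "((\<lambda>w. hdist z w) \<longlongrightarrow> hdist z z) (at z within uhp)"
    unfolding hdist_def using z ev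
    by (intro tendsto_intros) (auto simp: uhp_def elim!: eventually_mono)
  then have "((\<lambda>w. Im (f z) * (exp (hdist z w) - 1)) \<longlongrightarrow> Im (f z) * (exp (hdist z z) - 1)) (at z within uhp)"
    by (intro tendsto_intros)
  then have lim: "((\<lambda>w. Im (f z) * (exp (hdist z w) - 1)) \<longlongrightarrow> 0) (at z within uhp)"
    by simp
  have "((\<lambda>w. f w - f z) \<longlongrightarrow> 0) (at z within uhp)"
  proof (rule Lim_null_comparison[OF _ lim])
    show "\<forall>\<^sub>F w in at z within uhp. norm (f w - f z) \<le> Im (f z) * (exp (hdist z w) - 1)"
      using ev
    proof eventually_elim
      case (elim w)
      then show ?case
        using norm_diff_le_hdist[of "f z" "f w"] f z
        by (simp add: hisometry_uhp hisometry_def norm_minus_commute)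
    qed
  qed
  then show "(f \<longlongrightarrow> f z) (at z within uhp)"
    by (simp add: LIM_zero_iff)
qed

lemma hisometry_inv:
  assumes f: "hisometry f" shows "hisometry (inv_into uhp f)"
proof -
  have b: "bij_betw f uhp uhp" using f by (simp add: hisometry_def)
  have im: "inv_into uhp f z \<in> uhp" "f (inv_into uhp f z) = z" if "z \<in> uhp" for z
    using b that by (auto simp: bij_betw_def inv_into_into f_inv_into_f)
  show ?thesis
    unfolding hisometry_def
  proof (intro conjI ballI)
    show "bij_betw (inv_into uhp f) uhp uhp" by (rule bij_betw_inv_into[OF b])
    fix z w assume "z \<in> uhp" "w \<in> uhp"
    then have "hdist (f (inv_into uhp f z)) (f (inv_into uhp f w)) = hdist (inv_into uhp f z) (inv_into uhp f w)"
      using f im unfolding hisometry_def by blast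
    then show "hdist (inv_into uhp f z) (inv_into uhp f w) = hdist z w"
      using im \<open>z \<in> uhp\<close> \<open>w \<in> uhp\<close> by simp
  qed
qed

lemma hisometry_mob:
  assumes "a * d - b * c = 1" shows "hisometry (mob a b c d)"
  unfolding hisometry_def
proof (intro conjI ballI)
  have det': "d * a - (-b) * (-c) = 1" using assms by (simp add: algebra_simps)
  show "bij_betw (mob a b c d) uhp uhp"
    by (rule bij_betw_byWitness[where f' = "mob d (-b) (-c) a"])
      (use assms det' in \<open>auto simp: mob_inverse mob_inverse' mob_uhp\<close>)
qed (use assms in \<open>auto simp: hdist_mob\<close>)

lemma hisometry_hgeodesic:
  assumes "hisometry f" "hgeodesic I g" shows "hgeodesic I (f \<circ> g)"
  using assms unfolding hgeodesic_def hisometry_def bij_betw_def by (simp add: image_subset_iff) blast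

text \<open>In the chart \<open>z \<mapsto> (Re z, \<bar>z\<bar>\<^sup>2)\<close> geodesics are straight, so that hyperbolic convexity is
  ordinary convexity.\<close>

lemma hconvex_chart:
  assumes N: "hconvex N" "N \<subseteq> uhp" and z: "z \<in> N" and w: "w \<in> N" and v: "v \<in> uhp"
    and k: "0 \<le> k" "k \<le> 1"
    and re: "Re v = (1 - k) * Re z + k * Re w"
    and no: "(cmod v)\<^sup>2 = (1 - k) * (cmod z)\<^sup>2 + k * (cmod w)\<^sup>2"
  shows "v \<in> N"
proof -
  define D where "D = hdist z w"
  have zw: "z \<in> uhp" "w \<in> uhp" using z w N by auto
  obtain a b c d where 1: "a * d - b * c = 1" "z = mob a b c d (iaxis 0)" "w = mob a b c d (iaxis D)"
    unfolding D_def by (rule two_points_normal_form[OF zw])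
  have D0: "D \<ge> 0" using zw by (simp add: D_def hdist_nonneg)
  define g where "g = (\<lambda>t. mob a b c d (iaxis t))"
  have geo: "hgeodesic {0..D} g" unfolding g_def by (rule hgeodesic_mob_axis[OF 1(1)])
  have img: "g ` {0..D} \<subseteq> N"
    using N(1) D0 geo z w 1 unfolding hconvex_def g_def by blast
  have chart_inj: "u = v" if "u \<in> uhp" "Re u = Re v" "(cmod u)\<^sup>2 = (cmod v)\<^sup>2" for u
    using that v by (auto simp: complex_eq_iff cmod_power2 uhp_def)
  show ?thesis
  proof (cases "D = 0")
    case True
    then have "z = w" using 1 by simp
    then have "v = z" using chart_inj[of z] re no zw by (simp add: algebra_simps)
    then show ?thesis using z by simp
  next
    case False
    with D0 have Dp: "D > 0" by simp
    have upos: "Im z > 0" "Im w > 0" using zw by (auto simp: uhp_def)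
    define P where "P = (\<lambda>t. sinh (D - t) / Im z)"
    define Q where "Q = (\<lambda>t. sinh t / Im w)"
    have PQ: "P t + Q t > 0" if "0 \<le> t" "t \<le> D" for t
    proof (cases "t = D")
      case True then show ?thesis using upos Dp by (simp add: P_def Q_def)
    next
      case False
      then show ?thesis using upos that unfolding P_def Q_def
        by (intro add_pos_nonneg divide_pos_pos divide_nonneg_pos) auto
    qed
    define L where "L = (\<lambda>t. Q t / (P t + Q t))"
    have contL: "continuous_on {0..D} L"
      unfolding L_def P_def Q_def
      by (intro continuous_intros ballI) (use PQ upos in \<open>force simp: P_def Q_def\<close>)+
    have "\<exists>t. 0 \<le> t \<and> t \<le> D \<and> L t = k"
      using Dp upos by (intro IVT' contL) (auto simp: L_def P_def Q_def k)
    then obtain t where t: "0 \<le> t" "t \<le> D" "L t = k" by blast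
    have sinhD: "sinh D > 0" using Dp by simp
    \<comment> \<open>combinations of \<open>exp t\<close> and \<open>exp (-t)\<close> are interpolated by hyperbolic sines; applied to \<open>1 / Im\<close>,
      \<open>Re / Im\<close> and \<open>\<bar>\<cdot>\<bar>\<^sup>2 / Im\<close> this shows that the chart carries the geodesic to a segment\<close>
    have interp: "(A * exp t + B * exp (-t)) * sinh D
        = sinh (D - t) * (A * exp 0 + B * exp (-0)) + sinh t * (A * exp D + B * exp (-D))" for A B
      by (simp add: sinh_field_def exp_diff exp_minus field_simps)
    have u: "g t \<in> uhp" using geo t by (auto simp: hgeodesic_def)
    then have ut: "Im (g t) > 0" by (simp add: uhp_def)
    note cz = mob_coordinates[OF 1(1) 1(2)] and cw = mob_coordinates[OF 1(1) 1(3)]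
      and cu = mob_coordinates[OF 1(1) fun_cong[OF g_def, of t]]
    have one: "sinh D / Im (g t) = P t + Q t"
    proof -
      have "1 / Im (g t) * sinh D = sinh (D - t) * (1 / Im z) + sinh t * (1 / Im w)"
        unfolding cz(1) cw(1) cu(1) by (rule interp)
      then show ?thesis by (simp add: P_def Q_def mult_ac)
    qed
    have R: "Re (g t) * (sinh D / Im (g t)) = P t * Re z + Q t * Re w"
    proof -
      have "Re (g t) / Im (g t) * sinh D = sinh (D - t) * (Re z / Im z) + sinh t * (Re w / Im w)"
        unfolding cz(2) cw(2) cu(2) by (rule interp)
      then show ?thesis by (simp add: P_def Q_def mult_ac)
    qed
    have C: "(cmod (g t))\<^sup>2 * (sinh D / Im (g t)) = P t * (cmod z)\<^sup>2 + Q t * (cmod w)\<^sup>2"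
    proof -
      have "(cmod (g t))\<^sup>2 / Im (g t) * sinh D = sinh (D - t) * ((cmod z)\<^sup>2 / Im z) + sinh t * ((cmod w)\<^sup>2 / Im w)"
        unfolding cz(3) cw(3) cu(3) by (rule interp)
      then show ?thesis by (simp add: P_def Q_def mult_ac)
    qed
    have k': "k * (P t + Q t) = Q t" "(1 - k) * (P t + Q t) = P t"
      using t(3) PQ[OF t(1,2)] by (auto simp: L_def field_simps)
    have "Re (g t) * (P t + Q t) = Re v * (P t + Q t)"
    proof -
      have "Re (g t) * (P t + Q t) = P t * Re z + Q t * Re w" using R one by simp
      also have "\<dots> = ((1 - k) * (P t + Q t)) * Re z + (k * (P t + Q t)) * Re w" unfolding k' ..
      also have "\<dots> = Re v * (P t + Q t)" unfolding re by (simp add: algebra_simps)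
      finally show ?thesis .
    qed
    moreover have "(cmod (g t))\<^sup>2 * (P t + Q t) = (cmod v)\<^sup>2 * (P t + Q t)"
    proof -
      have "(cmod (g t))\<^sup>2 * (P t + Q t) = P t * (cmod z)\<^sup>2 + Q t * (cmod w)\<^sup>2" using C one by simp
      also have "\<dots> = ((1 - k) * (P t + Q t)) * (cmod z)\<^sup>2 + (k * (P t + Q t)) * (cmod w)\<^sup>2" unfolding k' ..
      also have "\<dots> = (cmod v)\<^sup>2 * (P t + Q t)" unfolding no by (simp add: algebra_simps)
      finally show ?thesis .
    qed
    ultimately have "g t = v"
      using PQ[OF t(1,2)] by (intro chart_inj u) auto
    then show ?thesis using img t by auto
  qed
qed

lemma hconvex_image:
  assumes f: "hisometry f" and N: "hconvex N" "N \<subseteq> uhp"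
  shows "hconvex (f ` N)"
  unfolding hconvex_def
proof (intro allI impI)
  fix c :: "real \<Rightarrow> complex" and m :: real
  assume m: "m \<ge> 0" and c: "hgeodesic {0..m} c" and e: "c 0 \<in> f ` N" "c m \<in> f ` N"
  let ?g = "inv_into uhp f"
  have inj: "inj_on f uhp" and im: "f ` uhp = uhp" using f by (auto simp: hisometry_def bij_betw_def)
  have g: "hgeodesic {0..m} (?g \<circ> c)"
    by (rule hisometry_hgeodesic[OF hisometry_inv[OF f] c])
  have ret: "?g z \<in> N" if "z \<in> f ` N" for z
    using that N(2) inj by (auto simp: inv_into_f_f subset_iff)
  have "(?g \<circ> c) ` {0..m} \<subseteq> N"
    using N(1)[unfolded hconvex_def, rule_format, OF m g] ret[OF e(1)] ret[OF e(2)] by simp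
  moreover have "c t = f (?g (c t))" if "t \<in> {0..m}" for t
  proof -
    have "c t \<in> f ` uhp" using c that im by (auto simp: hgeodesic_def)
    then show ?thesis by (simp add: f_inv_into_f)
  qed
  ultimately show "c ` {0..m} \<subseteq> f ` N" by fastforce
qed

text \<open>A convex set that contains the axis and points on both sides of it contains the triangles spanned
  by either point and the axis, hence a neighbourhood of the axis.\<close>

lemma hconvex_axis_interior:
  assumes N: "hconvex N" "N \<subseteq> uhp" and ax: "range iaxis \<subseteq> N"
    and z: "z \<in> N" "Re z > 0" and w: "w \<in> N" "Re w < 0"
  shows "iaxis t \<in> interior N"
proof -
  \<comment> \<open>the union of the open triangles in the chart that straightens geodesics\<close>
  define U where "U = {v. 0 < Im v \<and> Re v < Re z \<and> Re w < Re v
     \<and> Re v * (cmod z)\<^sup>2 < (cmod v)\<^sup>2 * Re z \<and> (cmod v)\<^sup>2 * Re w < Re v * (cmod w)\<^sup>2}"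
  have "open U" unfolding U_def
    by (intro open_Collect_conj open_Collect_less continuous_intros)
  moreover have "iaxis t \<in> U" using z w by (simp add: U_def mult_pos_neg)
  moreover have "U \<subseteq> N"
  proof
    fix v assume v: "v \<in> U"
    have gen: "v \<in> N" if x: "x \<in> N" and k: "0 < k" "k < 1" "Re v = k * Re x" "k * (cmod x)\<^sup>2 < (cmod v)\<^sup>2" for x k
    proof -
      define q where "q = ((cmod v)\<^sup>2 - k * (cmod x)\<^sup>2) / (1 - k)"
      have q: "q > 0" using k by (simp add: q_def)
      have "iaxis (ln q / 2) \<in> N" using ax by blast
      moreover have "(cmod (iaxis (ln q / 2)))\<^sup>2 = q" using q by (simp flip: exp_double)
      ultimately show ?thesis
        using k v by (intro hconvex_chart[OF N, of "iaxis (ln q / 2)" x v k] x)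
          (auto simp: U_def uhp_def q_def field_simps)
    qed
    consider "Re v = 0" | "Re v > 0" | "Re v < 0" by linarith
    then show "v \<in> N"
    proof cases
      case 1
      then have "v = iaxis (ln (Im v))" using v by (auto simp: U_def complex_eq_iff)
      then show ?thesis using ax by (metis range_subsetD)
    next
      case 2
      then show ?thesis using v z
        by (intro gen[of z "Re v / Re z"]) (auto simp: U_def field_simps)
    next
      case 3
      then show ?thesis using v w
        by (intro gen[of w "Re v / Re w"]) (auto simp: U_def field_simps)
    qed
  qed
  ultimately show ?thesis by (meson interiorI)
qed

section \<open>The universal covering of a pair of pants\<close>

text \<open>The interior of the model surface.\<close>

definition core :: "bool \<Rightarrow> complex set" where
  "core cusp2 = ball 0 1 - {0} - (if cusp2 then {1/2} else cball (1/2) (1/4))"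

lemma open_core: "open (core cusp2)"
  unfolding core_def by (intro open_Diff) auto

lemma interior_pants_subset: "interior (pants cusp2) \<subseteq> core cusp2"
proof -
  have 1: "interior (pants cusp2) \<subseteq> interior (cball 0 1)"
    by (rule interior_mono) (auto simp: pants_def)
  have 2: "interior (pants cusp2) \<subseteq> pants cusp2" by (rule interior_subset)
  have 3: "interior (pants cusp2) \<subseteq> interior (- ball (1/2) (1/4))" if "\<not> cusp2"
    using that by (intro interior_mono) (auto simp: pants_def)
  have "interior (- ball (1/2) (1/4)) = - cball (1/2::complex) (1/4)"
    by (simp add: interior_complement)
  then show ?thesis using 1 2 3 unfolding core_def pants_def by auto
qed

lemma core_subset_pants: "core cusp2 \<subseteq> pants cusp2"
  unfolding core_def pants_def by auto

lemma pants_cases: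
  assumes "z \<in> pants cusp2"
  obtains "z \<in> core cusp2" | "z \<in> alpha_circle" | "\<not> cusp2" "z \<in> alpha2_circle"
proof -
  have "z \<in> core cusp2 \<or> z \<in> alpha_circle \<or> \<not> cusp2 \<and> z \<in> alpha2_circle"
    using assms unfolding core_def pants_def by (auto split: if_splits)
  then show ?thesis using that by blast
qed

definition deck :: "complex set \<Rightarrow> (complex \<Rightarrow> complex) \<Rightarrow> (complex \<Rightarrow> complex) \<Rightarrow> bool" where
  "deck N p f \<longleftrightarrow> hisometry f \<and> f ` N = N \<and> (\<forall>x\<in>N. p (f x) = p x)"

locale pants_cover =
  fixes cusp2 :: bool and N :: "complex set" and p :: "complex \<Rightarrow> complex"
  assumes hyp: "hyperbolic_pants cusp2 N p"
begin

lemma N_uhp: "N \<subseteq> uhp"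
  using hyp unfolding hyperbolic_pants_def by (meson closedin_imp_subset)

lemma N_closed: "closedin (top_of_set uhp) N"
  using hyp unfolding hyperbolic_pants_def by (elim conjE)

lemma N_hconvex: "hconvex N"
  using hyp unfolding hyperbolic_pants_def by (elim conjE)

lemma cov: "covering_space N p (pants cusp2)"
  using hyp unfolding hyperbolic_pants_def by (elim conjE)

lemma p_cont: "continuous_on N p"
  using cov by (rule covering_space_imp_continuous)

lemma p_image: "p ` N = pants cusp2"
  using cov by (rule covering_space_imp_surjective)

lemma deck_exists: "z \<in> N \<Longrightarrow> w \<in> N \<Longrightarrow> p z = p w \<Longrightarrow> \<exists>f. deck N p f \<and> f z = w"
proof -
  assume zw: "z \<in> N" "w \<in> N" "p z = p w"
  have "\<forall>z\<in>N. \<forall>w\<in>N. p z = p w \<longrightarrow> (\<exists>f. hisometry f \<and> f ` N = N \<and> (\<forall>x\<in>N. p (f x) = p x) \<and> f z = w)"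
    using hyp unfolding hyperbolic_pants_def by (elim conjE)
  from this[rule_format, OF zw] show ?thesis unfolding deck_def by auto
qed

lemma alpha_boundary: "geodesic_boundary N p alpha_circle"
  using hyp unfolding hyperbolic_pants_def by (elim conjE)

lemma alpha2_boundary: "\<not> cusp2 \<Longrightarrow> geodesic_boundary N p alpha2_circle"
  using hyp unfolding hyperbolic_pants_def by simp

lemma cusp0: "cusp_at N p 0"
  using hyp unfolding hyperbolic_pants_def by (elim conjE)

lemma deck_hgeodesic:
  assumes "deck N p f" "hgeodesic I g" "g ` I \<subseteq> N"
  shows "hgeodesic I (f \<circ> g)" "(f \<circ> g) ` I \<subseteq> N" "\<And>t. t \<in> I \<Longrightarrow> p ((f \<circ> g) t) = p (g t)"
  using assms hisometry_hgeodesic[of f I g] unfolding deck_def by (simp, fastforce, fastforce)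

text \<open>Invariance of domain, applied to a local inverse of the covering.\<close>

lemma interior_projection:
  assumes "z \<in> interior N" shows "p z \<in> interior (pants cusp2)"
proof -
  have z: "z \<in> N" using assms interior_subset by blast
  obtain T u q where T: "z \<in> T" "openin (top_of_set N) T" "p z \<in> u"
      "openin (top_of_set (pants cusp2)) u" "homeomorphism T u p q"
    by (rule covering_space_local_homeomorphism[OF cov z])
  obtain V where V: "open V" "T = N \<inter> V" using T(2) by (auto simp: openin_open)
  let ?S = "interior N \<inter> V"
  have sub: "?S \<subseteq> T" using V interior_subset by blast
  have "continuous_on ?S p" using continuous_on_subset[OF p_cont] interior_subset by blast
  moreover have "inj_on p ?S"
    using sub homeomorphism_apply1[OF T(5)] by (intro inj_on_inverseI[where g = q]) blast
  ultimately have "open (p ` ?S)"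
    using V by (intro invariance_of_domain) auto
  moreover have "p ` ?S \<subseteq> pants cusp2" using p_image interior_subset by blast
  moreover have "p z \<in> p ` ?S" using assms T(1) V by blast
  ultimately show ?thesis by (meson interiorI)
qed

text \<open>Complete geodesics over the boundary: lifts of \<open>\<alpha>\<close>, and of \<open>\<alpha>\<^sub>2\<close> if that is a geodesic.\<close>

definition boundary_lift :: "(real \<Rightarrow> complex) \<Rightarrow> bool" where
  "boundary_lift e \<longleftrightarrow> hgeodesic UNIV e \<and> range e \<subseteq> N \<and> p ` range e \<inter> core cusp2 = {}"

text \<open>Otherwise \<open>N\<close> would contain a neighbourhood of a point of the lift, and its projection would be
  an interior point of the surface.\<close>

lemma boundary_lift_one_sided:
  assumes e: "boundary_lift e" and det: "a * d - b * c = 1"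
    and ch: "\<And>t. e t = mob a b c d (iaxis t)"
  shows "(\<forall>z\<in>N. Re (mob d (-b) (-c) a z) \<ge> 0) \<or> (\<forall>z\<in>N. Re (mob d (-b) (-c) a z) \<le> 0)"
proof (rule ccontr)
  let ?m = "mob d (-b) (-c) a"
  have det': "d * a - (-b) * (-c) = 1" using det by (simp add: algebra_simps)
  assume "\<not> ?thesis"
  then obtain z w where zw: "z \<in> N" "Re (?m z) > 0" "w \<in> N" "Re (?m w) < 0"
    by (auto simp: not_le)
  have hc: "hconvex (?m ` N)" by (rule hconvex_image[OF hisometry_mob[OF det'] N_hconvex N_uhp])
  have sub: "?m ` N \<subseteq> uhp" using N_uhp mob_uhp[OF det'] by blast
  have inv: "?m (e t) = iaxis t" for t unfolding ch using mob_inverse[OF det] by simp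
  have eN: "e t \<in> N" for t using e unfolding boundary_lift_def by blast
  have ax: "range iaxis \<subseteq> ?m ` N" using inv[symmetric] eN by blast
  have int: "iaxis 0 \<in> interior (?m ` N)"
    by (rule hconvex_axis_interior[OF hc sub ax, of "?m z" "?m w"]) (use zw in auto)
  let ?V = "uhp \<inter> ?m -` interior (?m ` N)"
  have "open ?V"
    by (rule continuous_open_preimage[OF continuous_on_mob[OF det'] open_uhp]) simp
  moreover have "e 0 \<in> ?V" using int inv[of 0] e N_uhp unfolding boundary_lift_def by auto
  moreover have "?V \<subseteq> N"
  proof
    fix v assume v: "v \<in> ?V"
    then have "?m v \<in> ?m ` N" using interior_subset by blast
    then obtain x where x: "x \<in> N" "?m v = ?m x" by blast
    then have "v = x" using v N_uhp mob_inverse'[OF det, of v] mob_inverse'[OF det, of x] by auto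
    then show "v \<in> N" using x by simp
  qed
  ultimately have "e 0 \<in> interior N" by (meson interiorI)
  then have "p (e 0) \<in> core cusp2" using interior_projection interior_pants_subset by blast
  then show False using e unfolding boundary_lift_def by blast
qed

text \<open>A geodesic that touches the boundary at an interior point of its domain would have to cross it,
  unless it runs inside the boundary.\<close>

lemma boundary_lift_touching:
  assumes e: "boundary_lift e" and g: "hgeodesic I g" "g ` I \<subseteq> N"
    and r: "r > 0" "{s - r..s + r} \<subseteq> I" and s: "g s \<in> range e"
  shows "g ` I \<subseteq> range e"
proof -
  obtain a b c d where det: "a * d - b * c = 1" and ch: "\<And>t. e t = mob a b c d (iaxis t)"
    by (rule hgeodesic_normal_form[of UNIV e]) (use e in \<open>auto simp: boundary_lift_def\<close>)
  let ?m = "mob d (-b) (-c) a"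
  have det': "d * a - (-b) * (-c) = 1" using det by (simp add: algebra_simps)
  have inv: "?m (e t) = iaxis t" for t unfolding ch using mob_inverse[OF det] by simp
  have G: "hgeodesic I (?m \<circ> g)"
    by (rule hisometry_hgeodesic[OF hisometry_mob[OF det'] g(1)])
  obtain A B C D where det2: "A * D - B * C = 1"
    and G': "\<And>t. t \<in> I \<Longrightarrow> (?m \<circ> g) t = mob A B C D (iaxis t)"
    by (rule hgeodesic_normal_form[OF G]) blast
  \<comment> \<open>the tangent of the angle from the lift; such a combination vanishes identically if it has a zero without a
    change of sign\<close>
  define F where "F = (\<lambda>t. A * C * exp t + B * D * exp (-t))"
  have Im: "Im (?m (g t)) > 0" if "t \<in> I" for t
    using G that by (auto simp: hgeodesic_def uhp_def)
  have F: "F t = Re (?m (g t)) / Im (?m (g t))" if "t \<in> I" for t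
    using mob_coordinates(2)[OF det2 G'[OF that]] by (simp add: F_def)
  have sI: "s \<in> I" "s - r \<in> I" "s + r \<in> I" using r by auto
  have F0: "F s = 0" using F[OF sI(1)] s inv by auto
  have one: "(\<forall>z\<in>N. Re (?m z) \<ge> 0) \<or> (\<forall>z\<in>N. Re (?m z) \<le> 0)"
    by (rule boundary_lift_one_sided[OF e det ch])
  have F1: "F (s - r) \<ge> 0 \<and> F (s + r) \<ge> 0 \<or> F (s - r) \<le> 0 \<and> F (s + r) \<le> 0"
    using one g(2) F[OF sI(2)] F[OF sI(3)] Im[OF sI(2)] Im[OF sI(3)] sI
    by (auto simp: image_subset_iff divide_nonpos_pos)
  have BD: "B * D * exp (-s) = - (A * C * exp s)" using F0 by (simp add: F_def)
  have Fr: "F (s + x) = A * C * exp s * (exp x - exp (-x))" for x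
  proof -
    have "F (s + x) = A * C * exp s * exp x + B * D * exp (-s) * exp (-x)"
      by (simp add: F_def exp_add exp_minus field_simps)
    also have "\<dots> = A * C * exp s * (exp x - exp (-x))" unfolding BD by (simp add: algebra_simps)
    finally show ?thesis .
  qed
  define k where "k = exp r - exp (-r)"
  have k: "k > 0" using r by (simp add: k_def)
  have "F (s + r) = A * C * exp s * k" "F (s - r) = - (A * C * exp s * k)"
    using Fr[of r] Fr[of "-r"] by (simp_all add: k_def algebra_simps)
  then have "A * C * exp s * k = 0" using F1 by linarith
  then have "A * C = 0" using k by simp
  then have F00: "F t = 0" for t using Fr[of "t - s"] by simp
  show ?thesis
  proof
    fix z assume "z \<in> g ` I"
    then obtain t where t: "t \<in> I" "z = g t" by blast
    have "Re (?m z) = 0" using F[OF t(1)] F00[of t] Im[OF t(1)] t by simp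
    then have "?m z = iaxis (ln (Im (?m z)))"
      using Im[OF t(1)] t by (intro complex_eqI) simp_all
    then have "?m z = ?m (e (ln (Im (?m z))))" by (simp add: inv)
    moreover have "z \<in> uhp" "e (ln (Im (?m z))) \<in> uhp"
      using g(2) t N_uhp e unfolding boundary_lift_def by blast+
    ultimately have "z = e (ln (Im (?m z)))"
      using mob_inverse'[OF det, of z] mob_inverse'[OF det, of "e (ln (Im (?m z)))"] by simp
    then show "z \<in> range e" by blast
  qed
qed

lemma boundary_circle_touching:
  assumes K: "geodesic_boundary N p K" "K \<inter> core cusp2 = {}"
    and g: "hgeodesic I g" "g ` I \<subseteq> N"
    and r: "r > 0" "{s - r..s + r} \<subseteq> I" and s: "p (g s) \<in> K"
  shows "p ` g ` I \<subseteq> K"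
proof -
  have "s \<in> I" using r by auto
  then have "g s \<in> N" using g by blast
  then obtain e u where e: "hgeodesic UNIV e" "range e \<subseteq> N" "p ` range e = K" "e u = g s"
    using K(1) s unfolding geodesic_boundary_def by blast
  have "boundary_lift e" using e K unfolding boundary_lift_def by blast
  from boundary_lift_touching[OF this g r] e(4) have "g ` I \<subseteq> range e" by (metis rangeI)
  then show ?thesis using e(3) by blast
qed

lemma alpha_core: "alpha_circle \<inter> core cusp2 = {}"
  by (auto simp: core_def)

lemma alpha2_core: "\<not> cusp2 \<Longrightarrow> alpha2_circle \<inter> core cusp2 = {}"
  by (auto simp: core_def)

text \<open>A geodesic that runs into the puncture stays away from the boundary circles, since these are
  closed and do not contain the puncture.\<close>

lemma cusp_geodesic_in_core:
  assumes g: "hgeodesic I g" "g ` I \<subseteq> N" and r: "r > 0" "{s - r..s + r} \<subseteq> I"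
    and lim: "((p \<circ> g) \<longlongrightarrow> 0) at_top" "{t0..} \<subseteq> I"
  shows "p (g s) \<in> core cusp2"
proof -
  have no: "\<not> p ` g ` I \<subseteq> K" if "closed K" "0 \<notin> K" for K
  proof
    assume sub: "p ` g ` I \<subseteq> K"
    have "\<forall>\<^sub>F t in at_top. (p \<circ> g) t \<in> K"
      using eventually_ge_at_top[of t0] by eventually_elim (use sub lim(2) in auto)
    then have "0 \<in> K" using Lim_in_closed_set[OF that(1) _ _ lim(1)] by simp
    then show False using that by simp
  qed
  have sI: "s \<in> I" using r by auto
  then have "p (g s) \<in> pants cusp2" using g(2) p_image by blast
  then show ?thesis
  proof (cases rule: pants_cases)
    case 2
    then show ?thesis
      using boundary_circle_touching[OF alpha_boundary alpha_core g r] no[of alpha_circle] by auto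
  next
    case 3
    then show ?thesis
      using boundary_circle_touching[OF alpha2_boundary alpha2_core g r] no[of alpha2_circle]
      by (auto simp: dist_norm norm_divide)
  qed
qed

end

section \<open>The cusp\<close>

lemma hgeodesic_vertical:
  assumes "k > 0" shows "hgeodesic I (\<lambda>t. Complex x (k * exp t))"
proof -
  have det: "sqrt k * (1 / sqrt k) - x / sqrt k * 0 = 1" using assms by simp
  have "mob (sqrt k) (x / sqrt k) 0 (1 / sqrt k) (iaxis t) = Complex x (k * exp t)" for t
    using assms by (intro complex_eqI)
      (simp_all add: mob_def Re_divide Im_divide power2_eq_square field_simps)
  with hgeodesic_mob_axis[OF det, of I] show ?thesis by simp
qed

lemma deck_inv:
  assumes f: "deck N p f" and N: "N \<subseteq> uhp"
  shows "deck N p (inv_into uhp f)" "\<And>z. z \<in> N \<Longrightarrow> inv_into uhp f z \<in> N"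
    "\<And>z. z \<in> N \<Longrightarrow> f (inv_into uhp f z) = z"
proof -
  have iso: "hisometry f" and im: "f ` N = N" and pf: "\<And>x. x \<in> N \<Longrightarrow> p (f x) = p x"
    using f by (auto simp: deck_def)
  have inj: "inj_on f uhp" and onto: "f ` uhp = uhp" using iso by (auto simp: hisometry_def bij_betw_def)
  have 1: "inv_into uhp f (f z) = z" if "z \<in> N" for z
    using that N inj by (intro inv_into_f_f) auto
  have 2: "f (inv_into uhp f z) = z" if "z \<in> N" for z
    using that N onto by (intro f_inv_into_f) auto
  have 3: "inv_into uhp f ` N = N"
  proof -
    have "inv_into uhp f ` N = inv_into uhp f ` (f ` N)" using im by simp
    also have "\<dots> = N" unfolding image_image using 1 by simp
    finally show ?thesis .
  qed
  show "deck N p (inv_into uhp f)"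
    unfolding deck_def using hisometry_inv[OF iso] 3 pf 2 by (metis imageI)
  show "inv_into uhp f z \<in> N" if "z \<in> N" for z using 3 that by blast
  show "f (inv_into uhp f z) = z" if "z \<in> N" for z by (rule 2[OF that])
qed

text \<open>The chart \<open>h\<close> of the cusp: above height \<open>y\<close> the covering becomes the quotient by \<open>z \<mapsto> z + 1\<close>.\<close>

locale cusp_chart = pants_cover +
  fixes h :: "complex \<Rightarrow> complex" and y :: real
  assumes h_iso: "hisometry h" and y_pos: "y > 0" and h_sub: "h ` {z. Im z > y} \<subseteq> N"
    and h_eq: "\<And>z w. Im z > y \<Longrightarrow> Im w > y \<Longrightarrow> p (h z) = p (h w) \<longleftrightarrow> w - z \<in> \<int>"
    and h_lim: "((\<lambda>z. p (h z)) \<longlongrightarrow> 0) (filtercomap Im at_top)"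

lemma (in pants_cover) cusp_chart_exists: "\<exists>h y. cusp_chart cusp2 N p h y"
proof -
  obtain h y where "hisometry h" "y > 0" "h ` {z. Im z > y} \<subseteq> N"
    "\<forall>z w. Im z > y \<longrightarrow> Im w > y \<longrightarrow> (p (h z) = p (h w) \<longleftrightarrow> w - z \<in> \<int>)"
    "((\<lambda>z. p (h z)) \<longlongrightarrow> 0) (filtercomap Im at_top)"
    using cusp0 unfolding cusp_at_def by (elim exE conjE)
  then have "cusp_chart cusp2 N p h y" by unfold_locales auto
  then show ?thesis by blast
qed

context cusp_chart
begin

lemma h_in_N: "Im z > y \<Longrightarrow> h z \<in> N"
  using h_sub by blast

lemma ph_pants: "Im z > y \<Longrightarrow> p (h z) \<in> pants cusp2"
  using h_in_N p_image by blast

lemma ph_nonzero: "Im z > y \<Longrightarrow> p (h z) \<noteq> 0"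
  using ph_pants[of z] by (auto simp: pants_def)

lemma ph_cont: "continuous_on {z. Im z > y} (\<lambda>z. p (h z))"
proof (rule continuous_on_compose2[OF p_cont])
  show "continuous_on {z. Im z > y} h"
    by (rule continuous_on_subset[OF hisometry_continuous[OF h_iso]]) (use y_pos in \<open>auto simp: uhp_def\<close>)
qed (use h_sub in auto)

lemma ph_small:
  assumes "e > 0" shows "\<exists>Y>y0. \<forall>z. Im z > Y \<longrightarrow> cmod (p (h z)) < e"
proof -
  have "\<forall>\<^sub>F z in filtercomap Im at_top. dist (p (h z)) 0 < e"
    using h_lim assms by (rule tendstoD)
  then obtain Y where "\<forall>z. Im z \<ge> Y \<longrightarrow> dist (p (h z)) 0 < e"
    unfolding eventually_filtercomap_at_top_linorder by blast
  then show ?thesis by (intro exI[of _ "max Y (y0 + 1)"]) auto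
qed

lemma ints_diff_ReIm:
  "w - z \<in> \<int> \<longleftrightarrow> Im w = Im z \<and> Re w - Re z \<in> \<int>" for w z :: complex
proof
  assume "w - z \<in> \<int>"
  then obtain n where "w - z = of_int n" by (auto elim: Ints_cases)
  then have "Re (w - z) = of_int n" "Im (w - z) = 0" by (auto dest: arg_cong[of _ _ Re])
  then show "Im w = Im z \<and> Re w - Re z \<in> \<int>" by auto
next
  assume a: "Im w = Im z \<and> Re w - Re z \<in> \<int>"
  then obtain n where "Re w - Re z = of_int n" by (auto elim: Ints_cases)
  then have "w - z = of_int n" using a by (intro complex_eqI) auto
  then show "w - z \<in> \<int>" by simp
qed

lemma ph_eq_iff:
  "Im z > y \<Longrightarrow> Im w > y \<Longrightarrow> p (h z) = p (h w) \<longleftrightarrow> Im w = Im z \<and> Re w - Re z \<in> \<int>"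
  using h_eq ints_diff_ReIm by blast

text \<open>On strips of width 1 the chart is injective, so that invariance of domain applies.\<close>

lemma open_ph_image:
  assumes Y: "Y \<ge> y" shows "open ((\<lambda>z. p (h z)) ` {z. Im z > Y})"
proof -
  let ?S = "\<lambda>x. {z. x < Re z} \<inter> {z. Re z < x + 1} \<inter> {z. Im z > Y}"
  have "open ((\<lambda>z. p (h z)) ` ?S x)" for x
  proof (rule invariance_of_domain)
    show "continuous_on (?S x) (\<lambda>z. p (h z))"
      using ph_cont by (rule continuous_on_subset) (use Y in auto)
    show "open (?S x)"
      by (intro open_Int open_halfspace_Re_gt open_halfspace_Re_lt open_halfspace_Im_gt)
    show "inj_on (\<lambda>z. p (h z)) (?S x)"
    proof (rule inj_onI)
      fix z w assume z: "z \<in> ?S x" and w: "w \<in> ?S x" and e: "p (h z) = p (h w)"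
      then have "Im w = Im z" "Re w - Re z \<in> \<int>" using ph_eq_iff[of z w] Y by auto
      moreover have "\<bar>Re w - Re z\<bar> < 1" using z w by auto
      ultimately show "z = w" by (metis Ints_nonzero_abs_less1 complex_eqI right_minus_eq)
    qed
  qed
  moreover have "(\<lambda>z. p (h z)) ` {z. Im z > Y} = (\<Union>x. (\<lambda>z. p (h z)) ` ?S x)"
  proof -
    have "z \<in> ?S (Re z - 1/2)" if "Im z > Y" for z using that by auto
    then show ?thesis by blast
  qed
  ultimately show ?thesis by (simp only: open_UN) blast
qed

text \<open>The cusp fills a punctured neighbourhood of the puncture: its image is open, and within a small
  punctured disc that misses the bounding horocycle it is also closed.\<close>

lemma punctured_neighbourhood:
  assumes Y: "Y > y"
  obtains e where "e > 0" "ball 0 e - {0} \<subseteq> (\<lambda>z. p (h z)) ` {z. Im z > Y}"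
proof -
  let ?A = "(\<lambda>z. p (h z)) ` {z. Im z > Y}"
  define K where "K = (\<lambda>Y'. (\<lambda>z. p (h z)) ` cbox (Complex 0 Y) (Complex 1 Y'))"
  have cK: "compact (K Y')" for Y'
    unfolding K_def
    by (intro compact_continuous_image continuous_on_subset[OF ph_cont])
      (use Y in \<open>auto simp: in_cbox_complex_iff\<close>)
  have "0 \<notin> K Y" unfolding K_def using ph_nonzero Y by (force simp: in_cbox_complex_iff)
  moreover have "closed (K Y)" using cK compact_imp_closed by blast
  ultimately obtain e where e: "e > 0" "ball 0 e \<inter> K Y = {}"
    by (metis ComplI disjoint_eq_subset_Compl inf_commute open_Compl open_contains_ball)
  have rep: "\<exists>w. Im w = Im z \<and> 0 \<le> Re w \<and> Re w \<le> 1 \<and> p (h w) = p (h z)" if "Im z > y" for z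
  proof (intro exI conjI)
    let ?w = "Complex (frac (Re z)) (Im z)"
    show "p (h ?w) = p (h z)" using that by (subst ph_eq_iff) (auto simp: frac_def)
  qed (use frac_ge_0 frac_lt_1 less_imp_le in auto)
  let ?D = "ball (0::complex) e - {0}"
  have closed: "x \<in> ?A" if x: "x \<in> ?D" "x \<in> closure ?A" for x
  proof -
    have x2: "cmod x / 2 > 0" using x by simp
    obtain Y2 where Y2: "Y2 > Y" "\<And>z. Im z > Y2 \<Longrightarrow> cmod (p (h z)) < cmod x / 2"
      using ph_small[OF x2, of Y] by blast
    have "?A \<subseteq> K Y2 \<union> cball 0 (cmod x / 2)"
    proof
      fix v assume "v \<in> ?A"
      then obtain z where z: "Im z > Y" "v = p (h z)" by blast
      show "v \<in> K Y2 \<union> cball 0 (cmod x / 2)"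
      proof (cases "Im z > Y2")
        case True then show ?thesis using Y2(2)[of z] z by auto
      next
        case False
        obtain w where "Im w = Im z" "0 \<le> Re w" "Re w \<le> 1" "p (h w) = p (h z)"
          using rep[of z] z Y by auto
        then have "v \<in> K Y2" unfolding K_def using z False
          by (intro image_eqI[of _ _ w]) (auto simp: in_cbox_complex_iff)
        then show ?thesis ..
      qed
    qed
    moreover have "closed (K Y2 \<union> cball 0 (cmod x / 2))"
      by (intro closed_Un compact_imp_closed cK closed_cball)
    ultimately have "closure ?A \<subseteq> K Y2 \<union> cball 0 (cmod x / 2)" by (rule closure_minimal)
    then have "x \<in> K Y2 \<union> cball 0 (cmod x / 2)" using x(2) by blast
    then have "x \<in> K Y2" using x(1) by simp
    then obtain z where z: "z \<in> cbox (Complex 0 Y) (Complex 1 Y2)" "x = p (h z)" unfolding K_def by blast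
    have "Im z \<noteq> Y"
    proof
      assume "Im z = Y"
      then have "x \<in> K Y" unfolding K_def using z by (auto simp: in_cbox_complex_iff)
      then show False using x e by auto
    qed
    then show ?thesis using z by (auto simp: in_cbox_complex_iff)
  qed
  have con: "connected ?D" by (rule connected_punctured_ball) simp
  obtain Y3 where Y3: "Y3 > Y" "\<And>z. Im z > Y3 \<Longrightarrow> cmod (p (h z)) < e"
    using ph_small[OF e(1), of Y] by blast
  have "p (h (Complex 0 (Y3 + 1))) \<in> ?A \<inter> ?D"
    using Y3 Y ph_nonzero[of "Complex 0 (Y3 + 1)"] by auto
  then have ne: "?D \<inter> ?A \<noteq> {}" by blast
  have "openin (top_of_set ?D) (?D \<inter> ?A)"
    using open_ph_image[of Y] Y by (intro openin_open_Int) simp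
  moreover have "?D \<inter> ?A = ?D \<inter> closure ?A" using closed closure_subset[of ?A] by blast
  then have "closedin (top_of_set ?D) (?D \<inter> ?A)" by (simp only:) (intro closedin_closed_Int closed_closure)
  ultimately have "?D \<inter> ?A = {} \<or> ?D \<inter> ?A = ?D"
    using con[unfolded connected_clopen, rule_format, of "?D \<inter> ?A"] by blast
  with ne have "?D \<inter> ?A = ?D" by simp
  then have "?D \<subseteq> ?A" by (metis inf.absorb_iff1)
  then show ?thesis using that[OF e(1)] by simp
qed

text \<open>The tail of the ray runs in a punctured neighbourhood covered by the cusp, and its lift cannot leave
  the half-plane: on the bounding horocycle the projection is off that neighbourhood. A geodesic
  ray whose height stays bounded below is vertical, since \<open>1 / Im\<close> would otherwise grow like \<open>exp t\<close>.\<close>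

lemma cusp_ray_vertical:
  assumes r: "hgeodesic {0..} r" "r ` {0..} \<subseteq> N" and lim: "((p \<circ> r) \<longlongrightarrow> 0) at_top"
  obtains g x k where "deck N p g" "k > 0" "\<And>t. t \<ge> 0 \<Longrightarrow> r t = g (h (Complex x (k * exp t)))"
proof -
  define Y where "Y = y + 1"
  have Y: "Y > y" "Y > 0" using y_pos by (auto simp: Y_def)
  obtain e where e: "e > 0" "ball 0 e - {0} \<subseteq> (\<lambda>z. p (h z)) ` {z. Im z > Y}"
    by (rule punctured_neighbourhood[OF Y(1)])
  obtain t1 where t1: "t1 \<ge> 0" "\<And>t. t \<ge> t1 \<Longrightarrow> cmod (p (r t)) < e"
  proof -
    have "\<forall>\<^sub>F t in at_top. dist ((p \<circ> r) t) 0 < e" using lim e(1) by (rule tendstoD)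
    then obtain T where "\<forall>t\<ge>T. dist ((p \<circ> r) t) 0 < e" unfolding eventually_at_top_linorder by blast
    then show ?thesis by (intro that[of "max T 0"]) auto
  qed
  have pr0: "p (r t) \<noteq> 0" if "t \<ge> 0" for t
    using r(2) that p_image by (force simp: pants_def)
  have inA: "\<exists>z. Im z > Y \<and> p (r t) = p (h z)" if "t \<ge> t1" for t
  proof -
    have "p (r t) \<in> ball 0 e - {0}" using t1 that pr0[of t] by auto
    then show ?thesis using e(2) by auto
  qed
  obtain z0 where z0: "Im z0 > Y" "p (r t1) = p (h z0)" using inA[of t1] by auto
  have hz0: "h z0 \<in> N" using z0 Y by (intro h_in_N) auto
  have rN: "r t \<in> N" if "t \<ge> 0" for t using r(2) that by auto
  obtain g where g: "deck N p g" "g (h z0) = r t1"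
    using deck_exists[OF hz0 rN[OF t1(1)]] z0(2) by auto
  let ?gi = "inv_into uhp g" and ?hi = "inv_into uhp h"
  have gi: "deck N p ?gi" "\<And>z. z \<in> N \<Longrightarrow> ?gi z \<in> N" "\<And>z. z \<in> N \<Longrightarrow> g (?gi z) = z"
    by (rule deck_inv[OF g(1) N_uhp], assumption?)+
  have giso: "hisometry ?gi" and pgi: "\<And>z. z \<in> N \<Longrightarrow> p (?gi z) = p z" using gi(1) by (auto simp: deck_def)
  have hinj: "inj_on h uhp" and honto: "h ` uhp = uhp" using h_iso by (auto simp: hisometry_def bij_betw_def)
  have ginj: "inj_on g uhp" using g(1) by (auto simp: deck_def hisometry_def bij_betw_def)
  define Q where "Q = ?hi \<circ> (?gi \<circ> r)"
  have Q: "hgeodesic {0..} Q"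
    unfolding Q_def by (intro hisometry_hgeodesic hisometry_inv h_iso giso r)
  have hQ: "h (Q t) = ?gi (r t)" if "t \<ge> 0" for t
  proof -
    have "?gi (r t) \<in> h ` uhp" using gi(2)[OF rN[OF that]] N_uhp honto by blast
    then show ?thesis by (simp add: Q_def f_inv_into_f)
  qed
  have Qt1: "Q t1 = z0"
  proof -
    have z0u: "z0 \<in> uhp" using z0 Y by (simp add: uhp_def)
    have "?gi (r t1) = h z0" unfolding g(2)[symmetric] using hz0 N_uhp ginj by (intro inv_into_f_f) auto
    then show ?thesis using hinj z0u by (simp add: Q_def inv_into_f_f)
  qed
  have contQ: "continuous_on {0..} (\<lambda>t. Im (Q t))"
    by (intro continuous_intros hgeodesic_continuous[OF Q])
  have high: "Im (Q t) > Y" if t: "t \<ge> t1" for t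
  proof (rule ccontr)
    assume "\<not> ?thesis"
    then have "\<exists>s. t1 \<le> s \<and> s \<le> t \<and> Im (Q s) = Y"
      using z0(1) Qt1 t1(1) t
      by (intro IVT2') (auto intro: continuous_on_subset[OF contQ])
    then obtain s where s: "t1 \<le> s" "Im (Q s) = Y" by blast
    then have s0: "s \<ge> 0" using t1 by simp
    obtain z where z: "Im z > Y" "p (r s) = p (h z)" using inA[OF s(1)] by blast
    have "p (h (Q s)) = p (h z)" using hQ[OF s0] pgi[OF rN[OF s0]] z by simp
    then have "Im z = Im (Q s)" using ph_eq_iff[of "Q s" z] s z Y by simp
    then show False using z s by simp
  qed
  obtain a b c d where det: "a * d - b * c = 1" and Qm: "\<And>t. t \<in> {0..} \<Longrightarrow> Q t = mob a b c d (iaxis t)"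
    by (rule hgeodesic_normal_form[OF Q]) blast
  have c0: "c = 0"
  proof (rule ccontr)
    assume c: "c \<noteq> 0"
    define t where "t = max t1 (1 / (c\<^sup>2 * Y))"
    have t: "t \<ge> t1" "t \<ge> 0" "t \<ge> 1 / (c\<^sup>2 * Y)" using t1 by (auto simp: t_def)
    then have te: "1 / (c\<^sup>2 * Y) \<le> exp t" using exp_ge_add_one_self[of t] by linarith
    have "1 / Im (Q t) = c\<^sup>2 * exp t + d\<^sup>2 * exp (-t)"
      using mob_coordinates(1)[OF det Qm[of t]] t by simp
    moreover have "1 / Im (Q t) < 1 / Y" using high[OF t(1)] Y by (simp add: frac_less2)
    moreover have "c\<^sup>2 * (1 / (c\<^sup>2 * Y)) \<le> c\<^sup>2 * exp t"
      by (intro mult_left_mono te) auto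
    then have "1 / Y \<le> c\<^sup>2 * exp t" using c by simp
    moreover have "d\<^sup>2 * exp (-t) \<ge> 0" by simp
    ultimately show False by linarith
  qed
  have Qv: "Q t = Complex (a * b) (a\<^sup>2 * exp t)" if "t \<ge> 0" for t
  proof -
    have ad: "a * d = 1" using det c0 by simp
    then have a: "a \<noteq> 0" by auto
    then have d: "d = 1 / a" using ad by (simp add: field_simps)
    have "Q t = mob a b 0 (1 / a) (iaxis t)" using Qm[of t] that c0 d by simp
    also have "\<dots> = of_real (a * a) * iaxis t + of_real (a * b)"
      using a by (simp add: mob_def field_simps)
    finally show ?thesis by (simp add: complex_eq_iff power2_eq_square)
  qed
  show ?thesis
  proof (rule that[OF g(1), of "a\<^sup>2" "a * b"])
    show "a\<^sup>2 > 0" using det c0 by auto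
    show "r t = g (h (Complex (a * b) (a\<^sup>2 * exp t)))" if "t \<ge> 0" for t
      using Qv[OF that] hQ[OF that] gi(3)[OF rN[OF that]] by simp
  qed
qed

end

section \<open>Pairs of rays out the puncture\<close>

text \<open>The closing up of a curve on \<open>{0..}\<close> that converges to 0 to a path on \<open>{0..1}\<close>.\<close>

definition ray_path :: "(real \<Rightarrow> complex) \<Rightarrow> real \<Rightarrow> complex" where
  "ray_path f s = (if s < 1 then f (s / (1 - s)) else 0)"

lemma ray_path_simps:
  "pathstart (ray_path f) = f 0" "pathfinish (ray_path f) = 0"
  by (simp_all add: ray_path_def pathstart_def pathfinish_def)

lemma path_image_ray_path: "path_image (ray_path f) = insert 0 (f ` {0..})"
proof -
  have "ray_path f ` {0..1} \<subseteq> insert 0 (f ` {0..})"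
    by (auto simp: ray_path_def)
  moreover have "f t \<in> ray_path f ` {0..1}" if "t \<ge> 0" for t
  proof
    have "t / (1 + t) / (1 - t / (1 + t)) = t" using that by (simp add: field_simps)
    moreover have "t / (1 + t) < 1" using that by (simp add: field_simps)
    ultimately show "f t = ray_path f (t / (1 + t))" by (simp add: ray_path_def)
  qed (use that in \<open>auto simp: field_simps\<close>)
  moreover have "0 \<in> ray_path f ` {0..1}" by (rule image_eqI[of _ _ 1]) (auto simp: ray_path_def)
  ultimately show ?thesis unfolding path_image_def by auto
qed

lemma path_ray_path:
  assumes f: "continuous_on {0..} f" "(f \<longlongrightarrow> 0) at_top"
  shows "path (ray_path f)"
  unfolding path_def continuous_on_def
proof
  fix s :: real assume s: "s \<in> {0..1}"
  show "(ray_path f \<longlongrightarrow> ray_path f s) (at s within {0..1})"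
  proof (cases "s < 1")
    case True
    have "continuous_on {0..<1} (\<lambda>s. f (s / (1 - s)))"
      by (rule continuous_on_compose2[OF f(1)]) (auto intro!: continuous_intros)
    then have "continuous_on {0..<1} (ray_path f)"
      by (rule continuous_on_eq) (simp add: ray_path_def)
    then have "(ray_path f \<longlongrightarrow> ray_path f s) (at s within {0..<1})"
      using True s by (auto simp: continuous_on_def)
    moreover have "at s within {0..<1} = at s within {0..1}"
      by (rule at_within_nhd[where S = "{..<1}"]) (use True in auto)
    ultimately show ?thesis by simp
  next
    case False
    then have s1: "s = 1" using s by simp
    have "LIM s at_left (1::real). s / (1 - s) :> at_top"
      by (rule LIM_at_top_divide[where a = 1])
        (auto intro!: tendsto_eq_intros eventually_at_leftI[of 0])
    from filterlim_compose[OF f(2) this]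
    have "((\<lambda>s. f (s / (1 - s))) \<longlongrightarrow> 0) (at_left 1)" .
    moreover have "\<forall>\<^sub>F s in at_left 1. f (s / (1 - s)) = ray_path f s"
      by (rule eventually_at_leftI[of 0]) (auto simp: ray_path_def)
    ultimately have "(ray_path f \<longlongrightarrow> 0) (at_left 1)" by (rule Lim_transform_eventually)
    then show ?thesis unfolding s1 by (simp add: ray_path_def at_within_Icc_at_left)
  qed
qed

lemma arc_ray_path:
  assumes f: "continuous_on {0..} f" "(f \<longlongrightarrow> 0) at_top" and inj: "inj_on f {0..}" "0 \<notin> f ` {0..}"
  shows "arc (ray_path f)"
  unfolding arc_def
proof
  show "path (ray_path f)" by (rule path_ray_path[OF f])
  show "inj_on (ray_path f) {0..1}"
  proof (rule inj_onI)
    fix s t :: real assume st: "s \<in> {0..1}" "t \<in> {0..1}" "ray_path f s = ray_path f t"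
    have nz: "f (x / (1 - x)) \<noteq> 0" if "0 \<le> x" "x < 1" for x
      using inj(2) that by (metis atLeast_iff divide_nonneg_pos diff_gt_0_iff_gt image_eqI)
    consider "s < 1" "t < 1" | "s = 1" "t = 1" | "s < 1" "t = 1" | "s = 1" "t < 1" using st by force
    then show "s = t"
    proof cases
      case 1
      then have "s / (1 - s) = t / (1 - t)"
        using st inj(1) by (auto simp: ray_path_def inj_on_def)
      then show ?thesis using 1 by (simp add: field_simps)
    qed (use st nz[of s] nz[of t] in \<open>auto simp: ray_path_def\<close>)
  qed
qed

lemma connected_complement_imp_inside_empty:
  fixes S :: "complex set"
  assumes "connected (- S)" "\<not> bounded (- S)" shows "inside S = {}"
proof -
  have "connected_component_set (- S) x = - S" if "x \<notin> S" for x
    using assms(1) that by (simp add: connected_component_eq_self)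
  then show ?thesis using assms(2) by (auto simp: inside_def)
qed

text \<open>The complement of such a component is connected and unbounded: every other piece of the complement
  of \<open>C\<close> is attached to \<open>C\<close>.\<close>

lemma simply_connected_component:
  fixes C :: "complex set"
  assumes "closed C" "connected C" "\<not> bounded C" "q \<notin> C"
  shows "simply_connected (connected_component_set (- C) q)" "open (connected_component_set (- C) q)"
proof -
  let ?V = "connected_component_set (- C) q"
  show o: "open ?V" using assms(1) by (intro open_connected_component) auto
  have "?V \<in> components (- C)" using assms(4) by (simp add: componentsI)
  then have "connected (- ?V)" using assms(2) by (rule component_complement_connected[rotated])
  moreover have "C \<subseteq> - ?V" using connected_component_subset by fastforce
  then have "\<not> bounded (- ?V)" using assms(3) bounded_subset by blast
  ultimately have "inside ?V = {}" by (rule connected_complement_imp_inside_empty)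
  then show "simply_connected ?V"
    using o by (simp add: simply_connected_eq_empty_inside)
qed

lemma connected_Un_common:
  "connected A \<Longrightarrow> connected B \<Longrightarrow> x \<in> A \<Longrightarrow> x \<in> B \<Longrightarrow> connected (A \<union> B)"
  by (intro connected_Un) auto

context cusp_chart
begin

lemma deck_ph:
  "deck N p g \<Longrightarrow> u = g (h (Complex x s)) \<Longrightarrow> s > y \<Longrightarrow> p u = p (h (Complex x s))"
  using h_in_N[of "Complex x s"] by (auto simp: deck_def)

text \<open>High up in the cusp the ray is seen only as a single vertical line: its initial part is
  compact and stays away from the puncture.\<close>

lemma vertical_tail:
  assumes r: "continuous_on {0..} (p \<circ> r)" "0 \<notin> (p \<circ> r) ` {0..}"
    and v: "deck N p g" "k > 0" "\<And>t. t \<ge> 0 \<Longrightarrow> r t = g (h (Complex x (k * exp t)))"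
  shows "\<exists>Y>y. \<forall>z. Im z > Y \<longrightarrow> (\<forall>t\<ge>0. p (h z) = p (r t) \<longrightarrow> Re z - x \<in> \<int>)"
proof -
  define T where "T = max 0 (ln (y / k))"
  have "compact ((p \<circ> r) ` {0..T})"
    by (intro compact_continuous_image continuous_on_subset[OF r(1)]) auto
  then have "closed ((p \<circ> r) ` {0..T})" by (rule compact_imp_closed)
  moreover have "0 \<notin> (p \<circ> r) ` {0..T}" using r(2) by auto
  ultimately obtain e where e: "e > 0" "ball 0 e \<inter> (p \<circ> r) ` {0..T} = {}"
    by (metis ComplI disjoint_eq_subset_Compl inf_commute open_Compl open_contains_ball)
  obtain Y where Y: "Y > y" "\<And>z. Im z > Y \<Longrightarrow> cmod (p (h z)) < e"
    using ph_small[OF e(1), of y] by blast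
  show ?thesis
  proof (intro exI[of _ Y] conjI allI impI)
    fix z t assume z: "Im z > Y" and t: "0 \<le> (t::real)" "p (h z) = p (r t)"
    have "t > T"
    proof (rule ccontr)
      assume "\<not> t > T"
      then have "p (h z) \<in> (p \<circ> r) ` {0..T}" using t by auto
      then show False using e Y(2)[OF z] by auto
    qed
    then have "ln (y / k) < t" by (simp add: T_def)
    then have "y / k < exp t" using y_pos v(2) by (metis divide_pos_pos exp_less_cancel_iff exp_ln)
    then have ky: "k * exp t > y" using v(2) by (simp add: field_simps)
    have "p (h z) = p (h (Complex x (k * exp t)))" using deck_ph[OF v(1) v(3)[OF t(1)] ky] t by simp
    then have "x - Re z \<in> \<int>" using ph_eq_iff[of z "Complex x (k * exp t)"] z Y ky by simp
    then show "Re z - x \<in> \<int>" by (metis Ints_minus minus_diff_eq)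
  qed (use Y in auto)
qed

text \<open>Two rays out the puncture that are disjoint apart from a common start form, with the puncture, a Jordan
  curve \<open>J\<close>. Suppose that \<open>\<alpha>\<^sub>2\<close> is outside. Then everything that obstructs lifting can be joined outside
  \<open>J\<close>: the set \<open>C\<close> consists of the exterior of the unit disc, the hole at \<open>\<alpha>\<^sub>2\<close>, a slit that runs down
  the cusp to the puncture, and arcs outside \<open>J\<close> that connect these. The component of its complement
  that contains both rays is simply connected, so the covering has a section \<open>k\<close> over it. The section carries
  the rays to geodesic rays with a common start. Cutting along the slit leaves one strip of the cusp, on which
  the section is a single isometry composed with the chart, and there both lifted rays are vertical. Two
  vertical lines through a common point coincide, but disjoint rays lie over different verticals.\<close>

lemma cusp_ray_pair_encloses_second_end:
  assumes r1: "hgeodesic {0..} r1" "r1 ` {0..} \<subseteq> N" "((p \<circ> r1) \<longlongrightarrow> 0) at_top" "inj_on (p \<circ> r1) {0..}"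
    and r2: "hgeodesic {0..} r2" "r2 ` {0..} \<subseteq> N" "((p \<circ> r2) \<longlongrightarrow> 0) at_top" "inj_on (p \<circ> r2) {0..}"
    and start: "p (r1 0) = p (r2 0)"
    and disj: "\<And>s t. s \<ge> 0 \<Longrightarrow> t \<ge> 0 \<Longrightarrow> p (r1 s) = p (r2 t) \<Longrightarrow> s = 0 \<and> t = 0"
    and core1: "\<And>t. t \<ge> 0 \<Longrightarrow> p (r1 t) \<in> core cusp2"
    and core2: "\<And>t. t \<ge> 0 \<Longrightarrow> p (r2 t) \<in> core cusp2"
  shows "1/2 \<notin> outside (path_image (ray_path (p \<circ> r1) +++ reversepath (ray_path (p \<circ> r2))))"
proof
  assume out: "1/2 \<in> outside (path_image (ray_path (p \<circ> r1) +++ reversepath (ray_path (p \<circ> r2))))"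
  define J where "J = insert 0 (p ` r1 ` {0..} \<union> p ` r2 ` {0..})"
  define P where "P = ray_path (p \<circ> r1) +++ reversepath (ray_path (p \<circ> r2))"
  have cont: "continuous_on {0..} (p \<circ> r1)" "continuous_on {0..} (p \<circ> r2)"
    using hgeodesic_continuous[OF r1(1)] hgeodesic_continuous[OF r2(1)] r1(2) r2(2)
    by (auto intro!: continuous_on_compose2[OF p_cont])
  have core0: "0 \<notin> core cusp2" by (auto simp: core_def)
  have img: "path_image P = J"
    unfolding P_def J_def
    by (subst path_image_join) (auto simp: ray_path_simps path_image_ray_path image_comp)
  have z1: "0 \<notin> (p \<circ> r1) ` {0..}" "0 \<notin> (p \<circ> r2) ` {0..}" using core1 core2 core0 by force+
  have arcs: "arc (ray_path (p \<circ> r1))" "arc (ray_path (p \<circ> r2))"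
    by (intro arc_ray_path cont r1 r2 z1)+
  have simple: "simple_path P" unfolding P_def
  proof (rule simple_path_join_loop)
    show "path_image (ray_path (p \<circ> r1)) \<inter> path_image (reversepath (ray_path (p \<circ> r2)))
       \<subseteq> {pathstart (ray_path (p \<circ> r1)), pathstart (reversepath (ray_path (p \<circ> r2)))}"
      using disj z1 by (fastforce simp: ray_path_simps path_image_ray_path)
  qed (use arcs start in \<open>auto simp: ray_path_simps arc_reversepath\<close>)
  have closedP: "pathfinish P = pathstart P" by (simp add: P_def ray_path_simps start)
  \<comment> \<open>the outer region, which contains the second end\<close>
  define O' where "O' = outside J"
  note jordan = Jordan_inside_outside[OF simple closedP, unfolded img]
  have O: "open O'" "connected O'" "frontier O' = J" "O' \<inter> J = {}"
    using jordan by (auto simp: O'_def)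
  have half: "1/2 \<in> O'" using out img by (simp add: O'_def P_def)
  have Jball: "J \<subseteq> ball 0 1" unfolding J_def using core1 core2 by (auto simp: core_def)
  have outer: "- ball 0 1 \<subseteq> O'" unfolding O'_def by (rule outside_subset_convex[OF convex_ball Jball])
  obtain g1 x1 k1 where v1: "deck N p g1" "k1 > 0" "\<And>t. t \<ge> 0 \<Longrightarrow> r1 t = g1 (h (Complex x1 (k1 * exp t)))"
    by (rule cusp_ray_vertical[OF r1(1-3)]) blast
  obtain g2 x2 k2 where v2: "deck N p g2" "k2 > 0" "\<And>t. t \<ge> 0 \<Longrightarrow> r2 t = g2 (h (Complex x2 (k2 * exp t)))"
    by (rule cusp_ray_vertical[OF r2(1-3)]) blast
  have level: "\<exists>t\<ge>0. k * exp t = s" if "k > 0" "s \<ge> k" for k s :: real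
    using that by (intro exI[of _ "ln (s / k)"]) auto
  \<comment> \<open>over the same vertical the rays would meet high up\<close>
  have xdiff: "x1 - x2 \<notin> \<int>"
  proof
    assume z: "x1 - x2 \<in> \<int>"
    define s where "s = max (2 * k1) (max (2 * k2) (y + 1))"
    have "s \<ge> k1" "s \<ge> k2" using v1(2) v2(2) by (simp_all add: s_def le_max_iff_disj)
    then obtain t t' where t: "t \<ge> 0" "k1 * exp t = s" "t' \<ge> 0" "k2 * exp t' = s"
      using level[OF v1(2), of s] level[OF v2(2), of s] by blast
    have sy: "s > y" by (simp add: s_def)
    have "p (r1 t) = p (h (Complex x1 s))" "p (r2 t') = p (h (Complex x2 s))"
      using deck_ph[OF v1(1) v1(3)] deck_ph[OF v2(1) v2(3)] t sy by auto
    moreover have "p (h (Complex x2 s)) = p (h (Complex x1 s))" using z sy by (subst ph_eq_iff) auto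
    ultimately have "t = 0" using disj[of t t'] t by simp
    then have "s = k1" using t by simp
    then show False using v1(2) by (auto simp: s_def max_def split: if_splits)
  qed
  obtain Ya where Ya: "Ya > y" "\<And>z t. Im z > Ya \<Longrightarrow> t \<ge> 0 \<Longrightarrow> p (h z) = p (r1 t) \<Longrightarrow> Re z - x1 \<in> \<int>"
    using vertical_tail[OF cont(1) z1(1) v1] by blast
  obtain Yb where Yb: "Yb > y" "\<And>z t. Im z > Yb \<Longrightarrow> t \<ge> 0 \<Longrightarrow> p (h z) = p (r2 t) \<Longrightarrow> Re z - x2 \<in> \<int>"
    using vertical_tail[OF cont(2) z1(2) v2] by blast
  define Y where "Y = max (max Ya Yb) (max k1 k2)"
  have Y: "Y > y" "Y \<ge> Ya" "Y \<ge> Yb" "Y \<ge> k1" "Y \<ge> k2" using Ya by (auto simp: Y_def)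
  have inJ: "p (h z) \<in> J \<longleftrightarrow> Re z - x1 \<in> \<int> \<or> Re z - x2 \<in> \<int>" if z: "Im z > Y" for z
  proof
    assume "p (h z) \<in> J"
    then show "Re z - x1 \<in> \<int> \<or> Re z - x2 \<in> \<int>"
      using ph_nonzero[of z] Ya(2)[of z] Yb(2)[of z] z Y by (auto simp: J_def)
  next
    have zy: "Im z > y" using z Y by simp
    assume "Re z - x1 \<in> \<int> \<or> Re z - x2 \<in> \<int>"
    then show "p (h z) \<in> J"
    proof
      assume a: "Re z - x1 \<in> \<int>"
      obtain t where t: "t \<ge> 0" "k1 * exp t = Im z" using level[of k1 "Im z"] v1 z Y by auto
      have "p (h z) = p (h (Complex x1 (k1 * exp t)))"
        using ph_eq_iff[of "Complex x1 (k1 * exp t)" z] a t zy by simp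
      then have "p (h z) = p (r1 t)" using deck_ph[OF v1(1) v1(3)[OF t(1)]] t zy by simp
      then show ?thesis using t by (auto simp: J_def)
    next
      assume a: "Re z - x2 \<in> \<int>"
      obtain t where t: "t \<ge> 0" "k2 * exp t = Im z" using level[of k2 "Im z"] v2 z Y by auto
      have "p (h z) = p (h (Complex x2 (k2 * exp t)))"
        using ph_eq_iff[of "Complex x2 (k2 * exp t)" z] a t zy by simp
      then have "p (h z) = p (r2 t)" using deck_ph[OF v2(1) v2(3)[OF t(1)]] t zy by simp
      then show ?thesis using t by (auto simp: J_def)
    qed
  qed
  \<comment> \<open>the puncture is on the frontier of the outer region, so some vertical line of the cusp enters it and
    then stays in it\<close>
  obtain e where e: "e > 0" "ball 0 e - {0} \<subseteq> (\<lambda>z. p (h z)) ` {z. Im z > Y}"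
    by (rule punctured_neighbourhood[OF Y(1)])
  have "0 \<in> closure O'" using O(3) unfolding frontier_def J_def by blast
  then obtain v where v: "v \<in> O'" "dist v 0 < e" using e(1) unfolding closure_approachable by blast
  have "v \<noteq> 0" using v(1) O(4) by (auto simp: J_def)
  then have "v \<in> ball 0 e - {0}" using v by (auto simp: dist_commute)
  then obtain w where w: "Im w > Y" "v = p (h w)" using e(2) by auto
  have vJ: "v \<notin> J" using v O(4) by blast
  define xm where "xm = Re w"
  have xm: "xm - x1 \<notin> \<int>" "xm - x2 \<notin> \<int>" using inJ[OF w(1)] vJ w by (auto simp: xm_def)
  define slit where "slit = (\<lambda>t. p (h (Complex xm (Im w + t))))"
  have slit_cont: "continuous_on {0..} slit"
    unfolding slit_def
  proof (rule continuous_on_compose2[OF ph_cont])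
    show "continuous_on {0..} (\<lambda>t. Complex xm (Im w + t))"
      unfolding Complex_eq by (intro continuous_intros)
  qed (use w Y in auto)
  have slit_lim: "(slit \<longlongrightarrow> 0) at_top"
    unfolding slit_def
  proof (rule filterlim_compose[OF h_lim])
    show "filterlim (\<lambda>t. Complex xm (Im w + t)) (filtercomap Im at_top) at_top"
      unfolding filterlim_filtercomap_iff comp_def complex.sel
      by (rule filterlim_tendsto_add_at_top[OF tendsto_const filterlim_ident])
  qed
  have slitO: "slit ` {0..} \<subseteq> O'"
  proof -
    have "connected (slit ` {0..})"
      by (intro connected_continuous_image slit_cont) auto
    moreover have "slit ` {0..} \<subseteq> - J"
      using inJ xm w by (auto simp: slit_def)
    moreover have "v \<in> slit ` {0..}" unfolding w(2) slit_def xm_def by (rule image_eqI[of _ _ 0]) auto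
    ultimately have "slit ` {0..} \<subseteq> connected_component_set (- J) v"
      by (intro connected_component_maximal) auto
    moreover have "connected_component_set (- J) v \<subseteq> O'"
      using v(1) unfolding O'_def by (metis outside_same_component mem_Collect_eq subsetI)
    ultimately show ?thesis by blast
  qed
  have pc: "path_connected O'" using O by (simp add: connected_open_path_connected)
  obtain c1 where c1: "path c1" "path_image c1 \<subseteq> O'" "pathstart c1 = v" "pathfinish c1 = 1"
    using pc v(1) outer unfolding path_connected_def by (metis Compl_iff dist_0_norm less_irrefl mem_ball norm_one subsetD)
  obtain c2 where c2: "path c2" "path_image c2 \<subseteq> O'" "pathstart c2 = 1/2" "pathfinish c2 = 1"
    using pc half outer unfolding path_connected_def by (metis Compl_iff dist_0_norm less_irrefl mem_ball norm_one subsetD)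
  define B :: "complex set" where "B = (if cusp2 then {1/2} else cball (1/2) (1/4))"
  \<comment> \<open>the obstructions to lifting, joined to one closed connected unbounded set\<close>
  define C where "C = path_image (ray_path slit) \<union> (path_image c1 \<union> (path_image c2 \<union> (- ball 0 1 \<union> B)))"
  have Bc: "closed B" "connected B" "1/2 \<in> B" "0 \<notin> B" by (auto simp: B_def dist_norm)
  have core_B: "core cusp2 = ball 0 1 - {0} - B" by (simp add: core_def B_def)
  have slit_path: "path (ray_path slit)" by (rule path_ray_path[OF slit_cont slit_lim])
  have closedC: "closed C" unfolding C_def using slit_path c1 c2 Bc
    by (intro closed_Un closed_path_image) auto
  have ends: "v \<in> path_image (ray_path slit)" "v \<in> path_image c1" "1 \<in> path_image c1"
    "1 \<in> path_image c2" "1/2 \<in> path_image c2" "(1::complex) \<in> - ball 0 1"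
  proof -
    have "slit 0 = v" by (simp add: slit_def xm_def w)
    then show "v \<in> path_image (ray_path slit)" by (auto simp: path_image_ray_path)
    show "1/2 \<in> path_image c2" using pathstart_in_path_image[of c2] unfolding c2(3) .
  qed (use c1 c2 pathstart_in_path_image[of c1] pathfinish_in_path_image[of c1]
      pathstart_in_path_image[of c2] pathfinish_in_path_image[of c2] in simp_all)
  have conC: "connected C"
  proof -
    have outcon: "connected (- ball 0 1 :: complex set)"
      by (intro connected_complement_bounded_convex) auto
    have 1: "connected (- ball 0 1 \<union> path_image c2 \<union> B)"
      using ends Bc outcon connected_path_image[OF c2(1)]
      by (intro connected_Un_common[of "- ball 0 1 \<union> path_image c2" B "1/2"] connected_Un_common[of "- ball 0 1" "path_image c2" 1]) auto
    have 2: "connected (path_image (ray_path slit) \<union> path_image c1)"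
      using ends by (intro connected_Un_common[where x = v] connected_path_image slit_path c1) auto
    have "connected ((path_image (ray_path slit) \<union> path_image c1) \<union> (- ball 0 1 \<union> path_image c2 \<union> B))"
      using ends by (intro connected_Un_common[OF 2 1, of 1]) auto
    then show ?thesis unfolding C_def by (simp add: Un_ac)
  qed
  have unbC: "\<not> bounded C"
  proof
    assume "bounded C"
    then have "bounded (- ball 0 1 :: complex set)" by (rule bounded_subset) (auto simp: C_def)
    then show False using cobounded_imp_unbounded[of "- ball 0 1 :: complex set"] by simp
  qed
  have zC: "0 \<in> C" using pathfinish_in_path_image[of "ray_path slit"] by (auto simp: C_def ray_path_simps)
  have CO: "C \<subseteq> insert 0 (O' \<union> B)"
    using slitO c1 c2 outer by (auto simp: C_def path_image_ray_path)
  have subcore: "- C \<subseteq> core cusp2" using zC by (auto simp: core_B C_def)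
  define J0 where "J0 = p ` r1 ` {0..} \<union> p ` r2 ` {0..}"
  have J0core: "J0 \<subseteq> core cusp2" using core1 core2 by (auto simp: J0_def)
  have J0C: "J0 \<subseteq> - C"
  proof -
    have "J0 \<inter> O' = {}" using O(4) by (auto simp: J0_def J_def)
    moreover have "J0 \<inter> B = {}" "0 \<notin> J0" using J0core by (auto simp: core_B)
    ultimately show ?thesis using CO by blast
  qed
  define q where "q = p (r1 0)"
  have q: "q \<in> J0" "q \<notin> C" using J0C by (auto simp: q_def J0_def)
  define V where "V = connected_component_set (- C) q"
  have V: "simply_connected V" "open V" unfolding V_def
    by (rule simply_connected_component[OF closedC conC unbC q(2)])+
  have Vsub: "V \<subseteq> - C" unfolding V_def by (rule connected_component_subset)
  have conJ0: "connected J0"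
  proof -
    have "connected ((p \<circ> r1) ` {0..})" "connected ((p \<circ> r2) ` {0..})"
      by (intro connected_continuous_image cont; simp)+
    moreover have "q \<in> (p \<circ> r1) ` {0..} \<inter> (p \<circ> r2) ` {0..}"
    proof
      show "q \<in> (p \<circ> r1) ` {0..}" unfolding q_def by (rule image_eqI[of _ _ 0]) auto
      show "q \<in> (p \<circ> r2) ` {0..}" unfolding q_def start by (rule image_eqI[of _ _ 0]) auto
    qed
    ultimately have "connected ((p \<circ> r1) ` {0..} \<union> (p \<circ> r2) ` {0..})"
      by (intro connected_Un) auto
    then show ?thesis by (simp add: J0_def image_comp)
  qed
  have J0V: "J0 \<subseteq> V" unfolding V_def by (rule connected_component_maximal[OF q(1) conJ0 J0C])
  have Vp: "V \<subseteq> pants cusp2" using Vsub subcore core_subset_pants by blast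
  have lpc: "locally path_connected V" by (rule open_imp_locally_path_connected[OF V(2)])
  have idV: "id \<in> V \<rightarrow> pants cusp2" using Vp by auto
  \<comment> \<open>a section of the covering over the simply connected region\<close>
  have "\<exists>k. continuous_on V k \<and> k \<in> V \<rightarrow> N \<and> (\<forall>u\<in>V. p (k u) = id u)"
    by (rule covering_space_lift[OF cov V(1) lpc continuous_on_id[unfolded id_def[symmetric]] idV]) (intro exI conjI ballI; assumption?; simp)
  then obtain k where k: "continuous_on V k" "k \<in> V \<rightarrow> N" "\<And>u. u \<in> V \<Longrightarrow> p (k u) = id u"
    by auto
  have kN: "k u \<in> N" if "u \<in> V" for u using k(2) that by blast
  have qV: "q \<in> V" using q J0V by blast
  \<comment> \<open>by uniqueness of lifts the section carries each ray to a translate of its given lift, which is a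
    geodesic ray\<close>
  have lift: "\<exists>R. hgeodesic {0..} R \<and> R 0 = k q \<and> (\<forall>t\<ge>0. k (p (r t)) = R t)"
    if r: "hgeodesic {0..} r" "r ` {0..} \<subseteq> N" "continuous_on {0..} (p \<circ> r)" "p (r 0) = q"
      "p ` r ` {0..} \<subseteq> V" for r
  proof -
    have prV: "p (r x) \<in> V" if "x \<ge> 0" for x
      by (rule subsetD[OF r(5)], rule imageI, rule imageI) (use that in simp)
    have "r 0 \<in> N" using r(2) by auto
    then obtain f where f: "deck N p f" "f (r 0) = k q"
      using deck_exists[of "r 0" "k q"] kN[OF qV] k(3)[OF qV] r(4) by auto
    note R = deck_hgeodesic[OF f(1) r(1,2)]
    have "(k \<circ> (p \<circ> r)) t = (f \<circ> r) t" if t: "t \<ge> 0" for t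
    proof (rule covering_space_lift_unique[OF cov, of "k \<circ> (p \<circ> r)" 0 "f \<circ> r" "{0..}" "p \<circ> r" t])
      show "continuous_on {0..} (k \<circ> (p \<circ> r))"
        by (rule continuous_on_compose[OF r(3) continuous_on_subset[OF k(1)]]) (use prV in auto)
      show "continuous_on {0..} (f \<circ> r)" by (rule hgeodesic_continuous[OF R(1)])
      show "p \<circ> r \<in> {0..} \<rightarrow> pants cusp2" using prV Vp by auto
      show "k \<circ> (p \<circ> r) \<in> {0..} \<rightarrow> N" using prV kN by auto
      show "f \<circ> r \<in> {0..} \<rightarrow> N" using R(2) by auto
      show "(p \<circ> r) x = p ((k \<circ> (p \<circ> r)) x)" if "x \<in> {0..}" for x
        using that k(3)[OF prV[of x]] by simp
      show "(p \<circ> r) x = p ((f \<circ> r) x)" if "x \<in> {0..}" for x using R(3)[OF that] by simp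
      show "(k \<circ> (p \<circ> r)) 0 = (f \<circ> r) 0" using r(4) f(2) by simp
    qed (use r(3) t in simp_all)
    then show ?thesis using R(1) f(2) by (intro exI[of _ "f \<circ> r"]) auto
  qed
  obtain R1 where R1: "hgeodesic {0..} R1" "R1 0 = k q" "\<And>t. t \<ge> 0 \<Longrightarrow> k (p (r1 t)) = R1 t"
    using lift[OF r1(1,2) cont(1)] J0V by (auto simp: q_def J0_def)
  obtain R2 where R2: "hgeodesic {0..} R2" "R2 0 = k q" "\<And>t. t \<ge> 0 \<Longrightarrow> k (p (r2 t)) = R2 t"
    using lift[OF r2(1,2) cont(2)] J0V start by (auto simp: q_def J0_def)
  \<comment> \<open>the strip between two copies of the slit, taken so high that the rest of the cut is not seen from it\<close>
  define C' where "C' = path_image c1 \<union> (path_image c2 \<union> (- ball 0 1 \<union> B))"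
  have "closed C'" unfolding C'_def using c1 c2 Bc by (intro closed_Un closed_path_image) auto
  moreover have "0 \<notin> C'" using c1(2) c2(2) Bc O(4) by (auto simp: C'_def J_def)
  ultimately obtain e' where e': "e' > 0" "ball 0 e' \<inter> C' = {}"
    by (metis ComplI disjoint_eq_subset_Compl inf_commute open_Compl open_contains_ball)
  obtain Y2 where Y2: "Y2 > Y" "\<And>z. Im z > Y2 \<Longrightarrow> cmod (p (h z)) < e'"
    using ph_small[OF e'(1), of Y] by blast
  define S where "S = {z. xm < Re z} \<inter> {z. Re z < xm + 1} \<inter> {z. Im z > Y2}"
  have Sy: "Im z > y" if "z \<in> S" for z using that Y2 Y by (auto simp: S_def)
  have convS: "connected S" unfolding S_def
    by (intro convex_connected convex_Int convex_halfspace_Re_gt convex_halfspace_Re_lt convex_halfspace_Im_gt)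
  have SC: "(\<lambda>z. p (h z)) ` S \<subseteq> - C"
  proof
    fix u assume "u \<in> (\<lambda>z. p (h z)) ` S"
    then obtain z where z: "z \<in> S" "u = p (h z)" by blast
    have "Im z > Y2" using z(1) by (simp add: S_def)
    then have "u \<in> ball 0 e'" using Y2(2)[of z] z(2) by simp
    then have u1: "u \<notin> C'" using e'(2) by blast
    have u2: "u \<noteq> 0" unfolding z(2) by (rule ph_nonzero[OF Sy[OF z(1)]])
    have u3: "u \<noteq> slit t" if "t \<ge> 0" for t
    proof
      assume "u = slit t"
      then have "xm - Re z \<in> \<int>"
        using ph_eq_iff[of z "Complex xm (Im w + t)"] z Sy[OF z(1)] w Y that by (auto simp: slit_def)
      moreover have "\<bar>xm - Re z\<bar> < 1" "xm - Re z \<noteq> 0" using z(1) by (auto simp: S_def)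
      ultimately show False by (metis Ints_nonzero_abs_less1)
    qed
    have "u \<notin> path_image (ray_path slit)" unfolding path_image_ray_path using u2 u3 by auto
    then show "u \<in> - C" using u1 unfolding C_def C'_def by blast
  qed
  have shift: "\<exists>x'. x' - x \<in> \<int> \<and> xm < x' \<and> x' < xm + 1" if "xm - x \<notin> \<int>" for x
  proof (intro exI conjI)
    have ne: "of_int \<lceil>xm - x\<rceil> \<noteq> xm - x" using that by (metis Ints_of_int)
    show "xm < x + of_int \<lceil>xm - x\<rceil>" using ne le_of_int_ceiling[of "xm - x"] by linarith
    show "x + of_int \<lceil>xm - x\<rceil> < xm + 1" using ceiling_correct[of "xm - x"] by linarith
  qed simp
  obtain x1' where x1': "x1' - x1 \<in> \<int>" "xm < x1'" "x1' < xm + 1" using shift[OF xm(1)] by blast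
  obtain x2' where x2': "x2' - x2 \<in> \<int>" "xm < x2'" "x2' < xm + 1" using shift[OF xm(2)] by blast
  have SV: "(\<lambda>z. p (h z)) ` S \<subseteq> V"
  proof -
    define z where "z = Complex x1' (Y2 + 1)"
    have z: "z \<in> S" using x1' by (simp add: S_def z_def)
    have "p (h z) \<in> J" using inJ[of z] x1' Y2 by (simp add: z_def)
    then have "p (h z) \<in> J0" using ph_nonzero[OF Sy[OF z]] by (auto simp: J_def J0_def)
    then have "p (h z) \<in> V" using J0V by blast
    then have eqV: "V = connected_component_set (- C) (p (h z))"
      unfolding V_def by (simp add: connected_component_eq)
    have "connected ((\<lambda>z. p (h z)) ` S)"
      by (intro connected_continuous_image convS continuous_on_subset[OF ph_cont]) (use Sy in auto)
    then show ?thesis unfolding eqV using z SC by (intro connected_component_maximal) auto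
  qed
  define z0 where "z0 = Complex x1' (Y2 + 1)"
  have z0: "z0 \<in> S" using x1' by (simp add: S_def z0_def)
  have hS: "h z \<in> N" if "z \<in> S" for z using h_in_N Sy that by blast
  have phV: "p (h z) \<in> V" if "z \<in> S" for z using SV that by blast
  obtain g where g: "deck N p g" "g (h z0) = k (p (h z0))"
    using deck_exists[OF hS[OF z0] kN[OF phV[OF z0]]] k(3)[OF phV[OF z0]] by auto
  have giso: "hisometry g" and gN: "g ` N = N" and pg: "\<And>z. z \<in> N \<Longrightarrow> p (g z) = p z"
    using g(1) by (auto simp: deck_def)
  \<comment> \<open>on this strip the section is the chart followed by one covering isometry\<close>
  have ghk: "k (p (h z)) = g (h z)" if z: "z \<in> S" for z
  proof (rule covering_space_lift_unique[OF cov, of "\<lambda>z. k (p (h z))" z0 "\<lambda>z. g (h z)" S "\<lambda>z. p (h z)" z])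
    show ph: "continuous_on S (\<lambda>z. p (h z))"
      by (rule continuous_on_subset[OF ph_cont]) (use Sy in auto)
    show "continuous_on S (\<lambda>z. k (p (h z)))"
      by (rule continuous_on_compose2[OF k(1) ph SV])
    have "continuous_on S h"
      by (rule continuous_on_subset[OF hisometry_continuous[OF h_iso]])
        (use Sy y_pos in \<open>force simp: uhp_def\<close>)
    then show "continuous_on S (\<lambda>z. g (h z))"
      by (rule continuous_on_compose2[OF hisometry_continuous[OF giso]]) (use hS N_uhp in auto)
    show "(\<lambda>z. p (h z)) \<in> S \<rightarrow> pants cusp2" using phV Vp by blast
    show "(\<lambda>z. k (p (h z))) \<in> S \<rightarrow> N" using phV kN by blast
    show "(\<lambda>z. g (h z)) \<in> S \<rightarrow> N" using hS gN by blast
    show "p (h x) = p (k (p (h x)))" if "x \<in> S" for x using k(3)[OF phV[OF that]] by simp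
    show "p (h x) = p (g (h x))" if "x \<in> S" for x using pg[OF hS[OF that]] by simp
  qed (use g z0 z convS in auto)
  \<comment> \<open>the lifted ray agrees with a vertical one high up, hence from its start\<close>
  have vertical: "R 0 = g (h (Complex x' \<kappa>))"
    if R: "hgeodesic {0..} R" "\<And>t. t \<ge> 0 \<Longrightarrow> k (p (r t)) = R t"
      and vv: "deck N p g'" "\<kappa> > 0" "\<And>t. t \<ge> 0 \<Longrightarrow> r t = g' (h (Complex x (\<kappa> * exp t)))"
      and x': "x' - x \<in> \<int>" "xm < x'" "x' < xm + 1" for R r g' \<kappa> x x'
  proof -
    let ?G = "\<lambda>t. g (h (Complex x' (\<kappa> * exp t)))"
    have G: "hgeodesic {0..} ?G"
      using hisometry_hgeodesic[OF giso hisometry_hgeodesic[OF h_iso hgeodesic_vertical[OF vv(2), of "{0..}" x']]]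
      by (simp add: comp_def)
    have eq: "R t = ?G t" if t: "t \<ge> 0" "\<kappa> * exp t > Y2" for t
    proof -
      have z: "Complex x' (\<kappa> * exp t) \<in> S" using t x' by (simp add: S_def)
      have "p (r t) = p (h (Complex x (\<kappa> * exp t)))"
        using deck_ph[OF vv(1) vv(3)[OF t(1)]] t Y2 Y by simp
      also have "\<dots> = p (h (Complex x' (\<kappa> * exp t)))"
        using t Y2 Y x' by (subst ph_eq_iff) auto
      finally have "R t = k (p (h (Complex x' (\<kappa> * exp t))))" using R(2)[OF t(1)] by simp
      then show ?thesis using ghk[OF z] by simp
    qed
    define T where "T = max 0 (Y2 / \<kappa>)"
    have big: "\<kappa> * exp t > Y2" if "t \<ge> T" for t
    proof -
      have "Y2 / \<kappa> \<le> t" using that by (simp add: T_def)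
      then have "Y2 / \<kappa> < exp t" using exp_ge_add_one_self[of t] by linarith
      then show ?thesis using vv(2) by (simp add: field_simps)
    qed
    have "R 0 = ?G 0"
      by (rule hgeodesic_unique[OF R(1) G, of T "T + 1"])
        (use eq[of T] eq[of "T + 1"] big[of T] big[of "T + 1"] in \<open>auto simp: T_def\<close>)
    then show ?thesis by simp
  qed
  have "g (h (Complex x1' k1)) = g (h (Complex x2' k2))"
    using vertical[OF R1(1,3) v1 x1'] vertical[OF R2(1,3) v2 x2'] R1(2) R2(2) by simp
  moreover have "inj_on g uhp" "inj_on h uhp" using giso h_iso by (auto simp: hisometry_def bij_betw_def)
  moreover have "Complex x1' k1 \<in> uhp" "Complex x2' k2 \<in> uhp" using v1 v2 by (auto simp: uhp_def)
  ultimately have "Complex x1' k1 = Complex x2' k2"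
    using hisometry_uhp[OF h_iso] by (metis inj_onD)
  then have "x1' = x2'" by simp
  then have "x1 - x2 = (x2' - x2) - (x1' - x1)" by simp
  then have "x1 - x2 \<in> \<int>" using x1'(1) x2'(1) by (metis Ints_diff)
  then show False using xdiff by simp
qed

end

section \<open>The rays \<open>\<gamma>\<close> and \<open>\<beta>\<close> do not meet\<close>

lemma hgeodesic_reparam:
  assumes "hgeodesic I c" "f ` J \<subseteq> I" "\<And>s t. \<bar>f s - f t\<bar> = \<bar>s - t\<bar>"
  shows "hgeodesic J (\<lambda>t. c (f t))"
  using assms unfolding hgeodesic_def by (simp add: image_subset_iff)

context cusp_chart
begin

definition cusp_ray :: "(real \<Rightarrow> complex) \<Rightarrow> bool" where
  "cusp_ray r \<longleftrightarrow> hgeodesic {0..} r \<and> r ` {0..} \<subseteq> N \<and> ((p \<circ> r) \<longlongrightarrow> 0) at_top \<and>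
     inj_on (p \<circ> r) {0..} \<and> (\<forall>t\<ge>0. p (r t) \<in> core cusp2)"

lemma cusp_rayD:
  assumes "cusp_ray r"
  shows "hgeodesic {0..} r" "r ` {0..} \<subseteq> N" "((p \<circ> r) \<longlongrightarrow> 0) at_top" "inj_on (p \<circ> r) {0..}"
    "\<And>t. t \<ge> 0 \<Longrightarrow> p (r t) \<in> core cusp2" "continuous_on {0..} (p \<circ> r)"
    "0 \<notin> (p \<circ> r) ` {0..}" "1/2 \<notin> (p \<circ> r) ` {0..}"
proof -
  show r: "hgeodesic {0..} r" "r ` {0..} \<subseteq> N" "((p \<circ> r) \<longlongrightarrow> 0) at_top" "inj_on (p \<circ> r) {0..}"
    and c: "\<And>t. t \<ge> 0 \<Longrightarrow> p (r t) \<in> core cusp2"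
    using assms unfolding cusp_ray_def by auto
  show "continuous_on {0..} (p \<circ> r)"
    using hgeodesic_continuous[OF r(1)] r(2) by (auto intro!: continuous_on_compose2[OF p_cont])
  have "0 \<notin> core cusp2" "1/2 \<notin> core cusp2" by (auto simp: core_def)
  then show "0 \<notin> (p \<circ> r) ` {0..}" "1/2 \<notin> (p \<circ> r) ` {0..}" using c by force+
qed

text \<open>The difference is the winding number of the Jordan curve formed by the two rays, and the
  second end is inside.\<close>

lemma winding_number_ray_pair:
  assumes r1: "cusp_ray r1" and r2: "cusp_ray r2" and start: "p (r1 0) = p (r2 0)"
    and disj: "\<And>s t. s \<ge> 0 \<Longrightarrow> t \<ge> 0 \<Longrightarrow> p (r1 s) = p (r2 t) \<Longrightarrow> s = 0 \<and> t = 0"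
  shows "winding_number (ray_path (p \<circ> r1)) (1/2) - winding_number (ray_path (p \<circ> r2)) (1/2) \<in> {-1, 1}"
proof -
  note D1 = cusp_rayD[OF r1] and D2 = cusp_rayD[OF r2]
  let ?p1 = "ray_path (p \<circ> r1)" and ?p2 = "ray_path (p \<circ> r2)"
  let ?P = "?p1 +++ reversepath ?p2"
  have arcs: "arc ?p1" "arc ?p2"
    by (intro arc_ray_path D1 D2)+
  have img: "path_image ?p1 \<inter> path_image ?p2 \<subseteq> {p (r1 0), 0}"
  proof
    fix x assume x: "x \<in> path_image ?p1 \<inter> path_image ?p2"
    show "x \<in> {p (r1 0), 0}"
    proof (cases "x = 0")
      case False
      then obtain s t where "s \<ge> 0" "t \<ge> 0" "x = p (r1 s)" "x = p (r2 t)"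
        using x by (auto simp: path_image_ray_path)
      then show ?thesis using disj[of s t] by auto
    qed simp
  qed
  have simple: "simple_path ?P"
    by (rule simple_path_join_loop) (use arcs start img in \<open>auto simp: ray_path_simps arc_reversepath\<close>)
  have closedP: "pathfinish ?P = pathstart ?P" by (simp add: ray_path_simps start)
  have half: "1/2 \<notin> path_image ?p1" "1/2 \<notin> path_image ?p2"
    using D1(8) D2(8) by (auto simp: path_image_ray_path)
  have notin: "1/2 \<notin> path_image ?P"
    using half by (subst path_image_join) (auto simp: ray_path_simps)
  have wn: "winding_number ?P (1/2) = winding_number ?p1 (1/2) - winding_number ?p2 (1/2)"
    using half arcs by (subst winding_number_join)
      (auto simp: winding_number_reversepath ray_path_simps arc_imp_path)
  have "1/2 \<in> inside (path_image ?P)"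
  proof (rule ccontr)
    assume "\<not> ?thesis"
    then have "1/2 \<in> outside (path_image ?P)" using notin inside_Un_outside by blast
    then show False
      using cusp_ray_pair_encloses_second_end[OF D1(1-4) D2(1-4) start disj D1(5) D2(5)] by blast
  qed
  then have "cmod (winding_number ?P (1/2)) = 1"
    by (rule simple_closed_path_norm_winding_number_inside[OF simple])
  moreover have "winding_number ?P (1/2) \<in> {-1, 0, 1}"
    by (rule simple_closed_path_winding_number_cases[OF simple closedP notin])
  ultimately show ?thesis unfolding wn by auto
qed

text \<open>A sum of two odd numbers is even.\<close>

lemma no_three_cusp_rays:
  assumes r: "cusp_ray r1" "cusp_ray r2" "cusp_ray r3"
    and start: "p (r1 0) = p (r2 0)" "p (r2 0) = p (r3 0)"
    and d12: "\<And>s t. s \<ge> 0 \<Longrightarrow> t \<ge> 0 \<Longrightarrow> p (r1 s) = p (r2 t) \<Longrightarrow> s = 0 \<and> t = 0"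
    and d23: "\<And>s t. s \<ge> 0 \<Longrightarrow> t \<ge> 0 \<Longrightarrow> p (r2 s) = p (r3 t) \<Longrightarrow> s = 0 \<and> t = 0"
    and d13: "\<And>s t. s \<ge> 0 \<Longrightarrow> t \<ge> 0 \<Longrightarrow> p (r1 s) = p (r3 t) \<Longrightarrow> s = 0 \<and> t = 0"
  shows False
proof -
  define w where "w = (\<lambda>r. winding_number (ray_path (p \<circ> r)) (1/2))"
  have 1: "w r1 - w r2 \<in> {-1, 1}" unfolding w_def by (rule winding_number_ray_pair[OF r(1,2) start(1) d12])
  have 2: "w r2 - w r3 \<in> {-1, 1}" unfolding w_def by (rule winding_number_ray_pair[OF r(2,3) start(2) d23])
  have 3: "w r1 - w r3 \<in> {-1, 1}" unfolding w_def
    by (rule winding_number_ray_pair[OF r(1,3) trans[OF start] d13])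
  have "w r1 - w r3 = (w r1 - w r2) + (w r2 - w r3)" by simp
  moreover have "u + v \<notin> {-1, 1}" if "u \<in> {-1, 1}" "v \<in> {-1, 1}" for u v :: complex
    using that by (auto simp: complex_eq_iff)
  ultimately show False using 1 2 3 by metis
qed

text \<open>Geodesics over the same vertical line of the cusp have equal projections high up, hence, after a
  covering isometry, everywhere.\<close>

lemma asymptotic_geodesics:
  assumes r: "hgeodesic {0..} r" "r ` {0..} \<subseteq> N"
    and b: "hgeodesic UNIV b" "range b \<subseteq> N"
    and v0: "deck N p g0" "k0 > 0" "\<And>t. t \<ge> 0 \<Longrightarrow> r t = g0 (h (Complex x0 (k0 * exp t)))"
    and v1: "deck N p g1" "k1 > 0" "\<And>t. t \<ge> 0 \<Longrightarrow> b t = g1 (h (Complex x1 (k1 * exp t)))"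
    and x: "x0 - x1 \<in> \<int>"
  shows "\<exists>f c. deck N p f \<and> (\<forall>t\<ge>0. r t = f (b (t + c)))"
proof -
  define c where "c = ln (k0 / k1)"
  have kc: "k1 * exp (t + c) = k0 * exp t" for t
    using v0(2) v1(2) by (simp add: c_def exp_add)
  define T where "T = max 0 (max (- c) (y / k0))"
  have T: "T \<ge> 0" "T + c \<ge> 0" "T \<ge> y / k0" by (auto simp: T_def)
  have eqp: "p (r t) = p (b (t + c))" if t: "t \<ge> T" for t
  proof -
    have "y / k0 < exp t" using t T exp_ge_add_one_self[of t] by linarith
    then have big: "k0 * exp t > y" using v0(2) by (simp add: field_simps)
    have tc: "t \<ge> 0" "t + c \<ge> 0" using t T by auto
    have "p (r t) = p (h (Complex x0 (k0 * exp t)))" by (rule deck_ph[OF v0(1) v0(3)[OF tc(1)] big])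
    also have "\<dots> = p (h (Complex x1 (k0 * exp t)))"
      using big x by (subst ph_eq_iff) (auto, metis Ints_minus minus_diff_eq)
    also have "\<dots> = p (b (t + c))"
      using deck_ph[OF v1(1) v1(3)[OF tc(2)]] big unfolding kc by simp
    finally show ?thesis .
  qed
  have rN: "r t \<in> N" if "t \<ge> 0" for t using r(2) that by auto
  have bN: "b t \<in> N" for t using b(2) by auto
  obtain f where f: "deck N p f" "f (b (T + c)) = r T"
    using deck_exists[OF bN rN[OF T(1)]] eqp[of T] by (metis order_refl)
  define B where "B = (\<lambda>t. (f \<circ> b) (t + c))"
  note F = deck_hgeodesic[OF f(1) b]
  have geoB: "hgeodesic {0..} B" unfolding B_def by (rule hgeodesic_reparam[OF F(1)]) auto
  have BN: "B t \<in> N" for t using F(2) unfolding B_def by blast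
  have pB: "p (B t) = p (b (t + c))" for t using F(3) unfolding B_def by simp
  have eqT: "r t = B t" if t: "t \<ge> T" for t
  proof (rule covering_space_lift_unique[OF cov, of r T B "{T..}" "p \<circ> r" t])
    have sub: "{T..} \<subseteq> {0..}" using T by auto
    show "continuous_on {T..} r" "continuous_on {T..} B"
      using hgeodesic_continuous[OF r(1)] hgeodesic_continuous[OF geoB] continuous_on_subset[OF _ sub] by auto
    show "continuous_on {T..} (p \<circ> r)"
      by (rule continuous_on_compose) (use \<open>continuous_on {T..} r\<close> rN T in \<open>auto intro: continuous_on_subset[OF p_cont]\<close>)
    show "r \<in> {T..} \<rightarrow> N" using rN T by auto
    show "B \<in> {T..} \<rightarrow> N" using BN by auto
    show "p \<circ> r \<in> {T..} \<rightarrow> pants cusp2" using rN T p_image by auto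
    show "(p \<circ> r) u = p (B u)" if "u \<in> {T..}" for u using pB[of u] eqp[of u] that by simp
    show "r T = B T" using f(2) by (simp add: B_def)
  qed (use t in auto)
  have "r t = f (b (t + c))" if t: "t \<ge> 0" for t
  proof -
    have "r t = B t"
      by (rule hgeodesic_unique[OF r(1) geoB, of T "T + 1"]) (use T t eqT in auto)
    then show ?thesis by (simp add: B_def)
  qed
  then show ?thesis using f(1) by blast
qed

text \<open>The crossings form a bounded set of parameters of \<open>\<gamma>\<close>: high up in the cusp both geodesics are vertical,
  and \<open>\<gamma>\<close> is not over a vertical of \<open>\<beta>\<close>, since then its start on \<open>\<alpha>\<close> would lie on \<open>\<beta>\<close>. So there
  is a last crossing. The rest of \<open>\<gamma>\<close> and the two halves of \<open>\<beta>\<close> from there contradict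
  \<open>no_three_cusp_rays\<close>.\<close>

lemma gamma_beta_disjoint:
  assumes g: "hgeodesic {0..} g" "g ` {0..} \<subseteq> N" "inj_on (p \<circ> g) {0..}" "((p \<circ> g) \<longlongrightarrow> 0) at_top"
      "p (g 0) \<in> alpha_circle"
    and b: "hgeodesic UNIV b" "range b \<subseteq> N" "inj (p \<circ> b)" "((p \<circ> b) \<longlongrightarrow> 0) at_top" "((p \<circ> b) \<longlongrightarrow> 0) at_bot"
    and t: "t \<ge> 0"
  shows "p (g t) \<noteq> p (b u)"
proof
  assume eq: "p (g t) = p (b u)"
  have bcore: "p (b u) \<in> core cusp2" for u
    by (rule cusp_geodesic_in_core[OF b(1,2), of 1 u 0]) (use b in auto)
  have gcore: "p (g t) \<in> core cusp2" if "t > 0" for t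
    by (rule cusp_geodesic_in_core[OF g(1,2), of t t 0]) (use g that in auto)
  have g0: "p (g 0) \<noteq> p (b u)" for u using g(5) bcore[of u] alpha_core by auto
  define bp where "bp = (\<lambda>u t. b (u + t))"
  define bm where "bm = (\<lambda>u t. b (u - t))"
  define gs where "gs = (\<lambda>s t. g (s + t))"
  have shift_top: "LIM t at_top. u + t :> at_top" "LIM t at_top. u - t :> at_bot" for u :: real
  proof -
    have *: "LIM t at_top. v + t :> at_top" for v :: real
      by (rule filterlim_tendsto_add_at_top[OF tendsto_const filterlim_ident])
    show "LIM t at_top. u + t :> at_top" by (rule *)
    show "LIM t at_top. u - t :> at_bot" using *[of "-u"] by (simp add: filterlim_uminus_at_top)
  qed
  have bp: "cusp_ray (bp u)" for u
    unfolding cusp_ray_def bp_def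
  proof (intro conjI allI impI)
    show "hgeodesic {0..} (\<lambda>t. b (u + t))" by (rule hgeodesic_reparam[OF b(1)]) auto
    show "((p \<circ> (\<lambda>t. b (u + t))) \<longlongrightarrow> 0) at_top"
      using filterlim_compose[OF b(4) shift_top(1)] by (simp add: comp_def)
    show "inj_on (p \<circ> (\<lambda>t. b (u + t))) {0..}"
      by (rule inj_onI) (use injD[OF b(3)] in fastforce)
  qed (use b bcore in auto)
  have bm: "cusp_ray (bm u)" for u
    unfolding cusp_ray_def bm_def
  proof (intro conjI allI impI)
    show "hgeodesic {0..} (\<lambda>t. b (u - t))" by (rule hgeodesic_reparam[OF b(1)]) auto
    show "((p \<circ> (\<lambda>t. b (u - t))) \<longlongrightarrow> 0) at_top"
      using filterlim_compose[OF b(5) shift_top(2)] by (simp add: comp_def)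
    show "inj_on (p \<circ> (\<lambda>t. b (u - t))) {0..}"
      by (rule inj_onI) (use injD[OF b(3)] in fastforce)
  qed (use b bcore in auto)
  have gs: "cusp_ray (gs s)" if "s > 0" for s
    unfolding cusp_ray_def gs_def
  proof (intro conjI allI impI)
    show "hgeodesic {0..} (\<lambda>t. g (s + t))" by (rule hgeodesic_reparam[OF g(1)]) (use that in auto)
    show "((p \<circ> (\<lambda>t. g (s + t))) \<longlongrightarrow> 0) at_top"
      using filterlim_compose[OF g(4) shift_top(1)] by (simp add: comp_def)
    show "inj_on (p \<circ> (\<lambda>t. g (s + t))) {0..}"
    proof (rule inj_onI)
      fix t t' assume a: "t \<in> {0..}" "t' \<in> {0..}" "(p \<circ> (\<lambda>t. g (s + t))) t = (p \<circ> (\<lambda>t. g (s + t))) t'"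
      have "s + t = s + t'" by (rule inj_onD[OF g(3)]) (use a that in auto)
      then show "t = t'" by simp
    qed
  qed (use g gcore that in auto)
  \<comment> \<open>closedness of the set of crossings: with the puncture added, the projection of \<open>\<beta>\<close> is compact\<close>
  define K where "K = insert 0 (p ` range b)"
  have "K = path_image (ray_path (p \<circ> bp 0)) \<union> path_image (ray_path (p \<circ> bm 0))"
  proof -
    have "range b = bp 0 ` {0..} \<union> bm 0 ` {0..}"
    proof -
      have "b u \<in> bp 0 ` {0..} \<union> bm 0 ` {0..}" for u
        by (cases "u \<ge> 0") (auto simp: bp_def bm_def intro: image_eqI[of _ _ u] image_eqI[of _ _ "-u"])
      then show ?thesis by (auto simp: bp_def bm_def)
    qed
    then show ?thesis by (auto simp: K_def path_image_ray_path image_comp image_Un)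
  qed
  then have closedK: "closed K"
    using cusp_rayD[OF bp] cusp_rayD[OF bm] by (auto intro!: closed_Un closed_path_image path_ray_path)
  have gcont: "continuous_on {0..} (p \<circ> g)"
    using hgeodesic_continuous[OF g(1)] g(2) by (auto intro!: continuous_on_compose2[OF p_cont])
  define X where "X = {0..} \<inter> (p \<circ> g) -` K"
  have closedX: "closed X" unfolding X_def
    by (rule continuous_closed_preimage[OF gcont _ closedK]) simp
  have gnz: "p (g t) \<noteq> 0" if "t \<ge> 0" for t using g(2) that p_image by (force simp: pants_def)
  have tX: "t \<in> X" using t eq by (auto simp: X_def K_def)
  have XD: "\<exists>u. p (g s) = p (b u)" if "s \<in> X" for s using that gnz[of s] by (auto simp: X_def K_def)
  have bdd: "bdd_above X"
  proof -
    obtain g0 x0 k0 where v0: "deck N p g0" "k0 > 0" "\<And>t. t \<ge> 0 \<Longrightarrow> g t = g0 (h (Complex x0 (k0 * exp t)))"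
      by (rule cusp_ray_vertical[OF g(1,2,4)]) blast
    obtain g1 x1 k1 where v1: "deck N p g1" "k1 > 0" "\<And>t. t \<ge> 0 \<Longrightarrow> bp 0 t = g1 (h (Complex x1 (k1 * exp t)))"
      by (rule cusp_ray_vertical[OF cusp_rayD(1-3)[OF bp]]) blast
    obtain g2 x2 k2 where v2: "deck N p g2" "k2 > 0" "\<And>t. t \<ge> 0 \<Longrightarrow> bm 0 t = g2 (h (Complex x2 (k2 * exp t)))"
      by (rule cusp_ray_vertical[OF cusp_rayD(1-3)[OF bm]]) blast
    have no: "x0 - x' \<notin> \<int>"
      if c: "hgeodesic UNIV c" "range c \<subseteq> N" "\<And>t. p (c t) \<in> core cusp2"
      and v: "deck N p g'" "k' > 0" "\<And>t. t \<ge> 0 \<Longrightarrow> c t = g' (h (Complex x' (k' * exp t)))" for c g' k' x'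
    proof
      assume x: "x0 - x' \<in> \<int>"
      obtain f s where f: "deck N p f" "\<forall>t\<ge>0. g t = f (c (t + s))"
        using asymptotic_geodesics[OF g(1,2) c(1,2) v0 v x] by blast
      have "p (g 0) = p (c s)" using f(2)[rule_format, of 0] f(1) c(2) by (auto simp: deck_def)
      then show False using c(3)[of s] g(5) alpha_core by auto
    qed
    have n1: "x0 - x1 \<notin> \<int>"
      by (rule no[of "bp 0", OF _ _ _ v1]) (use b bcore in \<open>auto simp: bp_def\<close>)
    have "hgeodesic UNIV (\<lambda>t. b (0 - t))" by (rule hgeodesic_reparam[OF b(1)]) auto
    then have n2: "x0 - x2 \<notin> \<int>"
      by (intro no[of "bm 0", OF _ _ _ v2]) (use b bcore in \<open>auto simp: bm_def\<close>)
    obtain Ya where Ya: "Ya > y" "\<forall>z. Im z > Ya \<longrightarrow> (\<forall>t\<ge>0. p (h z) = p (bp 0 t) \<longrightarrow> Re z - x1 \<in> \<int>)"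
      using vertical_tail[OF cusp_rayD(6,7)[OF bp] v1] by blast
    obtain Yb where Yb: "Yb > y" "\<forall>z. Im z > Yb \<longrightarrow> (\<forall>t\<ge>0. p (h z) = p (bm 0 t) \<longrightarrow> Re z - x2 \<in> \<int>)"
      using vertical_tail[OF cusp_rayD(6,7)[OF bm] v2] by blast
    define T where "T = max 0 (max Ya Yb / k0)"
    have "s \<le> T" if s: "s \<in> X" for s
    proof (rule ccontr)
      assume "\<not> s \<le> T"
      then have "s \<ge> 0" "max Ya Yb / k0 < s" by (auto simp: T_def)
      then have "max Ya Yb / k0 < exp s" using exp_ge_add_one_self[of s] by linarith
      then have big: "k0 * exp s > Ya" "k0 * exp s > Yb" using v0(2) by (auto simp: field_simps max_def split: if_splits)
      let ?z = "Complex x0 (k0 * exp s)"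
      have pz: "p (g s) = p (h ?z)"
        using deck_ph[OF v0(1) v0(3)[OF \<open>s \<ge> 0\<close>]] big Ya by simp
      obtain u where u: "p (g s) = p (b u)" using XD[OF s] by blast
      show False
      proof (cases "u \<ge> 0")
        case True
        then show False using Ya(2)[rule_format, of ?z u] big pz u n1 by (simp add: bp_def)
      next
        case False
        then show False using Yb(2)[rule_format, of ?z "-u"] big pz u n2 by (simp add: bm_def)
      qed
    qed
    then show ?thesis by (auto simp: bdd_above_def)
  qed
  define t0 where "t0 = Sup X"
  have t0: "t0 \<in> X" unfolding t0_def using tX bdd closedX by (intro closed_contains_Sup) auto
  have last: "s \<le> t0" if "s \<in> X" for s unfolding t0_def by (rule cSup_upper[OF that bdd])
  obtain u0 where u0: "p (g t0) = p (b u0)" using XD[OF t0] by blast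
  have pos: "t0 > 0"
  proof (rule ccontr)
    assume "\<not> t0 > 0"
    then have "t0 = 0" using t0 by (auto simp: X_def)
    then show False using u0 g0 by auto
  qed
  have bi: "u = u'" if "p (b u) = p (b u')" for u u' using b(3) that by (auto simp: inj_def)
  have only: "s = 0" if "s \<ge> 0" "p (g (t0 + s)) = p (b u)" for s u
  proof -
    have "t0 + s \<in> X" using that pos by (auto simp: X_def K_def)
    then show ?thesis using last[of "t0 + s"] that(1) by simp
  qed
  show False
  proof (rule no_three_cusp_rays[OF gs[OF pos] bp[of u0] bm[of u0]])
    show "p (gs t0 0) = p (bp u0 0)" "p (bp u0 0) = p (bm u0 0)"
      using u0 by (simp_all add: gs_def bp_def bm_def)
    show "s = 0 \<and> t = 0" if "s \<ge> 0" "t \<ge> 0" "p (gs t0 s) = p (bp u0 t)" for s t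
    proof -
      have "s = 0" using only[of s "u0 + t"] that by (simp add: gs_def bp_def)
      then show ?thesis using that u0 bi[of u0 "u0 + t"] by (simp add: gs_def bp_def)
    qed
    show "s = 0 \<and> t = 0" if "s \<ge> 0" "t \<ge> 0" "p (gs t0 s) = p (bm u0 t)" for s t
    proof -
      have "s = 0" using only[of s "u0 - t"] that by (simp add: gs_def bm_def)
      then show ?thesis using that u0 bi[of u0 "u0 - t"] by (simp add: gs_def bm_def)
    qed
    show "s = 0 \<and> t = 0" if "s \<ge> 0" "t \<ge> 0" "p (bp u0 s) = p (bm u0 t)" for s t
      using that bi[of "u0 + s" "u0 - t"] by (simp add: bp_def bm_def)
  qed
qed

end

section \<open>Coordinates along \<open>\<alpha>\<close>\<close>

lemma iaxis_vector_derivative: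
  "(iaxis has_vector_derivative iaxis t) (at t within S)"
proof -
  have "((\<lambda>t. \<i> * of_real (exp t)) has_vector_derivative \<i> * of_real (exp t)) (at t within S)"
    by (auto intro!: derivative_eq_intros)
  moreover have "iaxis = (\<lambda>t. \<i> * of_real (exp t))"
    by (auto simp: iaxis_def complex_eq_iff)
  ultimately show ?thesis by metis
qed

lemma mob_field_derivative:
  assumes "a * d - b * c = 1" "z \<in> uhp"
  shows "(mob a b c d has_field_derivative 1 / (of_real c * z + of_real d)\<^sup>2) (at z within S)"
proof -
  have nz: "of_real c * z + of_real d \<noteq> 0" by (rule mob_denom_nonzero[OF assms])
  have "of_real a * of_real d - of_real b * of_real c = (1::complex)"
    using arg_cong[OF assms(1), of complex_of_real] by simp
  then have e: "of_real a * (of_real c * z + of_real d) - (of_real a * z + of_real b) * of_real c = 1"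
    by (simp add: algebra_simps)
  show ?thesis unfolding mob_def
    by (rule derivative_eq_intros refl nz)+ (use e nz in \<open>simp add: power2_eq_square\<close>)
qed

lemma mob_axis_vector_derivative:
  assumes "a * d - b * c = 1"
  shows "((\<lambda>t. mob a b c d (iaxis t)) has_vector_derivative
     iaxis t / (of_real c * iaxis t + of_real d)\<^sup>2) (at t within S)"
  using field_vector_diff_chain_within[OF iaxis_vector_derivative mob_field_derivative[OF assms, of "iaxis t"]]
  by (simp add: comp_def)

text \<open>The hypothesis \<open>perp\<close> says that the initial direction is horizontal: the derivative of the Moebius
  map at \<open>\<i>\<close> is \<open>1 / (c \<i> + d)\<^sup>2\<close>.\<close>

lemma perpendicular_ray:
  assumes det: "a * d - b * c = (1::real)" and start: "mob a b c d (iaxis 0) = iaxis s"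
    and perp: "Re ((of_real c * \<i> + of_real d)\<^sup>2) = 0"
  shows "cmod (mob a b c d (iaxis t)) = exp s"
    and "\<bar>Re (mob a b c d (iaxis t))\<bar> = exp s * tanh \<bar>t\<bar>"
proof -
  define z where "z = mob a b c d (iaxis t)"
  have zu: "Im z > 0" using mob_uhp[OF det, of "iaxis t"] by (simp add: z_def uhp_def)
  note c0 = mob_coordinates[OF det start[symmetric]]
  note ct = mob_coordinates[OF det z_def]
  have cd: "d\<^sup>2 = c\<^sup>2" using perp by (simp add: power2_eq_square)
  have cc: "2 * c\<^sup>2 = 1 / exp s" using c0(1) cd by simp
  have acbd: "b * d = - (a * c)" using c0(2) by simp
  have aabb: "a\<^sup>2 + b\<^sup>2 = exp s" using c0(3) by (simp add: power2_eq_square)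
  have c2: "c\<^sup>2 > 0" using cc by (metis exp_gt_zero zero_less_divide_1_iff zero_less_mult_pos zero_less_numeral)
  have "b\<^sup>2 * d\<^sup>2 = a\<^sup>2 * c\<^sup>2" using acbd by (metis power2_minus power_mult_distrib)
  then have ab: "b\<^sup>2 = a\<^sup>2" using cd c2 by simp
  have aa: "2 * a\<^sup>2 = exp s" using aabb ab by simp
  have im: "1 / Im z = c\<^sup>2 * (exp t + exp (-t))" using ct(1) cd by (simp add: algebra_simps)
  have no: "(cmod z)\<^sup>2 / Im z = a\<^sup>2 * (exp t + exp (-t))" using ct(3) ab by (simp add: algebra_simps)
  have re: "Re z / Im z = a * c * (exp t - exp (-t))" using ct(2) acbd by (simp add: algebra_simps)
  have a2: "a\<^sup>2 = c\<^sup>2 * (exp s)\<^sup>2"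
  proof -
    have "2 * c\<^sup>2 * exp s = 1" using cc by simp
    then have "2 * (c\<^sup>2 * (exp s)\<^sup>2) = exp s" by (simp add: power2_eq_square)
    then show ?thesis using aa by simp
  qed
  have "(cmod z)\<^sup>2 / Im z = (exp s)\<^sup>2 * (1 / Im z)" unfolding no im a2 by simp
  then have "(cmod z)\<^sup>2 = (exp s)\<^sup>2" using zu by (simp add: field_simps)
  then show "cmod z = exp s" by simp
  have "\<bar>a * c\<bar> = c\<^sup>2 * exp s"
  proof (rule power2_eq_imp_eq)
    show "\<bar>a * c\<bar>\<^sup>2 = (c\<^sup>2 * exp s)\<^sup>2" using a2 by (simp add: power_mult_distrib power2_eq_square)
  qed (use c2 in auto)
  moreover have "\<bar>exp t - exp (-t)\<bar> = exp \<bar>t\<bar> - exp (- \<bar>t\<bar>)" by (cases "t \<ge> 0") auto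
  ultimately have "\<bar>Re z / Im z\<bar> = c\<^sup>2 * exp s * (exp \<bar>t\<bar> - exp (- \<bar>t\<bar>))"
    unfolding re by (simp add: abs_mult)
  also have "\<dots> = exp s * tanh \<bar>t\<bar> * (c\<^sup>2 * (exp t + exp (-t)))"
  proof -
    have "exp t + exp (-t) = exp \<bar>t\<bar> + exp (- \<bar>t\<bar>)" by (cases "t \<ge> 0") auto
    moreover have "tanh \<bar>t\<bar> * (exp \<bar>t\<bar> + exp (- \<bar>t\<bar>)) = exp \<bar>t\<bar> - exp (- \<bar>t\<bar>)"
    proof -
      have "exp \<bar>t\<bar> + exp (- \<bar>t\<bar>) \<noteq> 0" using exp_gt_zero[of "\<bar>t\<bar>"] exp_gt_zero[of "- \<bar>t\<bar>"] by linarith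
      then show ?thesis by (simp add: tanh_altdef)
    qed
    ultimately show ?thesis by (simp add: mult_ac)
  qed
  also have "\<dots> = exp s * tanh \<bar>t\<bar> / Im z" unfolding im[symmetric] by simp
  finally show "\<bar>Re z\<bar> = exp s * tanh \<bar>t\<bar>" using zu by (simp add: abs_divide field_simps)
qed

text \<open>An isometry that translates the axis by \<open>c\<close> multiplies by \<open>exp c\<close>, up to reflection in the axis. Two of
  the distances give the claim.\<close>

lemma coordinates_from_axis_distances:
  assumes z: "z \<in> uhp" and w: "w \<in> uhp"
    and d: "\<And>t. hdist w (iaxis (t + c)) = hdist z (iaxis t)"
  shows "Im w = exp c * Im z" "cmod w = exp c * cmod z" "\<bar>Re w\<bar> = exp c * \<bar>Re z\<bar>"
proof -
  have pos: "Im z > 0" "Im w > 0" using z w by (auto simp: uhp_def)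
  have eq: "((cmod w)\<^sup>2 + (exp t)\<^sup>2 * (exp c)\<^sup>2) * Im z = Im w * exp c * ((cmod z)\<^sup>2 + (exp t)\<^sup>2)" for t
  proof -
    define r where "r = hdist z (iaxis t)"
    have r: "r \<ge> 0" using z by (simp add: r_def hdist_nonneg)
    have 1: "(cmod z)\<^sup>2 + (exp t)\<^sup>2 = 2 * Im z * exp t * cosh r"
      by (rule hdist_axis_eq[OF z]) (use r in \<open>simp add: r_def\<close>)
    have 2: "(cmod w)\<^sup>2 + (exp (t + c))\<^sup>2 = 2 * Im w * exp (t + c) * cosh r"
      by (rule hdist_axis_eq[OF w]) (use r d[of t] in \<open>simp add: r_def\<close>)
    have "((cmod w)\<^sup>2 + (exp (t + c))\<^sup>2) * Im z = Im w * exp c * ((cmod z)\<^sup>2 + (exp t)\<^sup>2)"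
      unfolding 1 2 by (simp add: exp_add)
    then show ?thesis by (simp add: exp_add power_mult_distrib)
  qed
  have "((cmod w)\<^sup>2 + 1 * (exp c)\<^sup>2) * Im z = Im w * exp c * ((cmod z)\<^sup>2 + 1)"
    "((cmod w)\<^sup>2 + 4 * (exp c)\<^sup>2) * Im z = Im w * exp c * ((cmod z)\<^sup>2 + 4)"
    using eq[of 0] eq[of "ln 2"] by simp_all
  then have "3 * ((exp c)\<^sup>2 * Im z) = 3 * (Im w * exp c)" by (simp add: algebra_simps)
  then show im: "Im w = exp c * Im z" by (simp add: power2_eq_square)
  have "((cmod w)\<^sup>2 + (exp c)\<^sup>2) * Im z = exp c * Im z * exp c * ((cmod z)\<^sup>2 + 1)"
    using eq[of 0] im by simp
  then have "(cmod w)\<^sup>2 + (exp c)\<^sup>2 = (exp c)\<^sup>2 * ((cmod z)\<^sup>2 + 1)" using pos by (simp add: power2_eq_square)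
  then have nn: "(cmod w)\<^sup>2 = (exp c * cmod z)\<^sup>2" by (simp add: power_mult_distrib algebra_simps)
  then show "cmod w = exp c * cmod z" by (simp add: power2_eq_imp_eq)
  have "(Re w)\<^sup>2 = (exp c * Re z)\<^sup>2"
    using nn im by (simp add: cmod_power2 power_mult_distrib algebra_simps)
  then have "\<bar>Re w\<bar> = \<bar>exp c * Re z\<bar>" by (metis real_sqrt_abs)
  then show "\<bar>Re w\<bar> = exp c * \<bar>Re z\<bar>" by (simp add: abs_mult)
qed

text \<open>Let \<open>t\<close> tend to infinity in both directions.\<close>

lemma exp_combination_nonneg:
  fixes P Q :: real
  assumes "\<And>t. 0 \<le> P * exp t + Q * exp (-t)"
  shows "0 \<le> P" "0 \<le> Q"
proof -
  have *: "0 \<le> P" if a: "\<And>t. 0 \<le> P * exp t + Q * exp (-t)" for P Q :: real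
  proof (rule ccontr)
    assume "\<not> 0 \<le> P"
    then have P: "P < 0" by simp
    define t where "t = max 0 (1 + \<bar>Q\<bar> / (- P))"
    have t: "t \<ge> 0" "t \<ge> 1 + \<bar>Q\<bar> / (- P)" by (auto simp: t_def)
    have "exp t > \<bar>Q\<bar> / (- P)" using t exp_ge_add_one_self[of t] by linarith
    then have "\<bar>Q\<bar> < - P * exp t" using P by (simp add: field_simps)
    moreover have "Q * exp (-t) \<le> \<bar>Q\<bar> * 1" using t by (intro mult_mono) auto
    ultimately show False using a[of t] by simp
  qed
  show "0 \<le> P" by (rule *[OF assms])
  show "0 \<le> Q" by (rule *[of Q P]) (use assms[of "- _"] in \<open>simp add: add.commute\<close>)
qed

lemma circle_dist_le: "l > 0 \<Longrightarrow> circle_dist l s s' \<le> \<bar>s - s' + of_int k * l\<bar>"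
  unfolding circle_dist_def by (rule cINF_lower) (auto intro: bdd_belowI[of _ 0])

lemma circle_dist_nonneg: "l > 0 \<Longrightarrow> circle_dist l s s' \<ge> 0"
  unfolding circle_dist_def by (rule cINF_greatest) auto

lemma circle_dist_ge_min:
  assumes l: "l > 0" and v: "0 \<le> v" "v \<le> l" "v = u - s - of_int k * l"
  shows "min v (l - v) \<le> circle_dist l u s"
  unfolding circle_dist_def
proof (rule cINF_greatest)
  fix j :: int
  define n where "n = k + j"
  have e: "u - s + of_int j * l = v + of_int n * l" using v by (simp add: n_def algebra_simps)
  show "min v (l - v) \<le> \<bar>u - s + of_int j * l\<bar>"
  proof (cases "n \<ge> 0")
    case True
    then have "of_int n * l \<ge> 0" using l by simp
    then show ?thesis unfolding e using v by linarith
  next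
    case False
    then have "of_int n \<le> (-1::real)" by linarith
    then have "of_int n * l \<le> (-1) * l" using l by (intro mult_right_mono) auto
    then show ?thesis unfolding e using v by linarith
  qed
qed simp

text \<open>One side of \<open>\<alpha>\<close>, with the Moebius map that carries the imaginary axis to the lift \<open>a\<close> of \<open>\<alpha>\<close>.\<close>

locale collar_chart = pants_cover +
  fixes a b :: "real \<Rightarrow> complex" and l s :: real and A B C D :: real
  assumes collar: "nonstandard_half_collar cusp2 N p a l s b"
    and det: "A * D - B * C = 1" and chart: "\<And>t. a t = mob A B C D (iaxis t)"
begin

text \<open>The inverse Moebius map, which straightens the lift of \<open>\<alpha>\<close> to the imaginary axis: \<open>ln (cmod (m z))\<close> is
  the position of \<open>z\<close> along \<open>a\<close>, and \<open>\<bar>Re (m z)\<bar> / cmod (m z)\<close> is the sine of its angle from \<open>a\<close>.\<close>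

definition m :: "complex \<Rightarrow> complex" where "m = mob D (-B) (-C) A"

lemma det': "D * A - (-B) * (-C) = 1" using det by (simp add: algebra_simps)

lemma m_uhp: "z \<in> uhp \<Longrightarrow> m z \<in> uhp" unfolding m_def by (rule mob_uhp[OF det'])

lemma hdist_m: "z \<in> uhp \<Longrightarrow> w \<in> uhp \<Longrightarrow> hdist (m z) (m w) = hdist z w"
  unfolding m_def by (rule hdist_mob[OF det'])

lemma m_inverse: "z \<in> uhp \<Longrightarrow> mob A B C D (m z) = z" unfolding m_def by (rule mob_inverse'[OF det])

lemma m_inj: "z \<in> uhp \<Longrightarrow> w \<in> uhp \<Longrightarrow> m z = m w \<Longrightarrow> z = w" by (metis m_inverse)

lemma m_axis: "m (a t) = iaxis t" unfolding m_def chart by (rule mob_inverse[OF det]) simp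

lemma alpha: "lifts_alpha N p a l" and gamma: "\<exists>g. gamma_ray N p a s g" and beta: "beta_geodesic cusp2 N p b"
  using collar unfolding nonstandard_half_collar_def by auto

lemma l_pos: "l > 0" using alpha unfolding lifts_alpha_def by blast

lemma a_geo: "hgeodesic UNIV a" and a_N: "a t \<in> N" and a_circle: "p ` range a = alpha_circle"
  and a_period: "p (a t) = p (a t') \<longleftrightarrow> (\<exists>k::int. t' - t = of_int k * l)"
  using alpha unfolding lifts_alpha_def by blast+

lemma b_facts: "hgeodesic UNIV b" "range b \<subseteq> N" "inj (p \<circ> b)" "((p \<circ> b) \<longlongrightarrow> 0) at_top" "((p \<circ> b) \<longlongrightarrow> 0) at_bot"
  using beta unfolding beta_geodesic_def by blast+

lemma b_core: "p (b u) \<in> core cusp2"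
  by (rule cusp_geodesic_in_core[OF b_facts(1,2), of 1 u 0]) (use b_facts in auto)

lemma a_boundary: "boundary_lift a"
  unfolding boundary_lift_def using a_geo a_N a_circle alpha_core by auto

lemma one_sided: "(\<forall>z\<in>N. Re (m z) \<ge> 0) \<or> (\<forall>z\<in>N. Re (m z) \<le> 0)"
  unfolding m_def by (rule boundary_lift_one_sided[OF a_boundary det chart])

text \<open>The covering isometry that moves \<open>a 0\<close> to the right place maps the lift to itself, since it touches it.
  A reversal of direction would give two points of the lift at distance \<open>l / 2\<close> the same projection.\<close>

lemma translation:
  obtains f where "deck N p f" "\<And>t. f (a t) = a (t + of_int k * l)"
proof -
  have "p (a 0) = p (a (of_int k * l))" using a_period by auto
  then obtain f where f: "deck N p f" "f (a 0) = a (of_int k * l)"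
    using deck_exists[OF a_N a_N] by blast
  have "range a \<subseteq> N" using a_N by blast
  note F = deck_hgeodesic[OF f(1) a_geo this]
  have sub: "(f \<circ> a) ` UNIV \<subseteq> range a"
    by (rule boundary_lift_touching[OF a_boundary F(1,2), of 1 0]) (use f in auto)
  define t where "t = l / 4"
  have "f (a t) \<in> range a" using sub by auto
  then obtain t' where t': "f (a t) = a t'" by blast
  have "hdist (f (a t)) (f (a 0)) = \<bar>t - 0\<bar>" using F(1) by (auto simp: hgeodesic_def)
  then have "\<bar>t' - of_int k * l\<bar> = t" using t' f(2) a_geo l_pos by (simp add: hgeodesic_def t_def)
  then have "t' = of_int k * l + t \<or> t' = of_int k * l - t" by linarith
  moreover have "t' \<noteq> of_int k * l - t"
  proof
    assume e: "t' = of_int k * l - t"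
    have "p (a t) = p (a t')" using F(3)[of t] t' by simp
    then obtain j :: int where "t' - t = of_int j * l" using a_period by blast
    then have "(2 * of_int (k - j) - 1) * l = (0::real)" using e by (simp add: t_def algebra_simps)
    then have "2 * of_int (k - j) = (1::real)" using l_pos by simp
    then have "2 * (k - j) = 1" by (metis of_int_eq_1_iff of_int_mult of_int_numeral)
    then show False by presburger
  qed
  ultimately have ft: "f (a t) = a (t + of_int k * l)" using t' by (simp add: add.commute)
  have G: "hgeodesic UNIV (\<lambda>t. a (t + of_int k * l))" by (rule hgeodesic_reparam[OF a_geo]) auto
  have "(f \<circ> a) r = a (r + of_int k * l)" for r
    by (rule hgeodesic_unique[OF F(1) G, of 0 t]) (use f ft l_pos in \<open>auto simp: t_def\<close>)
  then show ?thesis using that[OF f(1)] by simp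
qed

lemma translation_coordinates:
  assumes f: "deck N p f" "\<And>t. f (a t) = a (t + of_int k * l)" and z: "z \<in> N"
  shows "Im (m (f z)) = exp (of_int k * l) * Im (m z)" "cmod (m (f z)) = exp (of_int k * l) * cmod (m z)"
    "\<bar>Re (m (f z))\<bar> = exp (of_int k * l) * \<bar>Re (m z)\<bar>"
proof -
  have fz: "f z \<in> N" using f z by (auto simp: deck_def)
  have iso: "hisometry f" using f by (simp add: deck_def)
  have "hdist (m (f z)) (iaxis (t + of_int k * l)) = hdist (m z) (iaxis t)" for t
  proof -
    have "hdist (m (f z)) (iaxis (t + of_int k * l)) = hdist (f z) (f (a t))"
      unfolding m_axis[symmetric] f(2)[symmetric] using fz a_N N_uhp f by (intro hdist_m) (auto simp: deck_def)
    also have "\<dots> = hdist z (a t)"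
      using iso subsetD[OF N_uhp z] subsetD[OF N_uhp a_N[of t]] unfolding hisometry_def by blast
    also have "\<dots> = hdist (m z) (iaxis t)"
      unfolding m_axis[symmetric] using z a_N N_uhp by (intro hdist_m[symmetric]) auto
    finally show ?thesis .
  qed
  from coordinates_from_axis_distances[OF _ _ this]
  show "Im (m (f z)) = exp (of_int k * l) * Im (m z)" "cmod (m (f z)) = exp (of_int k * l) * cmod (m z)"
    "\<bar>Re (m (f z))\<bar> = exp (of_int k * l) * \<bar>Re (m z)\<bar>"
    using m_uhp fz z N_uhp by blast+
qed

text \<open>In the chart \<open>m\<close> a lift of \<open>\<gamma>\<close> is the ray perpendicular to the axis at height \<open>exp s\<close>; the orthogonality
  is inherited because \<open>m\<close> is conformal.\<close>

lemma gamma_coordinates: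
  assumes g: "gamma_ray N p a s g" and t: "t \<ge> 0"
  shows "cmod (m (g t)) = exp s" "\<bar>Re (m (g t))\<bar> = exp s * tanh t"
proof -
  have geo: "hgeodesic {0..} g" and perp: "meets_orthogonally {0..} g 0 UNIV a s"
    using g by (auto simp: gamma_ray_def)
  have mg: "hgeodesic {0..} (m \<circ> g)"
    unfolding m_def by (rule hisometry_hgeodesic[OF hisometry_mob[OF det'] geo])
  obtain \<alpha> \<beta> \<gamma> \<delta> where dt: "\<alpha> * \<delta> - \<beta> * \<gamma> = (1::real)"
    and nf: "\<And>t. t \<in> {0..} \<Longrightarrow> (m \<circ> g) t = mob \<alpha> \<beta> \<gamma> \<delta> (iaxis t)"
    by (rule hgeodesic_normal_form[OF mg]) blast
  have g0: "g 0 = a s" using perp by (simp add: meets_orthogonally_def)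
  have start: "mob \<alpha> \<beta> \<gamma> \<delta> (iaxis 0) = iaxis s" using nf[of 0] g0 m_axis by simp
  have gu: "g t \<in> uhp" if "t \<ge> 0" for t using geo that by (auto simp: hgeodesic_def)
  define a' b' c' d' where "a' = A * \<alpha> + B * \<gamma>" and "b' = A * \<beta> + B * \<delta>"
    and "c' = C * \<alpha> + D * \<gamma>" and "d' = C * \<beta> + D * \<delta>"
  have det2: "a' * d' - b' * c' = 1" unfolding a'_def b'_def c'_def d'_def by (rule mob_det_compose[OF det dt])
  have g_nf: "g t = mob a' b' c' d' (iaxis t)" if "t \<in> {0..}" for t
  proof -
    have "g t = mob A B C D (mob \<alpha> \<beta> \<gamma> \<delta> (iaxis t))"
      using nf[OF that] m_inverse[OF gu[of t]] that by simp
    also have "\<dots> = mob a' b' c' d' (iaxis t)"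
      unfolding a'_def b'_def c'_def d'_def by (rule mob_compose[OF dt]) simp
    finally show ?thesis .
  qed
  define X where "X = iaxis 0 / (of_real c' * iaxis 0 + of_real d')\<^sup>2"
  define Y where "Y = iaxis s / (of_real C * iaxis s + of_real D)\<^sup>2"
  have "(g has_vector_derivative X) (at 0 within {0..})"
    using mob_axis_vector_derivative[OF det2, of 0 "{0..}"] unfolding X_def
    by (rule has_vector_derivative_transform[rotated 2]) (use g_nf in auto)
  moreover have "at (0::real) within {0..} \<noteq> bot" by (simp add: at_within_Ici_at_right)
  ultimately have X: "vector_derivative g (at 0 within {0..}) = X"
    by (rule vector_derivative_within[rotated])
  have "(a has_vector_derivative Y) (at s)"
    using mob_axis_vector_derivative[OF det, of s UNIV] unfolding Y_def chart[abs_def] .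
  then have Y: "vector_derivative a (at s within UNIV) = Y" by (simp add: vector_derivative_at)
  have "X \<bullet> Y = 0" using perp X Y by (simp add: meets_orthogonally_def)
  define K where "K = of_real C * iaxis s + of_real D"
  define q where "q = of_real \<gamma> * \<i> + of_real \<delta>"
  have i0: "iaxis 0 = \<i>" by (simp add: complex_eq_iff)
  have "\<i> \<in> uhp" by (simp add: uhp_def)
  then have qnz: "q \<noteq> 0" using mob_denom_nonzero[OF dt, of "\<i>"] by (simp add: q_def)
  have Knz: "K \<noteq> 0" unfolding K_def by (rule mob_denom_nonzero[OF det]) simp
  have den: "of_real c' * iaxis 0 + of_real d' = K * q"
  proof -
    have "iaxis s * q = of_real \<alpha> * \<i> + of_real \<beta>"
      using start qnz by (simp add: mob_def i0 q_def field_simps)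
    moreover have "K * q = of_real C * (iaxis s * q) + of_real D * q"
      by (simp add: K_def algebra_simps)
    ultimately have "K * q = of_real C * (of_real \<alpha> * \<i> + of_real \<beta>) + of_real D * q" by simp
    then show ?thesis by (simp add: c'_def d'_def i0 q_def algebra_simps)
  qed
  have XY: "X \<bullet> Y = exp s / (cmod (K\<^sup>2))\<^sup>2 * Re (1 / q\<^sup>2)"
  proof -
    have "X = \<i> / q\<^sup>2 / K\<^sup>2" "Y = (\<i> * of_real (exp s)) / K\<^sup>2"
    proof -
      have isx: "iaxis s = \<i> * of_real (exp s)" by (simp add: complex_eq_iff)
      show "X = \<i> / q\<^sup>2 / K\<^sup>2" unfolding X_def den unfolding i0 by (simp add: power_mult_distrib mult.commute)
      show "Y = (\<i> * of_real (exp s)) / K\<^sup>2" unfolding Y_def K_def[symmetric] unfolding isx ..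
    qed
    then have "X * cnj Y = of_real (exp s) * (1 / q\<^sup>2) / (K\<^sup>2 * cnj (K\<^sup>2))"
      by simp
    also have "\<dots> = of_real (exp s / (cmod (K\<^sup>2))\<^sup>2) * (1 / q\<^sup>2)"
      by (simp only: complex_norm_square[symmetric]) simp
    finally have prod: "X * cnj Y = of_real (exp s / (cmod (K\<^sup>2))\<^sup>2) * (1 / q\<^sup>2)" .
    have "Re (of_real x * w) = x * Re w" for x w by simp
    then have "Re (X * cnj Y) = exp s / (cmod (K\<^sup>2))\<^sup>2 * Re (1 / q\<^sup>2)" unfolding prod .
    then show ?thesis by (simp add: inner_complex_def)
  qed
  have "Re (1 / q\<^sup>2) = 0" using XY \<open>X \<bullet> Y = 0\<close> Knz by simp
  then have q2: "Re (q\<^sup>2) = 0" using qnz unfolding Re_divide by auto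
  have "m (g t) = mob \<alpha> \<beta> \<gamma> \<delta> (iaxis t)" using nf[of t] t by simp
  then show "cmod (m (g t)) = exp s" "\<bar>Re (m (g t))\<bar> = exp s * tanh t"
    using perpendicular_ray[OF dt start q2[unfolded q_def], of t] t by simp_all
qed

lemma gamma_facts:
  assumes "gamma_ray N p a s g"
  shows "hgeodesic {0..} g" "g ` {0..} \<subseteq> N" "inj_on (p \<circ> g) {0..}" "((p \<circ> g) \<longlongrightarrow> 0) at_top"
      "p (g 0) \<in> alpha_circle"
  using assms a_circle unfolding gamma_ray_def meets_orthogonally_def by auto

text \<open>\<open>N\<close> lies on one side of the axis, so the part of a circle \<open>cmod (m z) = exp (s + k l)\<close> inside \<open>N\<close> is
  covered by one translate of the ray \<open>\<gamma>\<close>, which fills a whole quarter circle.\<close>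

lemma on_gamma_lift:
  assumes g: "gamma_ray N p a s g" and z: "z \<in> N" "cmod (m z) = exp (s + of_int k * l)"
  obtains t where "t \<ge> 0" "p z = p (g t)"
proof -
  obtain f where f: "deck N p f" "\<And>t. f (a t) = a (t + of_int k * l)"
    by (rule translation) blast
  have mzu: "m z \<in> uhp" using z N_uhp m_uhp by blast
  then have im: "Im (m z) > 0" by (simp add: uhp_def)
  define x where "x = \<bar>Re (m z)\<bar> / cmod (m z)"
  have "\<bar>Re (m z)\<bar> < cmod (m z)"
    using im by (simp add: cmod_def real_less_rsqrt)
  then have x: "0 \<le> x" "x < 1" using im by (auto simp: x_def divide_less_eq)
  define t where "t = - ln ((1 - x) / (1 + x)) / 2"
  have "exp (- (2 * t)) = (1 - x) / (1 + x)" using x by (simp add: t_def)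
  then have "tanh t = (1 - (1 - x) / (1 + x)) / (1 + (1 - x) / (1 + x))"
    by (simp add: tanh_real_altdef)
  also have "\<dots> = x" using x by (simp add: field_simps)
  finally have "tanh t = x" .
  moreover have "t \<ge> 0" using x by (simp add: t_def)
  ultimately have t: "t \<ge> 0" "tanh t = x" by auto
  define w where "w = f (g t)"
  have gN: "g t \<in> N" using gamma_facts(2)[OF g] t by auto
  have wN: "w \<in> N" using f gN by (auto simp: w_def deck_def)
  note wc = translation_coordinates[OF f gN, folded w_def]
  note gc = gamma_coordinates[OF g t(1)]
  have nw: "cmod (m w) = cmod (m z)" unfolding wc(2) gc z(2) by (simp add: exp_add)
  have rw: "\<bar>Re (m w)\<bar> = \<bar>Re (m z)\<bar>"
  proof -
    have "\<bar>Re (m w)\<bar> = exp (s + of_int k * l) * x" unfolding wc(3) gc t(2) by (simp add: exp_add)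
    also have "\<dots> = \<bar>Re (m z)\<bar>" unfolding x_def z(2)[symmetric] using im by (auto simp: complex_eq_iff)
    finally show ?thesis .
  qed
  have re: "Re (m w) = Re (m z)" using one_sided z wN rw by force
  have "(Im (m w))\<^sup>2 = (Im (m z))\<^sup>2" using nw re by (simp add: cmod_def)
  moreover have "Im (m w) > 0" using wN N_uhp m_uhp by (auto simp: uhp_def)
  ultimately have "Im (m w) = Im (m z)" using im by (simp add: power2_eq_iff_nonneg)
  then have "m w = m z" using re by (simp add: complex_eq_iff)
  then have "w = z" using m_inj wN z N_uhp by blast
  then have "p z = p (g t)" using f gN by (auto simp: w_def deck_def)
  then show ?thesis using that t by blast
qed

text \<open>A lift of \<open>\<beta>\<close> misses all quarter circles over \<open>\<gamma>\<close>, so it stays between two neighbouring ones, of radii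
  \<open>A1\<close> and \<open>A2\<close>. For a complete geodesic this is a condition on its two end points \<open>x\<close>, \<open>y\<close> on the real line,
  \<open>A1 \<le> \<bar>x\<bar>, \<bar>y\<bar> \<le> A2\<close>, and it forces the geodesic to stay on the far side of the half circle with end
  points \<open>A1\<close> and \<open>A2\<close>. The latter has the equation \<open>\<bar>Re z\<bar> (A1 + A2) = \<bar>z\<bar>\<^sup>2 + A1 A2\<close>, which gives the bound.\<close>

lemma beta_far:
  assumes z: "z \<in> N" and pz: "p z \<in> p ` range b"
  shows "\<bar>Re (m z)\<bar> \<ge> exp (- circle_dist l (ln (cmod (m z))) s) / 2 * cmod (m z)"
proof -
  obtain g where g: "gamma_ray N p a s g" using gamma by blast
  obtain u0 where u0: "p (b u0) = p z" using pz by auto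
  have bN: "b u \<in> N" for u using b_facts(2) by auto
  obtain f where f: "deck N p f" "f (b u0) = z" using deck_exists[OF bN z u0] by blast
  note F = deck_hgeodesic[OF f(1) b_facts(1,2)]
  define c where "c = m \<circ> (f \<circ> b)"
  have cgeo: "hgeodesic UNIV c"
    unfolding c_def m_def by (rule hisometry_hgeodesic[OF hisometry_mob[OF det'] F(1)])
  have fbN: "f (b u) \<in> N" for u using F(2) by auto
  have pfb: "p (f (b u)) = p (b u)" for u using F(3)[of u] by simp
  have cu: "Im (c u) > 0" for u using cgeo by (auto simp: hgeodesic_def uhp_def)
  have cpos: "cmod (c u) > 0" for u using cu[of u] by (auto simp: complex_eq_iff)
  obtain h y where "cusp_chart cusp2 N p h y" using cusp_chart_exists by blast
  then interpret cc: cusp_chart cusp2 N p h y .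
  have avoid: "cmod (c u) \<noteq> exp (s + of_int k * l)" for u k
  proof
    assume "cmod (c u) = exp (s + of_int k * l)"
    then obtain t where t: "t \<ge> 0" "p (f (b u)) = p (g t)"
      using on_gamma_lift[OF g fbN, of u k] by (auto simp: c_def)
    then show False
      using cc.gamma_beta_disjoint[OF gamma_facts[OF g] b_facts t(1), of u] pfb[of u] by simp
  qed
  define k where "k = \<lfloor>(ln (cmod (c u0)) - s) / l\<rfloor>"
  define A1 where "A1 = exp (s + of_int k * l)"
  define A2 where "A2 = exp (s + of_int (k + 1) * l)"
  have A: "A1 > 0" "A2 > 0" "A2 = A1 * exp l"
    by (auto simp: A1_def A2_def algebra_simps exp_add)
  have bnd0: "A1 \<le> cmod (c u0)" "cmod (c u0) < A2"
  proof -
    have "of_int k \<le> (ln (cmod (c u0)) - s) / l" "(ln (cmod (c u0)) - s) / l < of_int (k + 1)"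
      unfolding k_def by linarith+
    then have "s + of_int k * l \<le> ln (cmod (c u0))" "ln (cmod (c u0)) < s + of_int (k + 1) * l"
      using l_pos by (simp_all add: field_simps)
    then show "A1 \<le> cmod (c u0)" "cmod (c u0) < A2" unfolding A1_def A2_def
      using cpos[of u0] by (metis exp_le_cancel_iff exp_ln, metis exp_less_cancel_iff exp_ln)
  qed
  have ccont: "continuous_on UNIV (\<lambda>u. cmod (c u))" by (intro continuous_intros hgeodesic_continuous[OF cgeo])
  have conn: "connected ((\<lambda>u. cmod (c u)) ` UNIV)" by (intro connected_continuous_image ccont) simp
  have bnd: "A1 \<le> cmod (c u) \<and> cmod (c u) \<le> A2" for u
  proof (rule ccontr)
    assume no: "\<not> ?thesis"
    have iv: "x \<in> range (\<lambda>u. cmod (c u))"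
      if "x \<in> closed_segment (cmod (c u)) (cmod (c u0))" for x
      using conn that by (metis (no_types, lifting) closed_segment_subset convex_connected is_interval_connected_1 is_interval_convex rangeI subsetD)
    have "A1 \<in> closed_segment (cmod (c u)) (cmod (c u0)) \<or> A2 \<in> closed_segment (cmod (c u)) (cmod (c u0))"
      using no bnd0 by (auto simp: closed_segment_eq_real_ivl)
    then obtain u' where "cmod (c u') = A1 \<or> cmod (c u') = A2" using iv by (metis imageE)
    then show False using avoid unfolding A1_def A2_def by blast
  qed
  obtain \<alpha> \<beta> \<gamma> \<delta> where dt: "\<alpha> * \<delta> - \<beta> * \<gamma> = (1::real)"
    and nf: "\<And>t. t \<in> UNIV \<Longrightarrow> c t = mob \<alpha> \<beta> \<gamma> \<delta> (iaxis t)"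
    by (rule hgeodesic_normal_form[OF cgeo]) blast
  note co = mob_coordinates[OF dt nf[OF UNIV_I]]
  have lo: "0 \<le> (\<alpha>\<^sup>2 - A1\<^sup>2 * \<gamma>\<^sup>2) * exp t + (\<beta>\<^sup>2 - A1\<^sup>2 * \<delta>\<^sup>2) * exp (-t)" for t
  proof -
    have "A1\<^sup>2 / Im (c t) \<le> (cmod (c t))\<^sup>2 / Im (c t)"
      using bnd[of t] A cu[of t] by (intro divide_right_mono power_mono) auto
    then have "A1\<^sup>2 * (1 / Im (c t)) \<le> (cmod (c t))\<^sup>2 / Im (c t)" by simp
    then show ?thesis unfolding co by (simp add: algebra_simps)
  qed
  have hi: "0 \<le> (A2\<^sup>2 * \<gamma>\<^sup>2 - \<alpha>\<^sup>2) * exp t + (A2\<^sup>2 * \<delta>\<^sup>2 - \<beta>\<^sup>2) * exp (-t)" for t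
  proof -
    have "(cmod (c t))\<^sup>2 / Im (c t) \<le> A2\<^sup>2 / Im (c t)"
      using bnd[of t] A cu[of t] by (intro divide_right_mono power_mono) auto
    then have "(cmod (c t))\<^sup>2 / Im (c t) \<le> A2\<^sup>2 * (1 / Im (c t))" by simp
    then show ?thesis unfolding co by (simp add: algebra_simps)
  qed
  \<comment> \<open>homogeneous coordinates of an end point \<open>x / y\<close> with \<open>A1 \<le> \<bar>x / y\<bar> \<le> A2\<close>\<close>
  have key: "\<bar>x * y\<bar> * (A1 + A2) \<ge> x\<^sup>2 + A1 * A2 * y\<^sup>2"
    if "0 \<le> x\<^sup>2 - A1\<^sup>2 * y\<^sup>2" "0 \<le> A2\<^sup>2 * y\<^sup>2 - x\<^sup>2" for x y :: real
  proof -
    have "(A1 * \<bar>y\<bar>)\<^sup>2 \<le> \<bar>x\<bar>\<^sup>2" "\<bar>x\<bar>\<^sup>2 \<le> (A2 * \<bar>y\<bar>)\<^sup>2" using that by (simp_all add: power_mult_distrib)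
    then have "A1 * \<bar>y\<bar> \<le> \<bar>x\<bar>" "\<bar>x\<bar> \<le> A2 * \<bar>y\<bar>" using A by (auto intro: power2_le_imp_le)
    then have "0 \<le> (\<bar>x\<bar> - A1 * \<bar>y\<bar>) * (A2 * \<bar>y\<bar> - \<bar>x\<bar>)" by simp
    then have "0 \<le> \<bar>x\<bar> * \<bar>y\<bar> * (A1 + A2) - (\<bar>x\<bar> * \<bar>x\<bar> + A1 * A2 * (\<bar>y\<bar> * \<bar>y\<bar>))" by (simp add: algebra_simps)
    then show ?thesis by (simp add: abs_mult power2_eq_square)
  qed
  have k1: "\<bar>\<alpha> * \<gamma>\<bar> * (A1 + A2) \<ge> \<alpha>\<^sup>2 + A1 * A2 * \<gamma>\<^sup>2"
    by (rule key) (use exp_combination_nonneg[OF lo] exp_combination_nonneg[OF hi] in auto)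
  have k2: "\<bar>\<beta> * \<delta>\<bar> * (A1 + A2) \<ge> \<beta>\<^sup>2 + A1 * A2 * \<delta>\<^sup>2"
    by (rule key) (use exp_combination_nonneg[OF lo] exp_combination_nonneg[OF hi] in auto)
  \<comment> \<open>both end points have the same sign, as \<open>N\<close> lies on one side of the axis\<close>
  have same: "\<bar>\<alpha> * \<gamma> * exp t + \<beta> * \<delta> * exp (-t)\<bar> = \<bar>\<alpha> * \<gamma>\<bar> * exp t + \<bar>\<beta> * \<delta>\<bar> * exp (-t)" for t
    using one_sided
  proof
    assume "\<forall>z\<in>N. Re (m z) \<ge> 0"
    then have "0 \<le> Re (c t) / Im (c t)" for t using fbN cu[of t] by (simp add: c_def)
    then have "0 \<le> \<alpha> * \<gamma> * exp t + \<beta> * \<delta> * exp (-t)" for t unfolding co .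
    from exp_combination_nonneg[OF this] show ?thesis by simp
  next
    assume "\<forall>z\<in>N. Re (m z) \<le> 0"
    then have "Re (c t) / Im (c t) \<le> 0" for t using fbN cu[of t] by (simp add: c_def divide_nonpos_pos)
    then have "\<alpha> * \<gamma> * exp t + \<beta> * \<delta> * exp (-t) \<le> 0" for t unfolding co .
    then have neg: "0 \<le> (- (\<alpha> * \<gamma>)) * exp t + (- (\<beta> * \<delta>)) * exp (-t)" for t
    proof -
      have "\<alpha> * \<gamma> * exp t + \<beta> * \<delta> * exp (-t) \<le> 0" by fact
      then show ?thesis by (simp add: algebra_simps)
    qed
    from exp_combination_nonneg[OF neg] have le: "\<alpha> * \<gamma> \<le> 0" "\<beta> * \<delta> \<le> 0" by simp_all
    then have "\<alpha> * \<gamma> * exp t \<le> 0" "\<beta> * \<delta> * exp (-t) \<le> 0" by (simp_all add: mult_nonpos_nonneg)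
    then show ?thesis using le by simp
  qed
  define t where "t = u0"
  have ct: "c t = m z" by (simp add: c_def t_def f)
  define r where "r = cmod (c t)"
  have r: "r > 0" "A1 \<le> r" "r \<le> A2" using cpos bnd by (auto simp: r_def)
  have main: "\<bar>Re (c t)\<bar> * (A1 + A2) \<ge> r\<^sup>2 + A1 * A2"
  proof -
    have "\<bar>Re (c t) / Im (c t)\<bar> * (A1 + A2) \<ge> (cmod (c t))\<^sup>2 / Im (c t) + A1 * A2 * (1 / Im (c t))"
      unfolding co same
    proof -
      have "(\<bar>\<alpha> * \<gamma>\<bar> * (A1 + A2) - (\<alpha>\<^sup>2 + A1 * A2 * \<gamma>\<^sup>2)) * exp t \<ge> 0"
        "(\<bar>\<beta> * \<delta>\<bar> * (A1 + A2) - (\<beta>\<^sup>2 + A1 * A2 * \<delta>\<^sup>2)) * exp (-t) \<ge> 0"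
        using k1 k2 by simp_all
      then show "(\<bar>\<alpha> * \<gamma>\<bar> * exp t + \<bar>\<beta> * \<delta>\<bar> * exp (- t)) * (A1 + A2)
        \<ge> \<alpha>\<^sup>2 * exp t + \<beta>\<^sup>2 * exp (- t) + A1 * A2 * (\<gamma>\<^sup>2 * exp t + \<delta>\<^sup>2 * exp (- t))"
        by (simp add: algebra_simps)
    qed
    then have "(\<bar>Re (c t)\<bar> * (A1 + A2)) / Im (c t) \<ge> (r\<^sup>2 + A1 * A2) / Im (c t)"
      using cu[of t] by (simp add: abs_divide r_def add_divide_distrib)
    then show ?thesis using cu[of t] by (simp add: divide_le_cancel)
  qed
  define v where "v = ln r - s - of_int k * l"
  have rv: "r = A1 * exp v" using r by (simp add: v_def A1_def exp_diff exp_add)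
  have v: "0 \<le> v" "v \<le> l"
    using r A unfolding rv by simp_all
  \<comment> \<open>\<open>v\<close> is the position relative to the foot below, so the half circle is at height of order \<open>exp (- min v (l - v))\<close>\<close>
  have cd: "min v (l - v) \<le> circle_dist l (ln r) s"
    by (rule circle_dist_ge_min[OF l_pos v, where k = k]) (simp add: v_def)
  have "exp (- circle_dist l (ln r) s) * (1 + exp l) \<le> exp (- min v (l - v)) * (2 * exp l)"
    using cd l_pos by (intro mult_mono) auto
  also have "\<dots> = 2 * exp (max v (l - v))"
  proof (cases "v \<le> l - v")
    case True
    then have "exp (- min v (l - v)) * exp l = exp (max v (l - v))" by (simp flip: exp_add)
    then show ?thesis by simp
  next
    case False
    then have "exp (- min v (l - v)) * exp l = exp (max v (l - v))" by (simp flip: exp_add)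
    then show ?thesis by simp
  qed
  also have "\<dots> \<le> 2 * (exp v + exp (l - v))" by (auto simp: max_def)
  finally have e1: "exp (- circle_dist l (ln r) s) / 2 * (1 + exp l) \<le> exp v + exp (l - v)" by simp
  have "exp (- circle_dist l (ln r) s) / 2 * r * (A1 + A2)
      = (exp (- circle_dist l (ln r) s) / 2 * (1 + exp l)) * (A1\<^sup>2 * exp v)"
    unfolding rv A(3) by (simp add: power2_eq_square algebra_simps)
  also have "\<dots> \<le> (exp v + exp (l - v)) * (A1\<^sup>2 * exp v)" using e1 by (intro mult_right_mono) auto
  also have "\<dots> = r\<^sup>2 + A1 * A2"
    unfolding rv A(3) by (simp add: power2_eq_square algebra_simps exp_diff)
  also have "\<dots> \<le> \<bar>Re (c t)\<bar> * (A1 + A2)" by (rule main)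
  finally have "exp (- circle_dist l (ln r) s) / 2 * r \<le> \<bar>Re (c t)\<bar>" using A by simp
  then show ?thesis by (simp add: r_def ct)
qed

text \<open>The chart that straightens geodesics identifies \<open>N\<close> with a convex set. Local connectedness makes the
  components that define the half-collar relatively open.\<close>

lemma N_locally_connected: "locally connected N"
proof -
  define \<kappa> where "\<kappa> = (\<lambda>z. Complex (Re z) ((cmod z)\<^sup>2))"
  define \<kappa>' where "\<kappa>' = (\<lambda>w. Complex (Re w) (sqrt (Im w - (Re w)\<^sup>2)))"
  have inv: "\<kappa>' (\<kappa> z) = z" if "z \<in> N" for z
  proof -
    have "Im z > 0" using that N_uhp by (auto simp: uhp_def)
    then show ?thesis by (simp add: \<kappa>_def \<kappa>'_def cmod_power2 complex_eq_iff)
  qed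
  have "convex (\<kappa> ` N)"
    unfolding convex_alt
  proof (intro ballI allI impI)
    fix x y :: complex and k :: real
    assume xy: "x \<in> \<kappa> ` N" "y \<in> \<kappa> ` N" and k: "0 \<le> k \<and> k \<le> 1"
    then obtain z w where z: "z \<in> N" "x = \<kappa> z" and w: "w \<in> N" "y = \<kappa> w" by blast
    have im: "Im z > 0" "Im w > 0" using z w N_uhp by (auto simp: uhp_def)
    define X where "X = (1 - k) * Re z + k * Re w"
    define Q where "Q = (1 - k) * (cmod z)\<^sup>2 + k * (cmod w)\<^sup>2"
    have "Q - X\<^sup>2 = (1 - k) * (Im z)\<^sup>2 + k * (Im w)\<^sup>2 + k * (1 - k) * (Re z - Re w)\<^sup>2"
      unfolding Q_def X_def cmod_power2 by (simp add: power2_eq_square algebra_simps)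
    moreover have "(1 - k) * (Im z)\<^sup>2 + k * (Im w)\<^sup>2 > 0"
    proof (cases "k = 0")
      case False
      then show ?thesis using k im by (intro add_nonneg_pos) auto
    qed (use im in simp)
    moreover have "k * (1 - k) * (Re z - Re w)\<^sup>2 \<ge> 0" using k by simp
    ultimately have pos: "Q - X\<^sup>2 > 0" by linarith
    define v where "v = Complex X (sqrt (Q - X\<^sup>2))"
    have vv: "Re v = X" "(cmod v)\<^sup>2 = Q" using pos by (simp_all add: v_def cmod_power2)
    have "v \<in> uhp" using pos by (simp add: v_def uhp_def)
    then have "v \<in> N"
      by (rule hconvex_chart[OF N_hconvex N_uhp z(1) w(1)]) (use k vv in \<open>auto simp: X_def Q_def\<close>)
    moreover have "(1 - k) *\<^sub>R x + k *\<^sub>R y = \<kappa> v"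
      by (simp add: z w \<kappa>_def vv complex_eq_iff) (simp add: X_def Q_def)
    ultimately show "(1 - k) *\<^sub>R x + k *\<^sub>R y \<in> \<kappa> ` N" by blast
  qed
  then have lc: "locally connected (\<kappa> ` N)" by (rule convex_imp_locally_connected)
  have "homeomorphism N (\<kappa> ` N) \<kappa> \<kappa>'"
    unfolding homeomorphism_def
  proof (intro conjI ballI)
    show "continuous_on N \<kappa>" unfolding \<kappa>_def Complex_eq by (intro continuous_intros)
    show "continuous_on (\<kappa> ` N) \<kappa>'" unfolding \<kappa>'_def Complex_eq by (intro continuous_intros)
    show "\<kappa>' ` \<kappa> ` N = N" using inv by (auto simp: image_image)
    show "\<kappa> (\<kappa>' y) = y" if "y \<in> \<kappa> ` N" for y using inv that by auto
  qed (use inv in auto)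
  then have "N homeomorphic (\<kappa> ` N)" unfolding homeomorphic_def by blast
  then show ?thesis
    using lc homeomorphic_locally[of N "\<kappa> ` N" connected connected] homeomorphic_connectedness by blast
qed

definition R :: "complex set" where "R = half_collar_cover cusp2 N p a b"

text \<open>With the puncture added it is the union of two paths.\<close>

lemma beta_closed: "closed (insert 0 (p ` range b))"
proof -
  have cb: "continuous_on UNIV (p \<circ> b)"
    using hgeodesic_continuous[OF b_facts(1)] b_facts(2) by (auto intro!: continuous_on_compose2[OF p_cont])
  have "insert 0 (p ` range b) = path_image (ray_path (\<lambda>t. p (b t))) \<union> path_image (ray_path (\<lambda>t. p (b (- t))))"
  proof -
    have "x \<in> (\<lambda>t. p (b t)) ` {0..} \<union> (\<lambda>t. p (b (- t))) ` {0..}" if "x = p (b t)" for x t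
      by (cases "t \<ge> 0") (use that in \<open>auto intro: image_eqI[of _ _ t] image_eqI[of _ _ "-t"]\<close>)
    then show ?thesis by (auto simp: path_image_ray_path)
  qed
  moreover have "path (ray_path (\<lambda>t. p (b t)))"
    using b_facts(4) by (intro path_ray_path continuous_on_subset[OF cb[unfolded comp_def]]) (auto simp: comp_def)
  moreover have "path (ray_path (\<lambda>t. p (b (- t))))"
  proof (rule path_ray_path)
    show "continuous_on {0..} (\<lambda>t. p (b (- t)))"
      by (rule continuous_on_compose2[OF cb[unfolded comp_def]]) (auto intro: continuous_intros)
    show "((\<lambda>t. p (b (- t))) \<longlongrightarrow> 0) at_top"
      using filterlim_compose[OF b_facts(5) filterlim_uminus_at_bot_at_top] by (simp add: comp_def)
  qed
  ultimately show ?thesis by (metis closed_Un closed_path_image)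
qed

lemma pants_minus_beta: "openin (top_of_set (pants cusp2)) (pants cusp2 - p ` range b)"
proof -
  have "pants cusp2 - p ` range b = pants cusp2 \<inter> - insert 0 (p ` range b)" by (auto simp: pants_def)
  then show ?thesis using beta_closed by (metis open_Compl openin_open_Int)
qed

lemma R_open: "openin (top_of_set N) R"
proof -
  have lcp: "locally connected (pants cusp2)"
    by (rule covering_space_locally_connected[OF N_locally_connected cov])
  have "locally connected (pants cusp2 - p ` range b)"
    by (rule locally_open_subset[OF lcp pants_minus_beta])
  then have "openin (top_of_set (pants cusp2 - p ` range b)) (half_collar cusp2 p b)"
    unfolding half_collar_def by (rule openin_connected_component_locally_connected)
  then have hc: "openin (top_of_set (pants cusp2)) (half_collar cusp2 p b)"
    using pants_minus_beta by (rule openin_trans)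
  have pre: "openin (top_of_set N) (N \<inter> p -` half_collar cusp2 p b)"
    by (rule continuous_openin_preimage[OF p_cont _ hc]) (use p_image in auto)
  have "locally connected (N \<inter> p -` half_collar cusp2 p b)"
    by (rule locally_open_subset[OF N_locally_connected pre])
  then have "openin (top_of_set (N \<inter> p -` half_collar cusp2 p b)) R"
    unfolding R_def half_collar_cover_def by (rule openin_connected_component_locally_connected)
  then show ?thesis using pre by (rule openin_trans)
qed

lemma R_subset: "R \<subseteq> N"
  using R_open by (rule openin_imp_subset)

lemma a_in_collar: "range a \<subseteq> N \<inter> p -` half_collar cusp2 p b"
proof -
  have "p ` range a \<subseteq> p ` N" using a_N by blast
  then have "alpha_circle \<subseteq> pants cusp2 - p ` range b"
    using a_circle p_image b_core alpha_core by auto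
  moreover have "connected (alpha_circle :: complex set)" by (rule connected_sphere) simp
  ultimately have "alpha_circle \<subseteq> half_collar cusp2 p b"
    unfolding half_collar_def by (intro connected_component_maximal) auto
  then show ?thesis using a_N a_circle by blast
qed

lemma a_in_R: "a t \<in> R"
proof -
  have "connected (range a)" by (intro connected_continuous_image hgeodesic_continuous[OF a_geo]) simp
  then have "range a \<subseteq> R"
    unfolding R_def half_collar_cover_def using a_in_collar by (intro connected_component_maximal) auto
  then show ?thesis by blast
qed

text \<open>A translation along \<open>a\<close> permutes the components over the half-collar and keeps the one that
  contains \<open>a\<close>.\<close>

lemma translation_R:
  assumes f: "deck N p f" "\<And>t. f (a t) = a (t + of_int k * l)" and z: "z \<in> R"
  shows "f z \<in> R"
proof -
  have "continuous_on uhp f" using f(1) hisometry_continuous by (auto simp: deck_def)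
  then have "continuous_on R f" by (rule continuous_on_subset) (use R_subset N_uhp in auto)
  then have con: "connected (f ` R)"
    by (intro connected_continuous_image) (auto simp: R_def half_collar_cover_def)
  have sub: "f ` R \<subseteq> N \<inter> p -` half_collar cusp2 p b"
  proof
    fix w assume "w \<in> f ` R"
    then obtain x where x: "x \<in> R" "w = f x" by blast
    then have "x \<in> N \<inter> p -` half_collar cusp2 p b"
      unfolding R_def half_collar_cover_def using connected_component_subset by blast
    then show "w \<in> N \<inter> p -` half_collar cusp2 p b" using x f(1) by (auto simp: deck_def)
  qed
  have "a (of_int k * l) \<in> f ` R" using a_in_R[of 0] f(2)[of 0] by (metis add_0 imageI)
  then have "f ` R \<subseteq> connected_component_set (N \<inter> p -` half_collar cusp2 p b) (a (of_int k * l))"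
    by (rule connected_component_maximal[OF _ con sub])
  also have "\<dots> = R"
    using a_in_R[of "of_int k * l"] unfolding R_def half_collar_cover_def
    by (simp add: connected_component_eq)
  finally show ?thesis using z by blast
qed

end

section \<open>A measurable choice of points in the fibres\<close>

lemma core_dense:
  assumes x: "x \<in> pants cusp2" and e: "e > 0"
  shows "\<exists>y\<in>core cusp2. dist y x < e"
  using x
proof (cases rule: pants_cases)
  case 1
  then show ?thesis using e by (intro bexI[of _ x]) auto
next
  case 2
  define t where "t = min (e / 2) (1 / 8)"
  have t: "0 < t" "t < e" "t \<le> 1/8" using e by (auto simp: t_def)
  define y where "y = of_real (1 - t) * x"
  have nx: "cmod x = 1" using 2 by simp
  have ny: "cmod y = 1 - t" unfolding y_def norm_mult norm_of_real nx using t by simp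
  have "dist y x = cmod (of_real t * x)" by (simp add: y_def dist_norm algebra_simps norm_minus_commute)
  then have dy: "dist y x < e" using t nx by (simp add: norm_mult)
  have "cmod y \<le> cmod (1/2 - y) + cmod (1/2 :: complex)" using norm_triangle_sub[of y "1/2"] by (simp add: norm_minus_commute)
  then have "dist (1/2) y > 1/4" using ny t by (simp add: dist_norm)
  moreover have "y \<noteq> 0" using ny t by auto
  moreover have "y \<noteq> 1/2"
  proof
    assume "y = 1/2"
    then have "dist (1/2) y = 0" by simp
    then show False using \<open>dist (1/2) y > 1/4\<close> by linarith
  qed
  ultimately have "y \<in> core cusp2" using ny t by (auto simp: core_def)
  then show ?thesis using dy by blast
next
  case 3
  define t where "t = min (e / 2) (1 / 8)"
  have t: "0 < t" "t < e" "t \<le> 1/8" using e by (auto simp: t_def)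
  define y where "y = 1/2 + of_real (1 + t) * (x - 1/2)"
  have nx: "cmod (x - 1/2) = 1/4" using 3 by (simp add: dist_norm norm_minus_commute)
  have d2: "cmod (y - 1/2) = (1 + t) / 4"
  proof -
    have "y - 1/2 = of_real (1 + t) * (x - 1/2)" by (simp add: y_def)
    then show ?thesis using t nx by (simp add: norm_mult del: of_real_add)
  qed
  have "y - x = of_real t * (x - 1/2)" by (simp add: y_def algebra_simps)
  then have dy: "dist y x < e" using t by (simp add: dist_norm norm_mult nx)
  have "cmod y \<le> cmod (y - 1/2) + cmod (1/2 :: complex)" using norm_triangle_sub[of y "1/2"] by simp
  then have "cmod y \<le> (1 + t) / 4 + 1 / 2" unfolding d2 by simp
  then have y1: "cmod y < 1" using t by (simp add: field_simps)
  have y0: "y \<noteq> 0" using d2 t by auto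
  have "dist (1/2) y > 1/4" using d2 t by (simp add: dist_norm norm_minus_commute)
  then have "y \<in> core cusp2" using y1 y0 3 by (auto simp: core_def)
  then show ?thesis using dy by blast
qed

context pants_cover
begin

lemma openin_N_borel:
  assumes "openin (top_of_set N) G" shows "G \<in> sets borel"
proof -
  obtain T where "closed T" "N = uhp \<inter> T" using N_closed by (auto simp: closedin_closed)
  then have "N \<in> sets borel" using open_uhp by auto
  moreover obtain V where "open V" "G = N \<inter> V" using assms by (auto simp: openin_open)
  ultimately show ?thesis by auto
qed

text \<open>The saturation of \<open>G\<close> with respect to the fibres of \<open>p\<close>.\<close>

definition sat :: "complex set \<Rightarrow> complex set" where
  "sat G = N \<inter> p -` (p ` G)"

lemma sat_iff: "z \<in> N \<Longrightarrow> z \<in> sat G \<longleftrightarrow> (\<exists>w\<in>G. p w = p z)"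
  by (auto simp: sat_def) (metis imageI)

lemma sat_mono_pt: "z \<in> sat G \<Longrightarrow> w \<in> N \<Longrightarrow> p w = p z \<Longrightarrow> w \<in> sat G"
  by (auto simp: sat_def)

lemma subset_sat: "G \<subseteq> N \<Longrightarrow> G \<subseteq> sat G"
  by (auto simp: sat_def)

lemma sat_openin:
  assumes "openin (top_of_set N) G" shows "openin (top_of_set N) (sat G)"
  unfolding sat_def
  by (rule continuous_openin_preimage[OF p_cont _ covering_space_open_map[OF cov assms]])
    (use p_image in auto)

text \<open>A measurable choice of one point in each fibre over the image of an open set: the set is covered
  by countably many sheets, and a point is kept in the first sheet that meets its fibre.\<close>

lemma open_section:
  assumes G: "openin (top_of_set N) G"
  shows "\<exists>F. F \<in> sets borel \<and> F \<subseteq> G \<and> (\<forall>z\<in>G. \<exists>!w. w \<in> F \<and> p w = p z) \<and>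
    (G \<noteq> {} \<longrightarrow> (\<exists>H. openin (top_of_set N) H \<and> H \<noteq> {} \<and> H \<subseteq> F))"
proof (cases "G = {}")
  case True
  then show ?thesis by (intro exI[of _ "{}"]) auto
next
  case False
  have GN: "G \<subseteq> N" by (rule openin_imp_subset[OF G])
  define \<F> where "\<F> = {T. openin (top_of_set N) T \<and> inj_on p T \<and> T \<subseteq> G \<and> T \<noteq> {}}"
  have cover: "\<Union>\<F> = G"
  proof
    show "G \<subseteq> \<Union>\<F>"
    proof
      fix z assume z: "z \<in> G"
      then have zN: "z \<in> N" using GN by blast
      obtain T u q where T: "z \<in> T" "openin (top_of_set N) T" "homeomorphism T u p q"
        by (rule covering_space_local_homeomorphism[OF cov zN])
      have "inj_on p (T \<inter> G)"
        by (rule inj_on_inverseI[where g = q]) (use homeomorphism_apply1[OF T(3)] in auto)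
      then have "T \<inter> G \<in> \<F>" unfolding \<F>_def using T G z by (auto intro: openin_Int)
      then show "z \<in> \<Union>\<F>" using T z by blast
    qed
  qed (auto simp: \<F>_def)
  have all: "openin (top_of_set N) T" if "T \<in> \<F>" for T using that by (simp add: \<F>_def)
  obtain \<F>' where F': "\<F>' \<subseteq> \<F>" "countable \<F>'" "\<Union>\<F>' = \<Union>\<F>"
    by (rule Lindelof_openin[OF all])
  have ne: "\<F>' \<noteq> {}" using False F'(3) cover by auto
  define W where "W = from_nat_into \<F>'"
  have W: "W i \<in> \<F>'" for i unfolding W_def by (rule from_nat_into[OF ne])
  have "range W = \<F>'" unfolding W_def by (rule range_from_nat_into[OF ne F'(2)])
  then have WU: "(\<Union>i. W i) = G" unfolding F'(3)[unfolded cover, symmetric] by simp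
  have Wp: "openin (top_of_set N) (W i)" "inj_on p (W i)" "W i \<subseteq> G" "W i \<noteq> {}" for i
    using subsetD[OF F'(1) W[of i]] by (simp_all add: \<F>_def)
  define F where "F = (\<Union>i. W i - (\<Union>j<i. sat (W j)))"
  have FG: "F \<subseteq> G" using Wp(3) by (auto simp: F_def)
  have ex1: "\<exists>!w. w \<in> F \<and> p w = p z" if z: "z \<in> G" for z
  proof -
    have zN: "z \<in> N" using z GN by blast
    define i where "i = (LEAST i. z \<in> sat (W i))"
    obtain i0 where "z \<in> W i0" using z WU by blast
    then have "z \<in> sat (W i0)" using zN by (auto simp: sat_def)
    then have i1: "z \<in> sat (W i)" unfolding i_def by (rule LeastI[of "\<lambda>i. z \<in> sat (W i)"])
    have i2: "z \<notin> sat (W j)" if "j < i" for j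
      using not_less_Least[of j "\<lambda>i. z \<in> sat (W i)"] that unfolding i_def by simp
    note i = i1 i2
    obtain w where w: "w \<in> W i" "p w = p z" using i(1) zN sat_iff by blast
    have wN: "w \<in> N" using w Wp(3) GN by blast
    have "w \<notin> sat (W j)" if "j < i" for j using i(2)[OF that] sat_mono_pt[OF _ zN, of w "W j"] w by auto
    then have "w \<in> F" using w by (auto simp: F_def)
    moreover have "w' = w" if w': "w' \<in> F" "p w' = p z" for w'
    proof -
      obtain k where k: "w' \<in> W k" "\<And>j. j < k \<Longrightarrow> w' \<notin> sat (W j)" using w'(1) by (auto simp: F_def)
      have w'N: "w' \<in> N" using k Wp(3) GN by blast
      have "\<not> k < i"
      proof
        assume "k < i"
        then have "z \<notin> sat (W k)" by (rule i(2))
        then show False using k(1) w'(2) zN sat_iff by blast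
      qed
      moreover have "\<not> i < k"
      proof
        assume "i < k"
        then have "w' \<notin> sat (W i)" by (rule k(2))
        then show False using w w'(2) w'N sat_iff by metis
      qed
      ultimately have "k = i" by simp
      then show "w' = w" using k(1) w w'(2) Wp(2)[of i] by (metis inj_onD)
    qed
    ultimately show ?thesis using w(2) by blast
  qed
  have "F \<in> sets borel" unfolding F_def
    by (intro sets.countable_UN subset_UNIV image_subsetI sets.Diff sets.finite_UN finite_lessThan
        openin_N_borel[OF Wp(1)] openin_N_borel[OF sat_openin[OF Wp(1)]])
  moreover have "W 0 - (\<Union>j<0. sat (W j)) \<subseteq> F" unfolding F_def by (rule UN_upper) simp
  then have "openin (top_of_set N) (W 0) \<and> W 0 \<noteq> {} \<and> W 0 \<subseteq> F" using Wp(1,4)[of 0] by simp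
  ultimately show ?thesis using FG ex1 by (intro exI[of _ F] conjI ballI impI exI[of _ "W 0"]) auto
qed

text \<open>The sets \<open>O' i\<close> are ordered by preference: each fibre is represented by a point of the first \<open>O' i\<close> that it
  meets. The last clause keeps a nonempty open piece of the preferred sets, so that the chosen set is not null
  there.\<close>

lemma priority_section:
  assumes Oi: "\<And>i. openin (top_of_set N) (O' i)"
  shows "\<exists>F. F \<in> sets borel \<and> F \<subseteq> (\<Union>i\<le>n. O' i) \<and> (\<forall>z\<in>(\<Union>i\<le>n. O' i). \<exists>!w. w \<in> F \<and> p w = p z) \<and>
    (\<forall>w\<in>F. \<exists>i\<le>n. w \<in> O' i \<and> (\<forall>j<i. w \<notin> sat (O' j))) \<and>
    (\<forall>i\<le>(n::nat). O' i \<noteq> {} \<longrightarrow> (\<exists>j\<le>i. \<exists>H. openin (top_of_set N) H \<and> H \<noteq> {} \<and> H \<subseteq> F \<inter> O' j))"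
proof -
  have ON: "O' i \<subseteq> N" for i by (rule openin_imp_subset[OF Oi])
  have "\<forall>i. \<exists>F. F \<in> sets borel \<and> F \<subseteq> O' i \<and> (\<forall>z\<in>O' i. \<exists>!w. w \<in> F \<and> p w = p z) \<and>
    (O' i \<noteq> {} \<longrightarrow> (\<exists>H. openin (top_of_set N) H \<and> H \<noteq> {} \<and> H \<subseteq> F))"
    using open_section[OF Oi] by blast
  then obtain S where S: "\<And>i. S i \<in> sets borel" "\<And>i. S i \<subseteq> O' i" "\<And>i z. z \<in> O' i \<Longrightarrow> \<exists>!w. w \<in> S i \<and> p w = p z"
    and S4: "\<And>i. O' i \<noteq> {} \<Longrightarrow> \<exists>H. openin (top_of_set N) H \<and> H \<noteq> {} \<and> H \<subseteq> S i"
    by metis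
  define F where "F = (\<Union>i\<le>n. S i - (\<Union>j<i. sat (O' j)))"
  have "F \<in> sets borel" unfolding F_def
    by (intro sets.finite_UN finite_atMost sets.Diff finite_lessThan S(1) openin_N_borel[OF sat_openin[OF Oi]])
  moreover have "F \<subseteq> (\<Union>i\<le>n. O' i)" unfolding F_def using S(2) by blast
  moreover have "\<forall>z\<in>(\<Union>i\<le>n. O' i). \<exists>!w. w \<in> F \<and> p w = p z"
  proof
    fix z assume "z \<in> (\<Union>i\<le>n. O' i)"
    then obtain i0 where i0: "i0 \<le> n" "z \<in> O' i0" by blast
    have zN: "z \<in> N" using i0 ON by blast
    define i where "i = (LEAST i. z \<in> sat (O' i))"
    have s0: "z \<in> sat (O' i0)" using zN i0 by (auto simp: sat_def)
    then have i1: "z \<in> sat (O' i)" unfolding i_def by (rule LeastI[of "\<lambda>i. z \<in> sat (O' i)"])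
    have i2: "z \<notin> sat (O' j)" if "j < i" for j
      using not_less_Least[of j "\<lambda>i. z \<in> sat (O' i)"] that unfolding i_def by simp
    note i = i1 i2
    have "i \<le> i0" unfolding i_def by (rule Least_le[of "\<lambda>i. z \<in> sat (O' i)", OF s0])
    then have "i \<le> n" using i0 by simp
    obtain v where v: "v \<in> O' i" "p v = p z" using i(1) zN sat_iff by blast
    obtain w where w: "w \<in> S i" "p w = p z" using S(3)[OF v(1)] v(2) by auto
    have wN: "w \<in> N" using w S(2) ON by blast
    have "w \<notin> sat (O' j)" if "j < i" for j
      using i(2)[OF that] sat_mono_pt[OF _ zN, of w "O' j"] w by auto
    then have "w \<in> F" using w \<open>i \<le> n\<close> by (auto simp: F_def)
    moreover have "w' = w" if w': "w' \<in> F" "p w' = p z" for w'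
    proof -
      obtain k where k: "w' \<in> S k" "\<And>j. j < k \<Longrightarrow> w' \<notin> sat (O' j)" using w'(1) by (auto simp: F_def)
      have kO: "w' \<in> O' k" "w \<in> O' i" using k w S(2) by auto
      have w'N: "w' \<in> N" using kO ON by blast
      have "\<not> k < i"
      proof
        assume "k < i"
        then have "z \<notin> sat (O' k)" by (rule i(2))
        then show False using kO w'(2) zN sat_iff by blast
      qed
      moreover have "\<not> i < k"
      proof
        assume "i < k"
        then have "w' \<notin> sat (O' i)" by (rule k(2))
        then show False using kO w w'(2) w'N sat_iff by metis
      qed
      ultimately have "k = i" by simp
      then show "w' = w" using k(1) w w'(2) S(3)[OF v(1)] v(2) by metis
    qed
    ultimately show "\<exists>!w. w \<in> F \<and> p w = p z" using w(2) by blast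
  qed
  moreover have "\<forall>w\<in>F. \<exists>i\<le>n. w \<in> O' i \<and> (\<forall>j<i. w \<notin> sat (O' j))"
  proof
    fix w assume "w \<in> F"
    then obtain i where i: "i \<le> n" "w \<in> S i" "\<And>j. j < i \<Longrightarrow> w \<notin> sat (O' j)" by (auto simp: F_def)
    then show "\<exists>i\<le>n. w \<in> O' i \<and> (\<forall>j<i. w \<notin> sat (O' j))" using S(2)[of i] by blast
  qed
  moreover have "\<forall>i\<le>n. O' i \<noteq> {} \<longrightarrow> (\<exists>j\<le>i. \<exists>H. openin (top_of_set N) H \<and> H \<noteq> {} \<and> H \<subseteq> F \<inter> O' j)"
  proof (intro allI impI)
    fix i assume i: "i \<le> n" "O' i \<noteq> {}"
    define j where "j = (LEAST j. O' j \<noteq> {})"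
    have j: "O' j \<noteq> {}" unfolding j_def by (rule LeastI[of "\<lambda>j. O' j \<noteq> {}", OF i(2)])
    have ji: "j \<le> i" unfolding j_def by (rule Least_le[of "\<lambda>j. O' j \<noteq> {}", OF i(2)])
    have emp: "O' k = {}" if "k < j" for k using not_less_Least[of k "\<lambda>j. O' j \<noteq> {}"] that by (auto simp: j_def)
    have "(\<Union>k<j. sat (O' k)) = {}" using emp by (auto simp: sat_def)
    moreover have "S j - (\<Union>k<j. sat (O' k)) \<subseteq> F" using ji i unfolding F_def by (intro UN_upper) auto
    ultimately have "S j \<subseteq> F" by simp
    then show "\<exists>j\<le>i. \<exists>H. openin (top_of_set N) H \<and> H \<noteq> {} \<and> H \<subseteq> F \<inter> O' j"
      using S4[OF j] S(2)[of j] ji by (metis Int_subset_iff order_trans)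
  qed
  ultimately show ?thesis by blast
qed

text \<open>Over the interior of the surface the covering space is locally an open subset of the plane.\<close>

lemma core_imp_interior:
  assumes z: "z \<in> N" "p z \<in> core cusp2" and G: "openin (top_of_set N) G" "z \<in> G"
  shows "z \<in> interior G"
proof -
  obtain T u q where T: "z \<in> T" "openin (top_of_set N) T" "p z \<in> u"
      "openin (top_of_set (pants cusp2)) u" "homeomorphism T u p q"
    by (rule covering_space_local_homeomorphism[OF cov z(1)])
  have GT: "openin (top_of_set N) (T \<inter> G)" using T G by (auto intro: openin_Int)
  have "openin (top_of_set (pants cusp2)) (p ` (T \<inter> G))" by (rule covering_space_open_map[OF cov GT])
  then obtain V where V: "open V" "p ` (T \<inter> G) = pants cusp2 \<inter> V" by (auto simp: openin_open)
  let ?S = "core cusp2 \<inter> V"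
  have SpT: "?S \<subseteq> p ` (T \<inter> G)" using V core_subset_pants by blast
  then have Su: "?S \<subseteq> u" using homeomorphism_image1[OF T(5)] by blast
  have "open (q ` ?S)"
  proof (rule invariance_of_domain)
    show "continuous_on ?S q" using homeomorphism_cont2[OF T(5)] Su continuous_on_subset by blast
    show "inj_on q ?S" by (rule inj_on_inverseI[where g = p]) (use homeomorphism_apply2[OF T(5)] Su in auto)
    show "open ?S" using V open_core by blast
  qed
  moreover have "q ` ?S \<subseteq> G"
  proof
    fix x assume "x \<in> q ` ?S"
    then obtain v where v: "v \<in> ?S" "x = q v" by blast
    obtain y where y: "y \<in> T \<inter> G" "v = p y" using SpT v by blast
    then have "x = y" using v homeomorphism_apply1[OF T(5)] by auto
    then show "x \<in> G" using y by blast
  qed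
  moreover have "z \<in> q ` ?S"
  proof (rule image_eqI)
    show "z = q (p z)" using homeomorphism_apply1[OF T(5) T(1)] by simp
    have "p z \<in> p ` (T \<inter> G)" using T G by blast
    then show "p z \<in> ?S" using z V by blast
  qed
  ultimately show ?thesis by (meson interiorI)
qed

lemma openin_N_emeasure_pos:
  assumes G: "openin (top_of_set N) G" "G \<noteq> {}"
  shows "emeasure lborel G > 0"
proof -
  have "openin (top_of_set (pants cusp2)) (p ` G)" by (rule covering_space_open_map[OF cov G(1)])
  then obtain V where V: "open V" "p ` G = pants cusp2 \<inter> V" by (auto simp: openin_open)
  obtain x where x: "x \<in> pants cusp2" "x \<in> V" using G(2) V by blast
  obtain e where e: "e > 0" "ball x e \<subseteq> V" using V(1) x(2) open_contains_ball by blast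
  obtain y where y: "y \<in> core cusp2" "dist y x < e" using core_dense[OF x(1) e(1)] by blast
  have "y \<in> V" using e y by (auto simp: dist_commute)
  then have "y \<in> p ` G" using V y core_subset_pants by blast
  then obtain z where z: "z \<in> G" "p z = y" by blast
  have zN: "z \<in> N" using openin_imp_subset[OF G(1)] z by blast
  have "z \<in> interior G" using core_imp_interior[OF zN _ G(1) z(1)] z y by simp
  then have "interior G \<noteq> {}" by blast
  then have nn: "\<not> negligible (interior G)" by (intro open_not_negligible) auto
  have "emeasure lborel (interior G) \<noteq> 0"
  proof
    assume "emeasure lborel (interior G) = 0"
    then have "interior G \<in> null_sets lborel" by (intro null_setsI) auto
    then have "interior G \<in> null_sets lebesgue" by (rule null_sets_completionI)
    then show False using nn by (simp add: negligible_iff_null_sets)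
  qed
  moreover have "emeasure lborel (interior G) \<le> emeasure lborel G"
    by (intro emeasure_mono interior_subset) (use openin_N_borel[OF G(1)] in simp)
  ultimately show ?thesis by (metis le_zero_eq not_gr_zero)
qed

end

section \<open>Area\<close>

lemma circle_dist_lipschitz:
  assumes l: "l > 0" shows "circle_dist l u s \<le> circle_dist l u' s + \<bar>u - u'\<bar>"
proof -
  have "circle_dist l u s - \<bar>u - u'\<bar> \<le> \<bar>u' - s + of_int k * l\<bar>" for k
    using circle_dist_le[OF l, of u s k] by linarith
  then have "circle_dist l u s - \<bar>u - u'\<bar> \<le> circle_dist l u' s"
    unfolding circle_dist_def[of l u'] by (intro cINF_greatest) auto
  then show ?thesis by linarith
qed

lemma circle_dist_periodic:
  assumes l: "l > 0" shows "circle_dist l (u + of_int k * l) s = circle_dist l u s"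
proof -
  have *: "circle_dist l (u + of_int k * l) s \<le> circle_dist l u s" for u k
    unfolding circle_dist_def[of l u]
  proof (intro cINF_greatest)
    fix j :: int
    show "circle_dist l (u + of_int k * l) s \<le> \<bar>u - s + of_int j * l\<bar>"
      using circle_dist_le[OF l, of "u + of_int k * l" s "j - k"] by (simp add: algebra_simps)
  qed simp
  show ?thesis using *[of u k] *[of "u + of_int k * l" "- k"] by simp
qed

lemma circle_dist_sym:
  assumes l: "l > 0" shows "circle_dist l s s' = circle_dist l s' s"
proof -
  have *: "circle_dist l s s' \<le> circle_dist l s' s" for s s'
    unfolding circle_dist_def[of l s']
  proof (intro cINF_greatest)
    fix k :: int
    show "circle_dist l s s' \<le> \<bar>s' - s + of_int k * l\<bar>"
      using circle_dist_le[OF l, of s s' "- k"] by (simp add: abs_minus_commute algebra_simps)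
  qed simp
  show ?thesis using *[of s s'] *[of s' s] by simp
qed

lemma circle_dist_continuous:
  assumes l: "l > 0" shows "continuous_on S (\<lambda>u. circle_dist l u s)"
proof (rule continuous_on_subset[OF lipschitz_on_continuous_on[of 1]])
  show "1-lipschitz_on UNIV (\<lambda>u. circle_dist l u s)"
  proof (rule lipschitz_onI)
    fix u u' :: real
    show "dist (circle_dist l u s) (circle_dist l u' s) \<le> 1 * dist u u'"
      using circle_dist_lipschitz[OF l, of u s u'] circle_dist_lipschitz[OF l, of u' s u]
      by (simp add: dist_real_def abs_le_iff)
  qed simp
qed simp

text \<open>The distance to the union of the feet of \<open>\<gamma>\<close> and of \<open>\<gamma>'\<close>.\<close>

definition feet_dist :: "real \<Rightarrow> real \<Rightarrow> real \<Rightarrow> real \<Rightarrow> real" where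
  "feet_dist l s s' u = min (circle_dist l u s) (circle_dist l u s')"

lemma feet_dist_lipschitz:
  assumes l: "l > 0" shows "feet_dist l s s' u \<le> feet_dist l s s' u' + \<bar>u - u'\<bar>"
  using circle_dist_lipschitz[OF l, of u s u'] circle_dist_lipschitz[OF l, of u s' u']
  by (simp add: feet_dist_def min_def)

lemma feet_dist_nonneg: "l > 0 \<Longrightarrow> feet_dist l s s' u \<ge> 0"
  by (simp add: feet_dist_def circle_dist_nonneg)

lemma feet_dist_commute: "feet_dist l s s' = feet_dist l s' s"
  by (auto simp: feet_dist_def min.commute)

text \<open>The feet cut the line into gaps of lengths \<open>v\<close> and \<open>l - v\<close>, both at most
  \<open>l - circle_dist l s s'\<close>; in a gap the distance to the feet is a tent over its midpoint.\<close>

lemma feet_dist_tent: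
  assumes l: "l > 0" and X: "X = (l - circle_dist l s s') / 2"
  obtains c1 c2 where "s - l \<le> c1" "c1 \<le> s + l" "s - l \<le> c2" "c2 \<le> s + l"
    "\<And>u. \<exists>k::int. feet_dist l s s' u \<le> X - \<bar>u - (c1 + of_int k * l)\<bar> \<or> feet_dist l s s' u \<le> X - \<bar>u - (c2 + of_int k * l)\<bar>"
proof -
  define n where "n = \<lfloor>(s - s') / l\<rfloor>"
  define v where "v = s - s' - of_int n * l"
  have "of_int n \<le> (s - s') / l" "(s - s') / l < of_int n + 1" unfolding n_def by linarith+
  then have v: "0 \<le> v" "v < l" using l by (simp_all add: v_def field_simps)
  have d1: "circle_dist l s s' \<le> v"
    using circle_dist_le[OF l, of s s' "- n"] v by (simp add: v_def)
  have d2: "circle_dist l s s' \<le> l - v"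
    using circle_dist_le[OF l, of s s' "- n - 1"] v by (simp add: v_def algebra_simps)
  define c1 c2 where "c1 = s - v / 2" and "c2 = s + (l - v) / 2"
  show ?thesis
  proof (rule that[of c1 c2])
    fix u
    define k where "k = \<lfloor>(u - (s - v)) / l\<rfloor>"
    define w where "w = u - of_int k * l"
    have "of_int k \<le> (u - (s - v)) / l" "(u - (s - v)) / l < of_int k + 1" unfolding k_def by linarith+
    then have w: "s - v \<le> w" "w < s - v + l" using l by (simp_all add: w_def field_simps)
    have e1: "feet_dist l s s' u \<le> \<bar>w - s\<bar>"
      using circle_dist_le[OF l, of u s "- k"] by (simp add: feet_dist_def w_def algebra_simps min_le_iff_disj)
    have e2: "feet_dist l s s' u \<le> w - (s - v)"
      using circle_dist_le[OF l, of u s' "- k - n"] w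
      by (simp add: feet_dist_def w_def v_def algebra_simps min_le_iff_disj)
    have e3: "feet_dist l s s' u \<le> s - v + l - w"
      using circle_dist_le[OF l, of u s' "- k - n - 1"] w
      by (simp add: feet_dist_def w_def v_def algebra_simps min_le_iff_disj)
    show "\<exists>k::int. feet_dist l s s' u \<le> X - \<bar>u - (c1 + of_int k * l)\<bar> \<or> feet_dist l s s' u \<le> X - \<bar>u - (c2 + of_int k * l)\<bar>"
    proof (intro exI[of _ k])
      have a1: "u - (c1 + of_int k * l) = w - s + v / 2" "u - (c2 + of_int k * l) = w - s - (l - v) / 2"
        by (simp_all add: c1_def c2_def w_def)
      have vX: "v / 2 \<le> X" "(l - v) / 2 \<le> X" using d1 d2 unfolding X by simp_all
      show "feet_dist l s s' u \<le> X - \<bar>u - (c1 + of_int k * l)\<bar> \<or> feet_dist l s s' u \<le> X - \<bar>u - (c2 + of_int k * l)\<bar>"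
      proof (cases "w \<le> s")
        case True
        then have "feet_dist l s s' u \<le> X - \<bar>w - s + v / 2\<bar>" using e1 e2 vX by linarith
        then show ?thesis unfolding a1 by simp
      next
        case False
        moreover have "(l - v) / 2 = l / 2 - v / 2" by (simp add: field_simps)
        ultimately have "feet_dist l s s' u \<le> X - \<bar>w - s - (l - v) / 2\<bar>" using e1 e3 vX by linarith
        then show ?thesis unfolding a1 by simp
      qed
    qed
  qed (use v l in \<open>auto simp: c1_def c2_def field_simps\<close>)
qed

text \<open>Compare with two geometric series of ratio \<open>1/2\<close>: \<open>12 = 3 * (2 + 2)\<close>, where \<open>3 \<ge> exp 1\<close> pays for replacing \<open>c\<close>
  by its integral part.\<close>

lemma sum_exp_dist_int:
  assumes "finite J" shows "(\<Sum>j\<in>J. exp (- \<bar>of_int j - c\<bar>)) \<le> (12::real)"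
proof -
  define n where "n = \<lfloor>c\<rfloor>"
  have e3: "exp (1::real) \<le> 3" by (rule exp_le)
  have half: "exp (- of_nat i) \<le> (1/2::real) ^ i" for i :: nat
  proof -
    have "exp (- (1::real)) \<le> 1/2" using exp_ge_add_one_self[of "1::real"] by (simp add: exp_minus field_simps)
    then have "exp (- (1::real)) ^ i \<le> (1/2) ^ i" by (intro power_mono) auto
    then show ?thesis by (simp flip: exp_of_nat_mult)
  qed
  have geo: "(\<Sum>i\<in>A. (1/2::real) ^ i) \<le> 2" if "finite A" for A :: "nat set"
  proof -
    have "(\<Sum>i\<in>A. (1/2::real) ^ i) \<le> (\<Sum>i. (1/2) ^ i)"
      by (rule sum_le_suminf) (use that in \<open>auto intro: summable_geometric\<close>)
    then show ?thesis by (simp add: suminf_geometric)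
  qed
  have one: "exp (- \<bar>of_int j - c\<bar>) \<le> 3 * (1/2) ^ nat \<bar>j - n\<bar>" for j
  proof -
    have "of_int n \<le> c" "c < of_int n + 1" unfolding n_def by linarith+
    then have "- \<bar>of_int j - c\<bar> \<le> 1 + (- \<bar>of_int (j - n)\<bar>)" by simp
    then have "exp (- \<bar>of_int j - c\<bar>) \<le> exp (1 + (- \<bar>of_int (j - n) :: real\<bar>))" by simp
    also have "\<dots> = exp 1 * exp (- of_nat (nat \<bar>j - n\<bar>))" unfolding exp_add by simp
    also have "\<dots> \<le> 3 * (1/2) ^ nat \<bar>j - n\<bar>" by (intro mult_mono e3 half) auto
    finally show ?thesis .
  qed
  have "(\<Sum>j\<in>J. exp (- \<bar>of_int j - c\<bar>)) \<le> (\<Sum>j\<in>J. 3 * (1/2) ^ nat \<bar>j - n\<bar>)"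
    by (rule sum_mono) (rule one)
  also have "\<dots> = 3 * (\<Sum>j\<in>J. (1/2) ^ nat \<bar>j - n\<bar>)" by (simp add: sum_distrib_left)
  also have "(\<Sum>j\<in>J. (1/2::real) ^ nat \<bar>j - n\<bar>) \<le> 4"
  proof -
    let ?P = "J \<inter> {n..}" and ?M = "J \<inter> {..<n}"
    have "(\<Sum>j\<in>J. (1/2::real) ^ nat \<bar>j - n\<bar>) = (\<Sum>j\<in>?P. (1/2) ^ nat \<bar>j - n\<bar>) + (\<Sum>j\<in>?M. (1/2) ^ nat \<bar>j - n\<bar>)"
      by (subst sum.union_disjoint[symmetric]) (use assms in \<open>auto intro!: sum.cong\<close>)
    moreover have "(\<Sum>j\<in>?P. (1/2::real) ^ nat \<bar>j - n\<bar>) = (\<Sum>i\<in>(\<lambda>j. nat \<bar>j - n\<bar>) ` ?P. (1/2) ^ i)"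
      by (subst sum.reindex) (auto simp: inj_on_def)
    moreover have "(\<Sum>j\<in>?M. (1/2::real) ^ nat \<bar>j - n\<bar>) = (\<Sum>i\<in>(\<lambda>j. nat \<bar>j - n\<bar>) ` ?M. (1/2) ^ i)"
      by (subst sum.reindex) (auto simp: inj_on_def)
    ultimately show ?thesis
      using geo[of "(\<lambda>j. nat \<bar>j - n\<bar>) ` ?P"] geo[of "(\<lambda>j. nat \<bar>j - n\<bar>) ` ?M"] assms by simp
  qed
  finally show ?thesis by simp
qed

text \<open>A Riemann sum for the integral of \<open>exp (feet_dist l s s')\<close> over a period. At most 7 translates of each of
  the two tents are relevant, and each contributes at most \<open>12 * exp X\<close>.\<close>

lemma sum_exp_feet_dist:
  assumes l: "l \<ge> 2" and X: "X = (l - circle_dist l s s') / 2"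
  shows "(\<Sum>j\<in>{-1..\<lceil>l\<rceil>}. exp (feet_dist l s s' (s + of_int j))) \<le> 240 * exp X"
proof -
  have l0: "l > 0" using l by simp
  obtain c1 c2 where c: "s - l \<le> c1" "c1 \<le> s + l" "s - l \<le> c2" "c2 \<le> s + l"
    and tent: "\<And>u. \<exists>k::int. feet_dist l s s' u \<le> X - \<bar>u - (c1 + of_int k * l)\<bar> \<or> feet_dist l s s' u \<le> X - \<bar>u - (c2 + of_int k * l)\<bar>"
    by (rule feet_dist_tent[OF l0 X]) blast
  have Xl: "X \<le> l / 2" unfolding X using circle_dist_nonneg[OF l0, of s s'] by simp
  define K :: "int set" where "K = {-3..3}"
  have pt: "exp (feet_dist l s s' (s + of_int j)) \<le> (\<Sum>k\<in>K. exp X * exp (- \<bar>of_int j - (c1 + of_int k * l - s)\<bar>) + exp X * exp (- \<bar>of_int j - (c2 + of_int k * l - s)\<bar>))"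
    if j: "j \<in> {-1..\<lceil>l\<rceil>}" for j
  proof -
    let ?u = "s + of_int j"
    have ju: "-1 \<le> (of_int j :: real)" "of_int j \<le> l + 1" using j by (auto, linarith?)
    obtain k :: int and c where k: "c = c1 \<or> c = c2" "feet_dist l s s' ?u \<le> X - \<bar>?u - (c + of_int k * l)\<bar>"
      using tent[of ?u] by blast
    have cb: "s - l \<le> c" "c \<le> s + l" using k(1) c by auto
    have "\<bar>?u - (c + of_int k * l)\<bar> \<le> X" using k(2) feet_dist_nonneg[OF l0, of s s' ?u] by linarith
    then have ab: "of_int k * l \<le> 3 * l + 1" "- (2 * l + 1) \<le> of_int k * l" using cb ju Xl l by (auto simp: abs_le_iff)
    have "k \<in> K"
    proof -
      have "k < 4"
      proof (rule ccontr)
        assume "\<not> k < 4"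
        then have "(4::real) \<le> of_int k" by linarith
        then have "4 * l \<le> of_int k * l" using l by (intro mult_right_mono) auto
        then show False using ab l by linarith
      qed
      moreover have "-4 < k"
      proof (rule ccontr)
        assume "\<not> -4 < k"
        then have "of_int k \<le> (-4::real)" by linarith
        then have "of_int k * l \<le> (-4) * l" using l by (intro mult_right_mono) auto
        then show False using ab l by linarith
      qed
      ultimately show ?thesis by (auto simp: K_def)
    qed
    have "exp (feet_dist l s s' ?u) \<le> exp (X - \<bar>?u - (c + of_int k * l)\<bar>)" using k(2) by simp
    also have "\<dots> = exp X * exp (- \<bar>of_int j - (c + of_int k * l - s)\<bar>)" by (simp add: exp_diff exp_minus divide_inverse algebra_simps)
    also have "\<dots> \<le> exp X * exp (- \<bar>of_int j - (c1 + of_int k * l - s)\<bar>) + exp X * exp (- \<bar>of_int j - (c2 + of_int k * l - s)\<bar>)"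
      using k(1) by auto
    also have "\<dots> \<le> (\<Sum>k\<in>K. exp X * exp (- \<bar>of_int j - (c1 + of_int k * l - s)\<bar>) + exp X * exp (- \<bar>of_int j - (c2 + of_int k * l - s)\<bar>))"
      by (rule member_le_sum[OF \<open>k \<in> K\<close>]) (auto simp: K_def)
    finally show ?thesis .
  qed
  have "(\<Sum>j\<in>{-1..\<lceil>l\<rceil>}. exp (feet_dist l s s' (s + of_int j)))
    \<le> (\<Sum>j\<in>{-1..\<lceil>l\<rceil>}. \<Sum>k\<in>K. exp X * exp (- \<bar>of_int j - (c1 + of_int k * l - s)\<bar>) + exp X * exp (- \<bar>of_int j - (c2 + of_int k * l - s)\<bar>))"
    by (rule sum_mono) (rule pt)
  also have "\<dots> = (\<Sum>k\<in>K. exp X * (\<Sum>j\<in>{-1..\<lceil>l\<rceil>}. exp (- \<bar>of_int j - (c1 + of_int k * l - s)\<bar>)) + exp X * (\<Sum>j\<in>{-1..\<lceil>l\<rceil>}. exp (- \<bar>of_int j - (c2 + of_int k * l - s)\<bar>)))"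
    by (subst sum.swap) (simp add: sum.distrib sum_distrib_left)
  also have "\<dots> \<le> (\<Sum>k\<in>K. exp X * 12 + exp X * 12)"
    by (intro sum_mono add_mono mult_left_mono sum_exp_dist_int) auto
  also have "\<dots> = of_nat (card K) * (24 * exp X)" by simp
  also have "\<dots> \<le> 10 * (24 * exp X)" by (intro mult_right_mono) (auto simp: K_def)
  finally show ?thesis by simp
qed

text \<open>The hypothesis \<open>d\<close> is a bound of order \<open>r\<close> for the hyperbolic distance.\<close>

lemma close_points:
  assumes z: "z \<in> uhp" and w: "w \<in> uhp" and r: "0 < r" "r \<le> 1"
    and d: "(cmod (z - w))\<^sup>2 \<le> 16 * r\<^sup>2 * Im z * Im w"
  shows "cmod (z - w) \<le> 20 * r * Im w" "Im w \<le> 21 * Im z"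
proof -
  have *: "cmod (z - w) \<le> 20 * r * Im w" if z: "Im z > 0" "Im w > 0"
    and d: "(cmod (z - w))\<^sup>2 \<le> 16 * r\<^sup>2 * Im z * Im w" for z w
  proof (rule ccontr)
    define x where "x = cmod (z - w)"
    assume "\<not> ?thesis"
    then have x: "x > 20 * r * Im w" by (simp add: x_def)
    have x0: "x > 0" using x r z by (smt (verit) mult_pos_pos)
    have iz: "Im z \<le> Im w + x" using abs_Im_le_cmod[of "z - w"] by (simp add: x_def)
    have rw: "r * Im w < x / 20" using x by simp
    have "x\<^sup>2 \<le> 16 * r\<^sup>2 * Im z * Im w" using d by (simp add: x_def)
    also have "\<dots> \<le> 16 * r\<^sup>2 * (Im w + x) * Im w" using iz z r by (intro mult_right_mono mult_left_mono) auto
    also have "\<dots> = 16 * (r * Im w) * (r * Im w) + 16 * (r * (r * Im w)) * x" by (simp add: power2_eq_square algebra_simps)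
    also have "\<dots> \<le> 16 * (x / 20) * (x / 20) + 16 * (1 * (x / 20)) * x"
      using rw r z x0 by (intro add_mono mult_mono) auto
    also have "\<dots> < x\<^sup>2" using x0 by (simp add: power2_eq_square field_simps)
    finally show False by simp
  qed
  have pos: "Im z > 0" "Im w > 0" using z w by (auto simp: uhp_def)
  show "cmod (z - w) \<le> 20 * r * Im w" by (rule *[OF pos d])
  have "cmod (w - z) \<le> 20 * r * Im z"
    by (rule *) (use pos d in \<open>auto simp: norm_minus_commute mult_ac\<close>)
  also have "\<dots> \<le> 20 * 1 * Im z" using r pos by (intro mult_right_mono mult_left_mono) auto
  finally show "Im w \<le> 21 * Im z" using abs_Im_le_cmod[of "w - z"] by simp
qed

lemma emeasure_cball_le:
  assumes "R \<ge> 0" shows "emeasure lborel (cball (w::complex) R) \<le> ennreal (4 * R\<^sup>2)"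
proof -
  let ?l = "w - Complex R R" and ?u = "w + Complex R R"
  have "cball w R \<subseteq> cbox ?l ?u"
  proof
    fix z assume "z \<in> cball w R"
    then have "cmod (w - z) \<le> R" by (simp add: dist_norm)
    then show "z \<in> cbox ?l ?u"
      using abs_Re_le_cmod[of "w - z"] abs_Im_le_cmod[of "w - z"] by (auto simp: in_cbox_complex_iff)
  qed
  then have "emeasure lborel (cball w R) \<le> emeasure lborel (cbox ?l ?u)" by (intro emeasure_mono) auto
  also have "\<dots> = ennreal (\<Prod>b\<in>Basis. (?u - ?l) \<bullet> b)"
    using assms by (subst emeasure_lborel_cbox_eq) (auto simp: Basis_complex_def inner_complex_def)
  also have "(\<Prod>b\<in>Basis. (?u - ?l) \<bullet> b) = 4 * R\<^sup>2"
    by (simp add: Basis_complex_def inner_complex_def power2_eq_square)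
  finally show ?thesis .
qed

lemma cosh_le_quadratic:
  fixes x :: real assumes "\<bar>x\<bar> \<le> 1" shows "cosh x \<le> 1 + x\<^sup>2"
proof -
  have *: "cosh x \<le> 1 + x\<^sup>2" if x: "0 \<le> x" "x \<le> 1" for x :: real
  proof -
    have 1: "exp x \<le> 1 + x + x\<^sup>2" by (rule exp_bound[OF x])
    have "exp (-x) \<le> 1 / (1 + x)"
      using exp_ge_add_one_self[of x] x by (simp add: exp_minus divide_inverse le_imp_inverse_le)
    also have "\<dots> \<le> 1 - x + x\<^sup>2" using x by (simp add: field_simps power2_eq_square)
    finally show ?thesis using 1 by (simp add: cosh_field_def)
  qed
  show ?thesis using *[of "\<bar>x\<bar>"] assms by simp
qed

text \<open>The part of the collar over a unit interval starting at \<open>t\<close> has height of order \<open>r = exp (- circle_dist l t s)\<close>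
  and is covered by about \<open>1 / r\<close> discs of radius of order \<open>r\<close> centred on the axis, of total area of order
  \<open>r\<close>. As \<open>g\<close> is of order \<open>exp (2 * feet_dist)\<close> there and \<open>r \<le> exp (- feet_dist)\<close>, the interval contributes
  \<open>exp (feet_dist)\<close>. Covering by discs replaces a change of variables. The constant is \<open>705600 * 2 * 240\<close>: the
  first factor \<open>441 * 4 * 20\<^sup>2\<close> comes from the discs, \<open>2\<close> from their number \<open>2 / r\<close> and \<open>240\<close> from the Riemann
  sum.\<close>

lemma weighted_collar_area:
  fixes g :: "complex \<Rightarrow> ennreal" and e :: "real \<Rightarrow> complex" and m :: "complex \<Rightarrow> complex"
  assumes l: "l \<ge> 2" and X: "X = (l - circle_dist l s s') / 2"
    and m: "\<And>z. z \<in> uhp \<Longrightarrow> m z \<in> uhp" "\<And>z w. z \<in> uhp \<Longrightarrow> w \<in> uhp \<Longrightarrow> hdist (m z) (m w) = hdist z w"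
    and e: "\<And>t. m (e t) = iaxis t" "\<And>t. e t \<in> uhp"
    and g: "\<And>z. g z \<noteq> 0 \<Longrightarrow> z \<in> uhp \<and> s - 1 < ln (cmod (m z)) \<and> ln (cmod (m z)) < s + l + 1 \<and>
        \<bar>Re (m z)\<bar> < exp (- circle_dist l (ln (cmod (m z))) s) / 2 * cmod (m z) \<and>
        g z \<le> ennreal (exp (2 * feet_dist l s s' (ln (cmod (m z))) + 2))"
  shows "(\<integral>\<^sup>+z. g z * ennreal (1 / (Im z)\<^sup>2) \<partial>lborel) \<le> ennreal (338688000 * exp 4 * exp X)"
proof -
  have l0: "l > 0" using l by simp
  define J where "J = {-1..\<lceil>l\<rceil>}"
  define t where "t = (\<lambda>j::int. s + of_int j)"
  define r where "r = (\<lambda>j. exp (- circle_dist l (t j) s))"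
  define I where "I = (\<lambda>j. {0..\<lfloor>1 / r j\<rfloor>})"
  define c where "c = (\<lambda>j i. e (t j + of_int i * r j))"
  define w where "w = (\<lambda>j. exp (2 * feet_dist l s s' (t j) + 4))"
  have r: "0 < r j" "r j \<le> 1" for j using circle_dist_nonneg[OF l0] by (auto simp: r_def)
  have cpos: "Im (c j i) > 0" for j i using e(2) by (auto simp: c_def uhp_def)
  \<comment> \<open>\<open>j\<close> numbers the unit intervals and \<open>i\<close> the discs over one of them\<close>
  have cover: "\<exists>j\<in>J. \<exists>i\<in>I j. z \<in> cball (c j i) (20 * r j * Im (c j i)) \<and>
      g z * ennreal (1 / (Im z)\<^sup>2) \<le> ennreal (w j * 441 / (Im (c j i))\<^sup>2)" if gz: "g z \<noteq> 0" for z
  proof -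
    define u where "u = ln (cmod (m z))"
    have G: "z \<in> uhp" "s - 1 < u" "u < s + l + 1" "\<bar>Re (m z)\<bar> < exp (- circle_dist l u s) / 2 * cmod (m z)"
      "g z \<le> ennreal (exp (2 * feet_dist l s s' u + 2))" using g[OF gz] by (auto simp: u_def)
    define j where "j = \<lfloor>u - s\<rfloor>"
    have j: "of_int j \<le> u - s" "u - s < of_int j + 1" unfolding j_def by linarith+
    have jJ: "j \<in> J" unfolding J_def using j G(2,3) by (auto simp: j_def, linarith+)
    define i where "i = \<lfloor>(u - t j) / r j\<rfloor>"
    have ut: "0 \<le> u - t j" "u - t j < 1" using j by (auto simp: t_def)
    have iI: "i \<in> I j" unfolding I_def i_def using ut r[of j] by (auto intro!: floor_mono divide_right_mono)
    have "of_int i \<le> (u - t j) / r j" "(u - t j) / r j < of_int i + 1" unfolding i_def by linarith+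
    then have "of_int i * r j \<le> u - t j" "u - t j < (of_int i + 1) * r j" using r[of j] by (simp_all add: field_simps)
    \<comment> \<open>the disc centre lies within \<open>r j\<close> of the foot of \<open>z\<close> on the axis\<close>
    then have close: "\<bar>u - (t j + of_int i * r j)\<bar> \<le> r j" by (simp add: algebra_simps abs_le_iff)
    define v where "v = t j + of_int i * r j"
    have mz: "Im (m z) > 0" using m(1)[OF G(1)] by (simp add: uhp_def)
    then have nz: "cmod (m z) > 0" by (auto simp: complex_eq_iff)
    have nu: "cmod (m z) = exp u" using nz by (simp add: u_def)
    define q where "q = \<bar>Re (m z)\<bar> / cmod (m z)"
    have q: "0 \<le> q" "q < exp (- circle_dist l u s) / 2" using G(4) nz by (auto simp: q_def field_simps)
    have dr: "exp (- circle_dist l u s) \<le> 3 * r j"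
    proof -
      have "- circle_dist l u s \<le> 1 + (- circle_dist l (t j) s)"
        using circle_dist_lipschitz[OF l0, of "t j" s u] ut by simp
      then have "exp (- circle_dist l u s) \<le> exp (1 + (- circle_dist l (t j) s))" by simp
      also have "\<dots> \<le> 3 * r j" unfolding exp_add r_def using exp_le by (intro mult_right_mono) auto
      finally show ?thesis .
    qed
    have q1: "q\<^sup>2 \<le> 1/4"
    proof -
      have "exp (- circle_dist l u s) \<le> 1" using circle_dist_nonneg[OF l0] by simp
      then have "q \<le> 1/2" using q by linarith
      then have "q\<^sup>2 \<le> (1/2)\<^sup>2" using q by (intro power_mono) auto
      then show ?thesis by (simp add: power2_eq_square)
    qed
    have q2: "q\<^sup>2 \<le> 9/4 * (r j)\<^sup>2"
    proof -
      have "q \<le> 3/2 * r j" using q dr by linarith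
      then have "q\<^sup>2 \<le> (3/2 * r j)\<^sup>2" using q by (intro power_mono) auto
      then show ?thesis by (simp add: power2_eq_square)
    qed
    define k where "k = Im (m z) / cmod (m z)"
    have k0: "k > 0" using mz nz by (simp add: k_def)
    have kq: "k\<^sup>2 = 1 - q\<^sup>2"
    proof -
      have "(Re (m z))\<^sup>2 + (Im (m z))\<^sup>2 = (cmod (m z))\<^sup>2" by (simp add: cmod_power2)
      then have "(Re (m z))\<^sup>2 / (cmod (m z))\<^sup>2 + (Im (m z))\<^sup>2 / (cmod (m z))\<^sup>2 = 1"
        using nz by (simp flip: add_divide_distrib)
      then show ?thesis by (simp add: k_def q_def power_divide)
    qed
    have k1: "1 / k \<le> 1 + 3 * (r j)\<^sup>2"
    proof -
      have kk: "k \<ge> k\<^sup>2"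
      proof -
        have "k\<^sup>2 \<le> 1" using kq by simp
        then have "k \<le> 1" using k0 by (simp add: power_le_one_iff)
        then show ?thesis using k0 by (simp add: power2_eq_square mult_left_le)
      qed
      have "1 \<le> (1 + 4/3 * q\<^sup>2) * (1 - q\<^sup>2)"
      proof -
        have "(1 + 4/3 * x) * (1 - x) = 1 + x * (1/3 - 4/3 * x)" for x :: real by (simp add: field_simps)
        then have "(1 + 4/3 * q\<^sup>2) * (1 - q\<^sup>2) = 1 + q\<^sup>2 * (1/3 - 4/3 * q\<^sup>2)" .
        moreover have "q\<^sup>2 * (1/3 - 4/3 * q\<^sup>2) \<ge> 0" using q1 by (intro mult_nonneg_nonneg) auto
        ultimately show ?thesis by linarith
      qed
      also have "\<dots> \<le> (1 + 4/3 * q\<^sup>2) * k" using kk kq by (intro mult_left_mono) auto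
      finally have "1 / k \<le> 1 + 4/3 * q\<^sup>2" using k0 by (simp add: field_simps)
      then show ?thesis using q2 by linarith
    qed
    have zc: "z \<in> uhp" "c j i \<in> uhp" using G(1) e(2) by (auto simp: c_def)
    have "cosh (hdist z (c j i)) = cosh (u - v) * (1 / k)"
    proof -
      have h: "hdist (m z) (iaxis v) = hdist z (c j i)"
        unfolding c_def e(1)[symmetric] v_def by (rule m(2)[OF G(1) e(2)])
      have "(cmod (m z))\<^sup>2 + (exp v)\<^sup>2 = 2 * Im (m z) * exp v * cosh (hdist z (c j i))"
        by (rule hdist_axis_eq[OF m(1)[OF G(1)]]) (use h hdist_nonneg[OF zc] in simp)
      moreover have "Im (m z) = k * exp u" using nz nu by (simp add: k_def)
      ultimately have "(exp u)\<^sup>2 + (exp v)\<^sup>2 = 2 * (exp u * exp v) * (k * cosh (hdist z (c j i)))"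
        using nu by (simp add: mult_ac)
      moreover have "(exp u)\<^sup>2 + (exp v)\<^sup>2 = 2 * (exp u * exp v) * cosh (u - v)"
        by (simp add: cosh_field_def exp_diff field_simps power2_eq_square)
      ultimately have "k * cosh (hdist z (c j i)) = cosh (u - v)" by simp
      then show ?thesis using k0 by (simp add: field_simps)
    qed
    also have "\<dots> \<le> (1 + (r j)\<^sup>2) * (1 + 3 * (r j)\<^sup>2)"
    proof (intro mult_mono k1)
      have "\<bar>u - v\<bar> \<le> r j" using close by (simp add: v_def)
      then have "(u - v)\<^sup>2 \<le> (r j)\<^sup>2" by (metis abs_ge_zero power2_abs power_mono)
      moreover have "\<bar>u - v\<bar> \<le> 1" using \<open>\<bar>u - v\<bar> \<le> r j\<close> r(2)[of j] by linarith
      ultimately show "cosh (u - v) \<le> 1 + (r j)\<^sup>2" using cosh_le_quadratic[of "u - v"] by linarith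
    qed (use k0 in auto)
    also have "\<dots> \<le> 1 + 8 * (r j)\<^sup>2"
    proof -
      have "(r j)\<^sup>2 \<le> 1" using r[of j] by (simp add: power_le_one)
      moreover have "(1 + x) * (1 + 3 * x) \<le> 1 + 8 * x" if "0 \<le> x" "x \<le> 1" for x :: real
      proof -
        have "x * x \<le> x" using that by (simp add: mult_left_le)
        moreover have "(1 + x) * (1 + 3 * x) = 1 + 4 * x + 3 * (x * x)" by (simp add: algebra_simps)
        ultimately show ?thesis using that by linarith
      qed
      ultimately show ?thesis by simp
    qed
    finally have "cosh (hdist z (c j i)) \<le> 1 + 8 * (r j)\<^sup>2" .
    then have "(cmod (z - c j i))\<^sup>2 / (2 * Im z * Im (c j i)) \<le> 8 * (r j)\<^sup>2"
      unfolding cosh_hdist[OF zc] by simp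
    then have "(cmod (z - c j i))\<^sup>2 \<le> 16 * (r j)\<^sup>2 * Im z * Im (c j i)"
      using zc by (simp add: uhp_def divide_le_eq mult_ac)
    note cl = close_points[OF zc r(1) r(2) this]
    have z0: "Im z > 0" using zc by (simp add: uhp_def)
    have "g z * ennreal (1 / (Im z)\<^sup>2) \<le> ennreal (exp (2 * feet_dist l s s' u + 2)) * ennreal (441 / (Im (c j i))\<^sup>2)"
    proof (intro mult_mono G(5) ennreal_leI)
      have "(Im (c j i))\<^sup>2 \<le> (21 * Im z)\<^sup>2" using cl(2) cpos[of j i] by (intro power_mono) auto
      then show "1 / (Im z)\<^sup>2 \<le> 441 / (Im (c j i))\<^sup>2" using z0 cpos[of j i] by (simp add: field_simps)
    qed auto
    also have "\<dots> = ennreal (exp (2 * feet_dist l s s' u + 2) * (441 / (Im (c j i))\<^sup>2))"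
      by (rule ennreal_mult[symmetric]) auto
    also have "\<dots> \<le> ennreal (w j * (441 / (Im (c j i))\<^sup>2))"
    proof (intro ennreal_leI mult_right_mono)
      have "feet_dist l s s' u \<le> feet_dist l s s' (t j) + 1"
        using feet_dist_lipschitz[OF l0, of s s' u "t j"] ut by simp
      then show "exp (2 * feet_dist l s s' u + 2) \<le> w j" by (simp add: w_def)
    qed auto
    finally have "g z * ennreal (1 / (Im z)\<^sup>2) \<le> ennreal (w j * 441 / (Im (c j i))\<^sup>2)" by simp
    moreover have "z \<in> cball (c j i) (20 * r j * Im (c j i))" using cl(1) by (simp add: dist_norm norm_minus_commute)
    ultimately show ?thesis using jJ iI by blast
  qed
  have fin: "finite J" "finite (I j)" for j by (auto simp: J_def I_def)
  let ?h = "\<lambda>j i z. ennreal (w j * 441 / (Im (c j i))\<^sup>2) * indicator (cball (c j i) (20 * r j * Im (c j i))) z"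
  have "(\<integral>\<^sup>+z. g z * ennreal (1 / (Im z)\<^sup>2) \<partial>lborel) \<le> (\<integral>\<^sup>+z. (\<Sum>j\<in>J. \<Sum>i\<in>I j. ?h j i z) \<partial>lborel)"
  proof (rule nn_integral_mono)
    fix z
    show "g z * ennreal (1 / (Im z)\<^sup>2) \<le> (\<Sum>j\<in>J. \<Sum>i\<in>I j. ?h j i z)"
    proof (cases "g z = 0")
      case False
      obtain j i where ji: "j \<in> J" "i \<in> I j" "z \<in> cball (c j i) (20 * r j * Im (c j i))"
        "g z * ennreal (1 / (Im z)\<^sup>2) \<le> ennreal (w j * 441 / (Im (c j i))\<^sup>2)" using cover[OF False] by blast
      have "g z * ennreal (1 / (Im z)\<^sup>2) \<le> ?h j i z" using ji by simp
      also have "\<dots> \<le> (\<Sum>i\<in>I j. ?h j i z)" by (rule member_le_sum[OF ji(2)]) (use fin in auto)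
      also have "\<dots> \<le> (\<Sum>j\<in>J. \<Sum>i\<in>I j. ?h j i z)" by (rule member_le_sum[OF ji(1)]) (use fin in auto)
      finally show ?thesis .
    qed simp
  qed
  also have "\<dots> = (\<Sum>j\<in>J. \<Sum>i\<in>I j. ennreal (w j * 441 / (Im (c j i))\<^sup>2) * emeasure lborel (cball (c j i) (20 * r j * Im (c j i))))"
  proof -
    have meas: "?h j i \<in> borel_measurable lborel" for j i
      by (intro borel_measurable_times_ennreal borel_measurable_const borel_measurable_indicator) simp
    have "(\<integral>\<^sup>+z. (\<Sum>j\<in>J. \<Sum>i\<in>I j. ?h j i z) \<partial>lborel) = (\<Sum>j\<in>J. \<integral>\<^sup>+z. (\<Sum>i\<in>I j. ?h j i z) \<partial>lborel)"
      by (rule nn_integral_sum) (intro borel_measurable_sum meas)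
    also have "\<dots> = (\<Sum>j\<in>J. \<Sum>i\<in>I j. \<integral>\<^sup>+z. ?h j i z \<partial>lborel)"
      by (intro sum.cong refl nn_integral_sum meas)
    also have "\<dots> = (\<Sum>j\<in>J. \<Sum>i\<in>I j. ennreal (w j * 441 / (Im (c j i))\<^sup>2) * emeasure lborel (cball (c j i) (20 * r j * Im (c j i))))"
      by (intro sum.cong refl nn_integral_cmult_indicator) simp
    finally show ?thesis .
  qed
  also have "\<dots> \<le> (\<Sum>j\<in>J. \<Sum>i\<in>I j. ennreal (705600 * w j * (r j)\<^sup>2))"
  proof (intro sum_mono)
    fix j i
    have "ennreal (w j * 441 / (Im (c j i))\<^sup>2) * emeasure lborel (cball (c j i) (20 * r j * Im (c j i)))
      \<le> ennreal (w j * 441 / (Im (c j i))\<^sup>2) * ennreal (4 * (20 * r j * Im (c j i))\<^sup>2)"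
      using r(1)[of j] cpos[of j i] by (intro mult_left_mono emeasure_cball_le) auto
    also have "\<dots> = ennreal (w j * 441 / (Im (c j i))\<^sup>2 * (4 * (20 * r j * Im (c j i))\<^sup>2))"
      by (rule ennreal_mult[symmetric]) (auto simp: w_def)
    also have "w j * 441 / (Im (c j i))\<^sup>2 * (4 * (20 * r j * Im (c j i))\<^sup>2) = 705600 * w j * (r j)\<^sup>2"
      using cpos[of j i] by (simp add: power_mult_distrib)
    finally show "ennreal (w j * 441 / (Im (c j i))\<^sup>2) * emeasure lborel (cball (c j i) (20 * r j * Im (c j i)))
      \<le> ennreal (705600 * w j * (r j)\<^sup>2)" .
  qed
  also have "\<dots> = ennreal (\<Sum>j\<in>J. \<Sum>i\<in>I j. 705600 * w j * (r j)\<^sup>2)"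
  proof -
    have nn: "0 \<le> 705600 * w j * (r j)\<^sup>2" for j by (simp add: w_def)
    have "(\<Sum>j\<in>J. \<Sum>i\<in>I j. ennreal (705600 * w j * (r j)\<^sup>2)) = (\<Sum>j\<in>J. ennreal (\<Sum>i\<in>I j. 705600 * w j * (r j)\<^sup>2))"
      by (intro sum.cong refl sum_ennreal nn)
    also have "\<dots> = ennreal (\<Sum>j\<in>J. \<Sum>i\<in>I j. 705600 * w j * (r j)\<^sup>2)"
      by (intro sum_ennreal sum_nonneg nn)
    finally show ?thesis .
  qed
  finally have int: "(\<integral>\<^sup>+z. g z * ennreal (1 / (Im z)\<^sup>2) \<partial>lborel) \<le> ennreal (\<Sum>j\<in>J. \<Sum>i\<in>I j. 705600 * w j * (r j)\<^sup>2)" .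
  have "(\<Sum>j\<in>J. \<Sum>i\<in>I j. 705600 * w j * (r j)\<^sup>2) \<le> (\<Sum>j\<in>J. 1411200 * exp 4 * exp (feet_dist l s s' (t j)))"
  proof (rule sum_mono)
    fix j
    have cI: "of_nat (card (I j)) \<le> 2 / r j"
    proof -
      have r1: "1 \<le> 1 / r j" using r[of j] by simp
      then have "\<lfloor>1 / r j\<rfloor> \<ge> 1" by linarith
      moreover have "of_nat (card {0..n}) = of_int n + (1::real)" if "n \<ge> 1" for n :: int using that by simp
      ultimately have "of_nat (card (I j)) = of_int \<lfloor>1 / r j\<rfloor> + (1::real)" unfolding I_def by blast
      also have "\<dots> \<le> 1 / r j + 1 / r j" using r1 of_int_floor_le[of "1 / r j"] by linarith
      also have "\<dots> = 2 / r j" by simp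
      finally show ?thesis .
    qed
    have "(\<Sum>i\<in>I j. 705600 * w j * (r j)\<^sup>2) = of_nat (card (I j)) * (705600 * w j * (r j)\<^sup>2)" by simp
    also have "\<dots> \<le> 2 / r j * (705600 * w j * (r j)\<^sup>2)" by (intro mult_right_mono cI) (auto simp: w_def)
    also have "\<dots> = 1411200 * w j * r j" using r(1)[of j] by (simp add: power2_eq_square)
    also have "\<dots> \<le> 1411200 * w j * exp (- feet_dist l s s' (t j))"
      by (intro mult_left_mono) (auto simp: w_def r_def feet_dist_def)
    also have "\<dots> = 1411200 * exp 4 * exp (feet_dist l s s' (t j))"
      by (simp add: w_def mult.assoc flip: exp_add)
    finally show "(\<Sum>i\<in>I j. 705600 * w j * (r j)\<^sup>2) \<le> 1411200 * exp 4 * exp (feet_dist l s s' (t j))" .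
  qed
  also have "\<dots> = 1411200 * exp 4 * (\<Sum>j\<in>{-1..\<lceil>l\<rceil>}. exp (feet_dist l s s' (s + of_int j)))"
    by (simp add: sum_distrib_left J_def t_def)
  also have "\<dots> \<le> 1411200 * exp 4 * (240 * exp X)"
    by (intro mult_left_mono sum_exp_feet_dist[OF l X]) auto
  finally have "(\<Sum>j\<in>J. \<Sum>i\<in>I j. 705600 * w j * (r j)\<^sup>2) \<le> 338688000 * exp 4 * exp X" by simp
  then show ?thesis using int ennreal_leI order_trans by blast
qed

section \<open>Length\<close>

context collar_chart
begin

text \<open>The real part is the position along the geodesic \<open>a\<close>, the imaginary part the signed angle from it.\<close>

definition log_chart :: "complex \<Rightarrow> complex" where "log_chart z = Ln (- \<i> * m z)"

lemma log_chart_field_derivative: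
  assumes z: "z \<in> uhp"
  shows "(log_chart has_field_derivative (1 / (of_real (-C) * z + of_real A)\<^sup>2) / m z) (at z)"
proof -
  have mz: "Im (m z) > 0" using m_uhp[OF z] by (simp add: uhp_def)
  then have nn: "- \<i> * m z \<notin> \<real>\<^sub>\<le>\<^sub>0" by (auto simp: complex_nonpos_Reals_iff)
  have mnz: "m z \<noteq> 0" using mz by auto
  have "(m has_field_derivative 1 / (of_real (-C) * z + of_real A)\<^sup>2) (at z)"
    unfolding m_def by (rule mob_field_derivative[OF det' z])
  then have "((\<lambda>z. - \<i> * m z) has_field_derivative - \<i> * (1 / (of_real (-C) * z + of_real A)\<^sup>2)) (at z)"
    by (rule DERIV_cmult)
  from DERIV_chain2[OF has_field_derivative_Ln[OF nn] this]
  have "(log_chart has_field_derivative inverse (- \<i> * m z) * (- \<i> * (1 / (of_real (-C) * z + of_real A)\<^sup>2))) (at z)"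
    unfolding log_chart_def[abs_def] .
  moreover have "inverse (- \<i> * m z) * (- \<i> * (1 / (of_real (-C) * z + of_real A)\<^sup>2)) = (1 / (of_real (-C) * z + of_real A)\<^sup>2) / m z"
    using mnz by (simp add: field_simps)
  ultimately show ?thesis by simp
qed

text \<open>The derivative of \<open>log_chart\<close> with respect to the hyperbolic metric is \<open>Im (m z) / cmod (m z)\<close>, the cosine of the angle
  from the axis.\<close>

lemma log_chart_derivative_bound:
  assumes z: "z \<in> uhp"
  shows "cmod ((1 / (of_real (-C) * z + of_real A)\<^sup>2) / m z) \<le> 1 / Im z"
proof -
  have mz: "Im (m z) > 0" and iz: "Im z > 0" using m_uhp[OF z] z by (auto simp: uhp_def)
  then have nz: "cmod (m z) > 0" by (auto simp: complex_eq_iff)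
  have "Im (m z) = Im z / (cmod (of_real (-C) * z + of_real A))\<^sup>2"
    unfolding m_def by (rule Im_mob[OF det'])
  then have e: "1 / (cmod (of_real (-C) * z + of_real A))\<^sup>2 = Im (m z) / Im z" using iz by simp
  have "cmod ((1 / (of_real (-C) * z + of_real A)\<^sup>2) / m z) = (1 / (cmod (of_real (-C) * z + of_real A))\<^sup>2) / cmod (m z)"
    by (simp only: norm_divide norm_power norm_one)
  also have "\<dots> = (Im (m z) / cmod (m z)) / Im z" unfolding e by simp
  also have "\<dots> \<le> 1 / Im z"
    using abs_Im_le_cmod[of "m z"] nz iz by (intro divide_right_mono) (auto simp: divide_le_eq)
  finally show ?thesis .
qed

lemma log_chart_Re: "z \<in> uhp \<Longrightarrow> Re (log_chart z) = ln (cmod (m z))"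
proof -
  assume z: "z \<in> uhp"
  have "m z \<noteq> 0" using m_uhp[OF z] by (auto simp: uhp_def)
  then show ?thesis unfolding log_chart_def by (subst Re_Ln) (auto simp: norm_mult)
qed

lemma log_chart_Im: "z \<in> uhp \<Longrightarrow> \<bar>Re (m z)\<bar> / cmod (m z) \<le> \<bar>Im (log_chart z)\<bar>"
proof -
  assume z: "z \<in> uhp"
  have nz: "m z \<noteq> 0" using m_uhp[OF z] by (auto simp: uhp_def)
  have "exp (log_chart z) = - \<i> * m z" unfolding log_chart_def using nz by (simp add: exp_Ln)
  then have "Im (exp (log_chart z)) = - Re (m z)" by simp
  then have "exp (Re (log_chart z)) * sin (Im (log_chart z)) = - Re (m z)" by (simp add: Im_exp)
  moreover have "exp (Re (log_chart z)) = cmod (m z)" using log_chart_Re[OF z] nz by simp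
  ultimately have "cmod (m z) * sin (Im (log_chart z)) = - Re (m z)" by simp
  then have "\<bar>Re (m z)\<bar> = cmod (m z) * \<bar>sin (Im (log_chart z))\<bar>" by (metis abs_minus_cancel abs_mult abs_norm_cancel)
  then have "\<bar>Re (m z)\<bar> / cmod (m z) = \<bar>sin (Im (log_chart z))\<bar>" using nz by simp
  also have "\<dots> \<le> \<bar>Im (log_chart z)\<bar>" by (rule abs_sin_x_le_abs_x)
  finally show ?thesis .
qed

lemma log_chart_axis: "Im (log_chart (a t)) = 0"
proof -
  have "- \<i> * m (a t) = of_real (exp t)" unfolding m_axis by (simp add: complex_eq_iff)
  then show ?thesis unfolding log_chart_def by (simp add: Ln_of_real)
qed

text \<open>The hyperbolic length dominates the Euclidean length in the logarithmic chart, hence the distance of the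
  images of the end points. The function \<open>h\<close> is a measurable minorant of the length element: the
  derivative of a path is arbitrary at its finitely many corners.\<close>

lemma path_length_log_chart:
  assumes c: "valid_path c" "path_image c \<subseteq> uhp" and t: "0 \<le> t1" "t1 \<le> t2" "t2 \<le> 1"
  shows "\<exists>h. h \<in> borel_measurable borel \<and>
     (\<forall>t. h t \<le> ennreal (cmod (vector_derivative c (at t)) / Im (c t)) * indicator {t1<..<t2} t) \<and>
     ennreal (cmod (log_chart (c t2) - log_chart (c t1))) \<le> (\<integral>\<^sup>+t. h t \<partial>lborel)"
proof -
  let ?g = "\<lambda>t. ennreal (cmod (vector_derivative c (at t)) / Im (c t))"
  define dlog where "dlog = (\<lambda>z. (1 / (of_real (-C) * z + of_real A)\<^sup>2) / m z)"
  obtain S where S: "finite S" "c C1_differentiable_on ({0..1} - S)" and cc: "continuous_on {0..1} c"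
    using c(1) unfolding valid_path_def piecewise_C1_differentiable_on_def by auto
  have cu: "c t \<in> uhp" if "t \<in> {0..1}" for t using c(2) that by (auto simp: path_image_def)
  define T where "T = {t1<..<t2} - S"
  have T01: "T \<subseteq> {0..1} - S" using t by (auto simp: T_def)
  have openT: "open T" unfolding T_def using S(1) by (intro open_Diff finite_imp_closed) auto
  have dc: "(c has_vector_derivative vector_derivative c (at t)) (at t)" if "t \<in> T" for t
    using S(2) T01 that unfolding C1_differentiable_on_eq by (meson subsetD vector_derivative_works)
  have contd: "continuous_on T (\<lambda>t. vector_derivative c (at t))"
    using S(2) T01 continuous_on_subset unfolding C1_differentiable_on_eq by blast
  define f' where "f' = (\<lambda>t. vector_derivative c (at t) * dlog (c t))"
  have df: "((\<lambda>t. log_chart (c t)) has_vector_derivative f' t) (at t)" if "t \<in> T" for t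
  proof -
    have ct: "c t \<in> uhp" using that T01 cu by auto
    have "(log_chart has_field_derivative dlog (c t)) (at (c t))" unfolding dlog_def by (rule log_chart_field_derivative[OF ct])
    from field_vector_diff_chain_at[OF dc[OF that] this]
    show ?thesis by (simp add: comp_def f'_def)
  qed
  have cont_log: "continuous_on uhp log_chart"
    by (rule DERIV_continuous_on[OF has_field_derivative_at_within[OF log_chart_field_derivative]])
  have "continuous_on {t1..t2} (\<lambda>t. log_chart (c t))"
    by (rule continuous_on_compose2[OF cont_log continuous_on_subset[OF cc]]) (use t cu in auto)
  then have ftc: "(f' has_integral (log_chart (c t2) - log_chart (c t1))) {t1..t2}"
    using t df by (intro fundamental_theorem_of_calculus_interior_strong[OF S(1)]) (auto simp: T_def)
  define h where "h = (\<lambda>t. indicator T t *\<^sub>R f' t)"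
  have contm: "continuous_on uhp m" unfolding m_def by (rule continuous_on_mob[OF det'])
  have cT: "continuous_on T c" by (rule continuous_on_subset[OF cc]) (use T01 in auto)
  have "continuous_on T f'"
  proof -
    have mc: "continuous_on T (\<lambda>t. m (c t))"
      by (rule continuous_on_compose2[OF contm cT]) (use T01 cu in auto)
    have nz: "m (c t) \<noteq> 0" "(of_real (-C) * c t + of_real A)\<^sup>2 \<noteq> 0" if "t \<in> T" for t
    proof -
      have ct: "c t \<in> uhp" using that T01 cu by blast
      show "m (c t) \<noteq> 0" using m_uhp[OF ct] by (auto simp: uhp_def)
      show "(of_real (-C) * c t + of_real A)\<^sup>2 \<noteq> 0" using mob_denom_nonzero[OF det' ct] by simp
    qed
    show ?thesis unfolding f'_def dlog_def
      by (intro continuous_on_mult continuous_on_divide continuous_on_power continuous_on_add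
          continuous_on_const contd cT mc ballI nz)
  qed
  then have hmeas: "h \<in> borel_measurable borel"
    unfolding h_def using openT by (intro borel_measurable_continuous_on_indicator) auto
  have hb: "ennreal (norm (h t)) \<le> ?g t * indicator {t1<..<t2} t" for t
  proof (cases "t \<in> T")
    case True
    then have ct: "c t \<in> uhp" and ti: "t \<in> {t1<..<t2}" using T01 cu by (auto simp: T_def)
    have "norm (h t) = cmod (vector_derivative c (at t)) * cmod (dlog (c t))"
      using True by (simp add: h_def f'_def norm_mult)
    also have "\<dots> \<le> cmod (vector_derivative c (at t)) * (1 / Im (c t))"
      unfolding dlog_def by (intro mult_left_mono log_chart_derivative_bound ct) auto
    finally show ?thesis using ti by (simp add: ennreal_leI)
  qed (simp add: h_def)
  have "ennreal (cmod (log_chart (c t2) - log_chart (c t1))) \<le> (\<integral>\<^sup>+t. ennreal (norm (h t)) \<partial>lborel)"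
  proof (cases "(\<integral>\<^sup>+t. ennreal (norm (h t)) \<partial>lborel) = \<infinity>")
    case True
    then show ?thesis by simp
  next
    case False
    then have fin: "(\<integral>\<^sup>+t. ennreal (norm (h t)) \<partial>lborel) < \<infinity>" by (simp add: less_top)
    have hint: "integrable lborel h" by (rule integrableI_bounded) (use hmeas fin in auto)
    have "(h has_integral integral\<^sup>L lborel h) UNIV" by (rule has_integral_integral_lborel[OF hint])
    moreover have "(h has_integral (log_chart (c t2) - log_chart (c t1))) UNIV"
    proof -
      have "((\<lambda>t. if t \<in> {t1..t2} then f' t else 0) has_integral (log_chart (c t2) - log_chart (c t1))) UNIV"
        using ftc unfolding has_integral_restrict_UNIV .
      note int = this
      have neg: "negligible (S \<union> {t1, t2})" using S(1) by (intro negligible_finite) auto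
      have eq: "h t = (if t \<in> {t1..t2} then f' t else 0)" if "t \<in> UNIV - (S \<union> {t1, t2})" for t
        using that by (auto simp: h_def T_def)
      show ?thesis by (rule has_integral_spike[OF neg eq int])
    qed
    ultimately have "integral\<^sup>L lborel h = log_chart (c t2) - log_chart (c t1)" by (rule has_integral_unique)
    then have "cmod (log_chart (c t2) - log_chart (c t1)) \<le> (LINT t|lborel. norm (h t))"
      using integral_norm_bound[of lborel h] by simp
    then have "ennreal (cmod (log_chart (c t2) - log_chart (c t1))) \<le> ennreal (LINT t|lborel. norm (h t))" by (rule ennreal_leI)
    also have "\<dots> = (\<integral>\<^sup>+t. ennreal (norm (h t)) \<partial>lborel)"
      by (rule nn_integral_eq_integral[symmetric]) (use hint in auto)
    finally show ?thesis .
  qed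
  moreover have "(\<lambda>t. ennreal (norm (h t))) \<in> borel_measurable borel" using hmeas by simp
  ultimately show ?thesis using hb by (intro exI[of _ "\<lambda>t. ennreal (norm (h t))"]) blast
qed

lemma weighted_length_log_chart:
  assumes c: "valid_path c" "path_image c \<subseteq> uhp" and t: "0 \<le> t1" "t1 \<le> t2" "t2 \<le> 1"
    and K: "K \<ge> 0" "\<And>t. t1 < t \<Longrightarrow> t < t2 \<Longrightarrow> ennreal K \<le> \<rho> (c t)"
  shows "ennreal (K * cmod (log_chart (c t2) - log_chart (c t1))) \<le> rho_length \<rho> c"
proof -
  obtain h where h: "h \<in> borel_measurable borel"
    "\<And>t. h t \<le> ennreal (cmod (vector_derivative c (at t)) / Im (c t)) * indicator {t1<..<t2} t"
    "ennreal (cmod (log_chart (c t2) - log_chart (c t1))) \<le> (\<integral>\<^sup>+t. h t \<partial>lborel)"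
    using path_length_log_chart[OF c t] by metis
  have "ennreal (K * cmod (log_chart (c t2) - log_chart (c t1))) = ennreal K * ennreal (cmod (log_chart (c t2) - log_chart (c t1)))"
    using K(1) by (intro ennreal_mult) auto
  also have "\<dots> \<le> ennreal K * (\<integral>\<^sup>+t. h t \<partial>lborel)"
    by (intro mult_left_mono h(3)) auto
  also have "\<dots> = (\<integral>\<^sup>+t. ennreal K * h t \<partial>lborel)"
    by (rule nn_integral_cmult[symmetric]) (use h(1) in simp)
  also have "\<dots> \<le> rho_length \<rho> c"
    unfolding rho_length_def
  proof (rule nn_integral_mono)
    fix t :: real
    show "ennreal K * h t \<le> \<rho> (c t) * ennreal (cmod (vector_derivative c (at t)) / Im (c t)) * indicator {0<..<1} t"
    proof (cases "t1 < t \<and> t < t2")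
      case True
      then have "ennreal K * h t \<le> \<rho> (c t) * ennreal (cmod (vector_derivative c (at t)) / Im (c t))"
        using K(2)[of t] h(2)[of t] by (intro mult_mono) auto
      moreover have "t \<in> {0<..<1}" using True t by auto
      ultimately show ?thesis by simp
    next
      case False
      then have "indicator {t1<..<t2} t = (0::ennreal)" by auto
      then have "h t \<le> 0" using h(2)[of t] by simp
      then show ?thesis by simp
    qed
  qed
  finally show ?thesis .
qed

text \<open>The curve comes from beyond the collar of one side, meets the axis at time \<open>t3\<close>, and ends beyond the collar
  of the other side. Either it moves by 1 along the axis, or the bound for the density is constant up to a factor \<open>exp 1\<close>
  and the curve has to climb the wider one of the two collars; the density times the width of that collar is
  bounded below.\<close>

lemma crossing_length:
  assumes c: "valid_path c" "path_image c \<subseteq> uhp" and t: "0 \<le> t1" "t1 \<le> t3" "t3 \<le> t2" "t2 \<le> 1"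
    and \<rho>: "\<And>t. t1 < t \<Longrightarrow> t < t2 \<Longrightarrow> ennreal (exp (feet_dist l s1 s2 (ln (cmod (m (c t)))))) \<le> \<rho> (c t)"
    and out1: "exp (- circle_dist l (ln (cmod (m (c t1)))) s1) / 2 * cmod (m (c t1)) \<le> \<bar>Re (m (c t1))\<bar>"
    and out2: "exp (- circle_dist l (ln (cmod (m (c t2)))) s2) / 2 * cmod (m (c t2)) \<le> \<bar>Re (m (c t2))\<bar>"
    and on_axis: "c t3 \<in> range a"
  shows "ennreal (exp (-2) / 2) \<le> rho_length \<rho> c"
proof -
  define u where "u = (\<lambda>t. ln (cmod (m (c t))))"
  have cu: "c t \<in> uhp" if "t \<in> {0..1}" for t using c(2) that by (auto simp: path_image_def)
  have u_Re: "u t = Re (log_chart (c t))" if "t \<in> {0..1}" for t using log_chart_Re[OF cu[OF that]] by (simp add: u_def)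
  have w3: "Im (log_chart (c t3)) = 0" using on_axis log_chart_axis by auto
  \<comment> \<open>a point beyond a collar has at least the angle that bounds the collar\<close>
  have ang: "exp (- circle_dist l (u t) s') / 2 \<le> \<bar>Im (log_chart (c t))\<bar>"
    if "t \<in> {0..1}" "exp (- circle_dist l (u t) s') / 2 * cmod (m (c t)) \<le> \<bar>Re (m (c t))\<bar>" for t s'
  proof -
    have "cmod (m (c t)) > 0" using m_uhp[OF cu[OF that(1)]] by (auto simp: uhp_def)
    then have "exp (- circle_dist l (u t) s') / 2 \<le> \<bar>Re (m (c t))\<bar> / cmod (m (c t))"
      using that(2) by (simp add: field_simps)
    also have "\<dots> \<le> \<bar>Im (log_chart (c t))\<bar>" by (rule log_chart_Im[OF cu[OF that(1)]])
    finally show ?thesis .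
  qed
  have a1: "exp (- circle_dist l (u t1) s1) / 2 \<le> \<bar>Im (log_chart (c t1))\<bar>"
    by (rule ang) (use t out1 in \<open>auto simp: u_def\<close>)
  have a2: "exp (- circle_dist l (u t2) s2) / 2 \<le> \<bar>Im (log_chart (c t2))\<bar>"
    by (rule ang) (use t out2 in \<open>auto simp: u_def\<close>)
  have "exp (-2) \<le> (1::real)" by simp
  then have small: "exp (-2) / 2 \<le> (1::real)" by linarith
  show ?thesis
  proof (cases "\<exists>t\<in>{t1..t2}. \<bar>u t - u t1\<bar> > 1")
    case True
    then obtain r where "r \<in> {t1..t2}" and r3: "\<bar>u r - u t1\<bar> > 1" by blast
    then have r: "t1 \<le> r" "r \<le> t2" "\<bar>u r - u t1\<bar> > 1" by simp_all
    have "ennreal (1 * cmod (log_chart (c r) - log_chart (c t1))) \<le> rho_length \<rho> c"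
    proof (rule weighted_length_log_chart[OF c])
      show "ennreal 1 \<le> \<rho> (c x)" if "t1 < x" "x < r" for x
      proof -
        have "ennreal 1 \<le> ennreal (exp (feet_dist l s1 s2 (ln (cmod (m (c x))))))"
          using feet_dist_nonneg[OF l_pos] by (intro ennreal_leI) simp
        also have "\<dots> \<le> \<rho> (c x)" by (rule \<rho>) (use that r in auto)
        finally show ?thesis .
      qed
    qed (use r t in auto)
    moreover have "exp (-2) / 2 \<le> 1 * cmod (log_chart (c r) - log_chart (c t1))"
    proof -
      have "\<bar>u r - u t1\<bar> \<le> cmod (log_chart (c r) - log_chart (c t1))"
        using abs_Re_le_cmod[of "log_chart (c r) - log_chart (c t1)"] u_Re[of r] u_Re[of t1] r t by simp
      then show ?thesis using r(3) small by linarith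
    qed
    ultimately show ?thesis by (metis ennreal_leI order_trans)
  next
    case False
    then have near: "\<bar>u x - u t1\<bar> \<le> 1" if "t1 \<le> x" "x \<le> t2" for x
      using that by (meson atLeastAtMost_iff not_le)
    define K where "K = exp (feet_dist l s1 s2 (u t1) - 1)"
    have K: "ennreal K \<le> \<rho> (c x)" if "t1 < x" "x < t2" for x
    proof -
      have "feet_dist l s1 s2 (u t1) - 1 \<le> feet_dist l s1 s2 (u x)"
        using feet_dist_lipschitz[OF l_pos, of s1 s2 "u t1" "u x"] near[of x] that by simp
      then have "ennreal K \<le> ennreal (exp (feet_dist l s1 s2 (u x)))" unfolding K_def by (intro ennreal_leI) simp
      also have "\<dots> \<le> \<rho> (c x)" unfolding u_def by (rule \<rho>[OF that])
      finally show ?thesis .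
    qed
    have K0: "K \<ge> 0" by (simp add: K_def)
    have e21: "exp (-2) \<le> exp (-1 :: real)" by simp
    show ?thesis
    \<comment> \<open>the wider collar at this position is the one whose foot is nearer\<close>
    proof (cases "circle_dist l (u t1) s1 \<le> circle_dist l (u t1) s2")
      case True
      have "ennreal (K * cmod (log_chart (c t3) - log_chart (c t1))) \<le> rho_length \<rho> c"
        by (rule weighted_length_log_chart[OF c]) (use t K K0 in auto)
      moreover have "exp (-2) / 2 \<le> K * cmod (log_chart (c t3) - log_chart (c t1))"
      proof -
        have "exp (- circle_dist l (u t1) s1) / 2 \<le> cmod (log_chart (c t3) - log_chart (c t1))"
          using a1 w3 abs_Im_le_cmod[of "log_chart (c t3) - log_chart (c t1)"] by simp
        then have "K * (exp (- circle_dist l (u t1) s1) / 2) \<le> K * cmod (log_chart (c t3) - log_chart (c t1))"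
          by (intro mult_left_mono K0)
        moreover have "K * (exp (- circle_dist l (u t1) s1) / 2) = exp (-1) / 2"
          using True by (simp add: K_def feet_dist_def flip: exp_add)
        ultimately show ?thesis using e21 by linarith
      qed
      ultimately show ?thesis by (metis ennreal_leI order_trans)
    next
      case False
      have "ennreal (K * cmod (log_chart (c t2) - log_chart (c t3))) \<le> rho_length \<rho> c"
        by (rule weighted_length_log_chart[OF c]) (use t K K0 in auto)
      moreover have "exp (-2) / 2 \<le> K * cmod (log_chart (c t2) - log_chart (c t3))"
      proof -
        have "circle_dist l (u t2) s2 \<le> circle_dist l (u t1) s2 + 1"
          using circle_dist_lipschitz[OF l_pos, of "u t2" s2 "u t1"] near[of t2] t by simp
        then have "exp (- circle_dist l (u t1) s2 - 1) / 2 \<le> exp (- circle_dist l (u t2) s2) / 2" by simp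
        also have "\<dots> \<le> cmod (log_chart (c t2) - log_chart (c t3))"
          using a2 w3 abs_Im_le_cmod[of "log_chart (c t2) - log_chart (c t3)"] by simp
        finally have "K * (exp (- circle_dist l (u t1) s2 - 1) / 2) \<le> K * cmod (log_chart (c t2) - log_chart (c t3))"
          by (intro mult_left_mono K0)
        moreover have "K * (exp (- circle_dist l (u t1) s2 - 1) / 2) = exp (-2) / 2"
          using False by (simp add: K_def feet_dist_def flip: exp_add)
        ultimately show ?thesis by linarith
      qed
      ultimately show ?thesis by (metis ennreal_leI order_trans)
    qed
  qed
qed

lemma range_a_null: "emeasure lborel (range a) = 0" "range a \<in> sets borel"
proof -
  have "continuous_on UNIV a" by (rule hgeodesic_continuous[OF a_geo])
  moreover have "range a = (\<Union>n::nat. a ` {- real n..real n})"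
  proof -
    have "\<exists>n::nat. t \<in> {- real n..real n}" for t :: real
      using real_arch_simple[of "\<bar>t\<bar>"] by (auto simp: abs_le_iff) (metis minus_le_iff)
    then show ?thesis by blast
  qed
  moreover have "compact (a ` {x..y})" for x y
    by (intro compact_continuous_image continuous_on_subset[OF hgeodesic_continuous[OF a_geo]]) auto
  ultimately show "range a \<in> sets borel" by (metis (no_types, lifting) borel_compact sets.countable_UN image_subsetI)
  have "a differentiable_on UNIV"
    unfolding differentiable_on_def
  proof
    fix t :: real
    show "a differentiable (at t)"
      using mob_axis_vector_derivative[OF det, of t UNIV]
      unfolding chart[abs_def] has_vector_derivative_def differentiable_def by blast
  qed
  then have "negligible (a ` UNIV)"
    by (intro negligible_differentiable_image_lowdim) auto
  then have "emeasure lebesgue (range a) = 0" by (simp add: negligible_iff_null_sets null_sets_def)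
  then show "emeasure lborel (range a) = 0" using \<open>range a \<in> sets borel\<close> by simp
qed

end

section \<open>The density\<close>

lemma circle_dist_le_length:
  assumes l: "l > 0" shows "circle_dist l u s \<le> l"
proof -
  define k where "k = \<lfloor>(u - s) / l\<rfloor>"
  have "of_int k \<le> (u - s) / l" "(u - s) / l < of_int k + 1" unfolding k_def by linarith+
  then have "0 \<le> u - s - of_int k * l" "u - s - of_int k * l < l" using l by (simp_all add: field_simps)
  then show ?thesis using circle_dist_le[OF l, of u s "- k"] by simp
qed

context collar_chart
begin

definition pos :: "complex \<Rightarrow> real" where "pos z = ln (cmod (m z))"

text \<open>Negative in the collar of half-width \<open>exp (- circle_dist l u s) / 2\<close>, measured by the sine of the angle, and
  positive beyond it.\<close>

definition beyond :: "complex \<Rightarrow> real" where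
  "beyond z = \<bar>Re (m z)\<bar> - exp (- circle_dist l (pos z) s) / 2 * cmod (m z)"

lemma m_nonzero: "z \<in> uhp \<Longrightarrow> m z \<noteq> 0"
  using m_uhp[of z] by (auto simp: uhp_def)

lemma m_cont: "continuous_on uhp m"
  unfolding m_def by (rule continuous_on_mob[OF det'])

lemma pos_cont: "continuous_on uhp pos"
  unfolding pos_def by (intro continuous_intros m_cont) (use m_nonzero in auto)

lemma beyond_cont: "continuous_on uhp beyond"
proof -
  have "continuous_on uhp (\<lambda>z. circle_dist l (pos z) s)"
    by (rule continuous_on_compose2[OF circle_dist_continuous[OF l_pos, of UNIV] pos_cont]) auto
  then show ?thesis unfolding beyond_def by (intro continuous_intros m_cont) auto
qed

text \<open>The part of one period of the collar where the distance to the feet exceeds \<open>n - 1\<close>. The margins by 1 make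
  the set open while a closed period is still covered; points over \<open>\<alpha>\<close> are left out because they belong to
  both sides.\<close>

definition level :: "real \<Rightarrow> nat \<Rightarrow> complex set" where
  "level s2 n = {z \<in> R. p z \<notin> alpha_circle \<and> beyond z < 0 \<and> s - 1 < pos z \<and> pos z < s + l + 1 \<and>
     real n - 1 < feet_dist l s s2 (pos z)}"

lemma openin_less:
  assumes "continuous_on uhp f" "continuous_on uhp g"
  shows "openin (top_of_set N) {z \<in> N. f z < (g z :: real)}"
proof -
  have "continuous_on N (\<lambda>z. g z - f z)"
    using assms N_uhp by (intro continuous_intros) (auto intro: continuous_on_subset)
  then have "openin (top_of_set N) (N \<inter> (\<lambda>z. g z - f z) -` {0<..})"
    by (rule continuous_openin_preimage_gen) simp
  moreover have "N \<inter> (\<lambda>z. g z - f z) -` {0<..} = {z \<in> N. f z < g z}" by auto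
  ultimately show ?thesis by simp
qed

lemma off_circle_open: "openin (top_of_set N) {z \<in> R. p z \<notin> alpha_circle}"
proof -
  have "open (- (alpha_circle :: complex set))" by (intro open_Compl closed_sphere)
  then have "openin (top_of_set N) (N \<inter> p -` (- alpha_circle))"
    by (rule continuous_openin_preimage_gen[OF p_cont])
  then have "openin (top_of_set N) (R \<inter> (N \<inter> p -` (- alpha_circle)))" by (rule openin_Int[OF R_open])
  moreover have "R \<inter> (N \<inter> p -` (- alpha_circle)) = {z \<in> R. p z \<notin> alpha_circle}" using R_subset by auto
  ultimately show ?thesis by simp
qed

lemma near_open: "openin (top_of_set N) {z \<in> R. beyond z < 0 \<and> s - 1 < pos z \<and> pos z < s + l + 1}"
proof -
  have "openin (top_of_set N) (R \<inter> {z \<in> N. beyond z < 0} \<inter> {z \<in> N. s - 1 < pos z} \<inter> {z \<in> N. pos z < s + l + 1})"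
    by (intro openin_Int R_open openin_less beyond_cont pos_cont continuous_on_const)
  moreover have "R \<inter> {z \<in> N. beyond z < 0} \<inter> {z \<in> N. s - 1 < pos z} \<inter> {z \<in> N. pos z < s + l + 1}
    = {z \<in> R. beyond z < 0 \<and> s - 1 < pos z \<and> pos z < s + l + 1}" using R_subset by auto
  ultimately show ?thesis by simp
qed

lemma level_open: "openin (top_of_set N) (level s2 n)"
proof -
  have fc: "continuous_on uhp (\<lambda>z. feet_dist l s s2 (pos z))"
    unfolding feet_dist_def
    by (intro continuous_on_min continuous_on_compose2[OF circle_dist_continuous[OF l_pos, of UNIV] pos_cont]) auto
  have "openin (top_of_set N) ({z \<in> R. p z \<notin> alpha_circle} \<inter>
     {z \<in> R. beyond z < 0 \<and> s - 1 < pos z \<and> pos z < s + l + 1} \<inter> {z \<in> N. real n - 1 < feet_dist l s s2 (pos z)})"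
    by (intro openin_Int off_circle_open near_open openin_less fc continuous_on_const)
  moreover have "{z \<in> R. p z \<notin> alpha_circle} \<inter>
     {z \<in> R. beyond z < 0 \<and> s - 1 < pos z \<and> pos z < s + l + 1} \<inter> {z \<in> N. real n - 1 < feet_dist l s s2 (pos z)}
     = level s2 n" using R_subset by (auto simp: level_def)
  ultimately show ?thesis by simp
qed

text \<open>Near the point of \<open>\<alpha>\<close> opposite to the foot of \<open>\<gamma>\<close> there are points over the interior of the surface.\<close>

lemma level_zero_nonempty: "level s2 0 \<noteq> {}"
proof -
  define V where "V = {z \<in> R. beyond z < 0 \<and> s - 1 < pos z \<and> pos z < s + l + 1}"
  have aV: "a (s + l / 2) \<in> V"
    using a_in_R[of "s + l / 2"] l_pos by (simp add: V_def beyond_def pos_def m_axis)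
  have "openin (top_of_set (pants cusp2)) (p ` V)"
    using near_open unfolding V_def[symmetric] by (rule covering_space_open_map[OF cov])
  then obtain O' where O: "open O'" "p ` V = pants cusp2 \<inter> O'" by (auto simp: openin_open)
  have x: "p (a (s + l / 2)) \<in> pants cusp2 \<inter> O'" using aV O by blast
  then obtain e where e: "e > 0" "ball (p (a (s + l / 2))) e \<subseteq> O'" using O(1) open_contains_ball by blast
  obtain y where y: "y \<in> core cusp2" "dist y (p (a (s + l / 2))) < e" using core_dense[of _ cusp2, OF _ e(1)] x by blast
  have "y \<in> O'" using e y by (auto simp: dist_commute)
  then have "y \<in> p ` V" using O y core_subset_pants by blast
  then obtain z where z: "z \<in> V" "p z = y" by blast
  have "z \<in> level s2 0"
    using z y alpha_core feet_dist_nonneg[OF l_pos, of s s2 "pos z"] unfolding level_def V_def by auto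
  then show ?thesis by blast
qed

text \<open>The maximum over the fibre of \<open>exp n\<close> for the levels \<open>n\<close> that it meets. Rounding the exponent gives finitely many
  values, hence measurability.\<close>

definition density :: "real \<Rightarrow> complex \<Rightarrow> ennreal" where
  "density s2 z = (SUP n\<in>{..nat \<lceil>l\<rceil>}. ennreal (exp (real n)) * indicator (sat (level s2 n)) z)"

lemma density_measurable: "density s2 \<in> borel_measurable borel"
proof -
  have "sat (level s2 n) \<in> sets borel" for n by (rule openin_N_borel[OF sat_openin[OF level_open]])
  then show ?thesis unfolding density_def[abs_def] by (intro borel_measurable_SUP) auto
qed

lemma density_invariant: "z \<in> N \<Longrightarrow> w \<in> N \<Longrightarrow> p z = p w \<Longrightarrow> density s2 z = density s2 w"
  unfolding density_def sat_def by (intro SUP_cong refl) (auto simp: indicator_def)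

text \<open>A translation along \<open>a\<close> moves the point into the period that the levels cover.\<close>

lemma density_lower:
  assumes z: "z \<in> R" "p z \<notin> alpha_circle" "beyond z < 0"
  shows "ennreal (exp (feet_dist l s s2 (pos z))) \<le> density s2 z"
proof -
  \<comment> \<open>the number of periods to the one that begins at the foot \<open>s\<close>\<close>
  define k where "k = - \<lfloor>(pos z - s) / l\<rfloor>"
  obtain f where f: "deck N p f" "\<And>t. f (a t) = a (t + of_int k * l)" by (rule translation) blast
  have zN: "z \<in> N" using z R_subset by blast
  have zu: "z \<in> uhp" using zN N_uhp by blast
  define w where "w = f z"
  have wR: "w \<in> R" unfolding w_def by (rule translation_R[OF f z(1)])
  have pw: "p w = p z" using f zN by (simp add: w_def deck_def)
  note co = translation_coordinates[OF f zN, folded w_def]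
  have pos: "pos w = pos z + of_int k * l"
    unfolding pos_def co(2) using m_nonzero[OF zu] by (simp add: ln_mult)
  have "beyond w = exp (of_int k * l) * beyond z"
    unfolding beyond_def pos circle_dist_periodic[OF l_pos] co by (simp add: algebra_simps)
  then have bw: "beyond w < 0" using z(3) by (simp add: mult_pos_neg)
  have "of_int (- k) \<le> (pos z - s) / l" "(pos z - s) / l < of_int (- k) + 1" unfolding k_def minus_minus by linarith+
  then have range: "s \<le> pos w" "pos w < s + l" unfolding pos using l_pos by (simp_all add: field_simps)
  define D where "D = feet_dist l s s2 (pos z)"
  have Dw: "feet_dist l s s2 (pos w) = D" unfolding D_def feet_dist_def pos by (simp add: circle_dist_periodic[OF l_pos])
  have D0: "D \<ge> 0" unfolding D_def by (rule feet_dist_nonneg[OF l_pos])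
  have Dl: "D \<le> l" unfolding D_def feet_dist_def using circle_dist_le_length[OF l_pos, of "pos z" s] by linarith
  define n where "n = nat \<lceil>D\<rceil>"
  have n: "n \<le> nat \<lceil>l\<rceil>" unfolding n_def using Dl by (intro nat_mono ceiling_mono)
  have nD: "D \<le> real n" "real n - 1 < D" unfolding n_def using D0 by (linarith, simp add: of_nat_nat, linarith?)
  have "w \<in> level s2 n" unfolding level_def using wR pw z(2) bw range nD Dw by simp
  then have "z \<in> sat (level s2 n)" using sat_iff[OF zN] pw by blast
  then have "ennreal (exp (real n)) \<le> density s2 z"
    unfolding density_def using n by (intro SUP_upper2[of n]) auto
  moreover have "ennreal (exp D) \<le> ennreal (exp (real n))" using nD by (intro ennreal_leI) simp
  ultimately show ?thesis unfolding D_def by (rule order_trans[rotated])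
qed

text \<open>Prefer the highest levels: the point chosen from a fibre then lies in the level that determines the
  density, and there the density is at most \<open>exp\<close> of the distance to the feet, up to the rounding. So the
  weighted area estimate applies to the chosen points. Positivity of the area comes from a nonempty open
  piece of the chosen set on which the density is at least 1.\<close>

lemma collar_fundamental_set:
  assumes l2: "l \<ge> 2"
  shows "\<exists>F. F \<in> sets borel \<and> F \<subseteq> {z \<in> R. p z \<notin> alpha_circle} \<and>
    (\<forall>z\<in>R. p z \<notin> alpha_circle \<longrightarrow> (\<exists>!w. w \<in> F \<and> p w = p z)) \<and>
    rho_area (density s2) F \<le> ennreal (338688000 * exp 4 * exp ((l - circle_dist l s s2) / 2)) \<and>
    0 < rho_area (density s2) F"
proof -
  define M where "M = nat \<lceil>l\<rceil>"
  \<comment> \<open>highest levels first, then the rest of the region\<close>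
  define O' where "O' = (\<lambda>i. if i \<le> M then level s2 (M - i) else {z \<in> R. p z \<notin> alpha_circle})"
  have Oop: "openin (top_of_set N) (O' i)" for i
    unfolding O'_def using level_open off_circle_open by simp
  obtain F where F: "F \<in> sets borel" "F \<subseteq> (\<Union>i\<le>M + 1. O' i)"
    and ex1: "\<forall>z\<in>(\<Union>i\<le>M + 1. O' i). \<exists>!w. w \<in> F \<and> p w = p z"
    and prio: "\<forall>w\<in>F. \<exists>i\<le>M + 1. w \<in> O' i \<and> (\<forall>j<i. w \<notin> sat (O' j))"
    and H: "\<forall>i\<le>M + 1. O' i \<noteq> {} \<longrightarrow> (\<exists>j\<le>i. \<exists>H. openin (top_of_set N) H \<and> H \<noteq> {} \<and> H \<subseteq> F \<inter> O' j)"
    using priority_section[where O' = O' and n = "M + 1", OF Oop] by (elim exE conjE) (rule that)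
  have OR: "O' i \<subseteq> {z \<in> R. p z \<notin> alpha_circle}" for i by (auto simp: O'_def level_def)
  have FR: "F \<subseteq> {z \<in> R. p z \<notin> alpha_circle}" using F(2) OR by blast
  have Olast: "O' (M + 1) = {z \<in> R. p z \<notin> alpha_circle}" by (simp add: O'_def)
  have key: "z \<in> level s2 0 \<and> density s2 z \<le> ennreal (exp (feet_dist l s s2 (pos z) + 1))"
    if z: "z \<in> F" "density s2 z \<noteq> 0" for z
  proof -
    obtain i where i: "i \<le> M + 1" "z \<in> O' i" "\<And>j. j < i \<Longrightarrow> z \<notin> sat (O' j)" using prio z(1) by blast
    have inlev: "M - n \<ge> i" if "n \<le> M" "z \<in> sat (level s2 n)" for n
    proof (rule ccontr)
      assume "\<not> ?thesis"
      then have "z \<notin> sat (O' (M - n))" using i(3) by simp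
      then show False using that by (simp add: O'_def)
    qed
    have iM: "i \<le> M"
    proof (rule ccontr)
      assume "\<not> i \<le> M"
      then have "z \<notin> sat (level s2 n)" if "n \<le> M" for n using inlev[OF that] that by linarith
      then have "density s2 z = 0" unfolding density_def M_def[symmetric] by (simp add: indicator_def)
      then show False using z(2) by simp
    qed
    \<comment> \<open>the index of the highest level that the fibre meets\<close>
    define n where "n = M - i"
    have zl: "z \<in> level s2 n" using i(2) iM by (simp add: O'_def n_def)
    have "density s2 z \<le> ennreal (exp (real n))"
      unfolding density_def M_def[symmetric]
    proof (rule SUP_least)
      fix k assume k: "k \<in> {..M}"
      show "ennreal (exp (real k)) * indicator (sat (level s2 k)) z \<le> ennreal (exp (real n))"
      proof (cases "z \<in> sat (level s2 k)")
        case True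
        then have "k \<le> n" using inlev[of k] k unfolding n_def by simp
        then show ?thesis using True by (simp add: ennreal_leI)
      qed simp
    qed
    also have "\<dots> \<le> ennreal (exp (feet_dist l s s2 (pos z) + 1))"
      using zl by (intro ennreal_leI) (simp add: level_def)
    finally have 1: "density s2 z \<le> ennreal (exp (feet_dist l s s2 (pos z) + 1))" .
    have "z \<in> level s2 0" using zl feet_dist_nonneg[OF l_pos, of s s2 "pos z"] by (simp add: level_def)
    then show ?thesis using 1 by simp
  qed
  have area: "rho_area (density s2) F \<le> ennreal (338688000 * exp 4 * exp ((l - circle_dist l s s2) / 2))"
  proof -
    define g where "g = (\<lambda>z. (density s2 z)\<^sup>2 * indicator F z)"
    have "rho_area (density s2) F = (\<integral>\<^sup>+z. g z * ennreal (1 / (Im z)\<^sup>2) \<partial>lborel)"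
      unfolding rho_area_def g_def by (simp add: mult_ac)
    also have "\<dots> \<le> ennreal (338688000 * exp 4 * exp ((l - circle_dist l s s2) / 2))"
    proof (rule weighted_collar_area[OF l2 refl m_uhp hdist_m m_axis])
      show "a t \<in> uhp" for t using a_N N_uhp by blast
      fix z assume "g z \<noteq> 0"
      then have z: "z \<in> F" "density s2 z \<noteq> 0" by (auto simp: g_def indicator_def split: if_splits)
      note K = key[OF z]
      have lv: "z \<in> R" "beyond z < 0" "s - 1 < pos z" "pos z < s + l + 1" using K by (auto simp: level_def)
      have "g z = (density s2 z)\<^sup>2" using z by (simp add: g_def)
      also have "\<dots> \<le> (ennreal (exp (feet_dist l s s2 (pos z) + 1)))\<^sup>2" using K by (intro power_mono) auto
      also have "\<dots> = ennreal (exp (2 * feet_dist l s s2 (pos z) + 2))"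
        by (simp add: power2_eq_square flip: ennreal_mult exp_add)
      finally have "g z \<le> ennreal (exp (2 * feet_dist l s s2 (pos z) + 2))" .
      then show "z \<in> uhp \<and> s - 1 < ln (cmod (m z)) \<and> ln (cmod (m z)) < s + l + 1 \<and>
        \<bar>Re (m z)\<bar> < exp (- circle_dist l (ln (cmod (m z))) s) / 2 * cmod (m z) \<and>
        g z \<le> ennreal (exp (2 * feet_dist l s s2 (ln (cmod (m z))) + 2))"
        using lv R_subset N_uhp unfolding pos_def beyond_def by auto
    qed
    finally show ?thesis .
  qed
  have pos: "0 < rho_area (density s2) F"
  proof -
    have "O' M \<noteq> {}" using level_zero_nonempty by (simp add: O'_def)
    then obtain j H where jH: "j \<le> M" "openin (top_of_set N) H" "H \<noteq> {}" "H \<subseteq> F \<inter> O' j"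
      using H[rule_format, of M] by auto
    have Hb: "H \<in> sets borel" by (rule openin_N_borel[OF jH(2)])
    have HN: "H \<subseteq> N" by (rule openin_imp_subset[OF jH(2)])
    have dH: "1 \<le> density s2 z" if "z \<in> H" for z
    proof -
      have "z \<in> level s2 (M - j)" using that jH by (auto simp: O'_def)
      then have "z \<in> sat (level s2 (M - j))" using that HN subset_sat[of "level s2 (M - j)"] openin_imp_subset[OF level_open] by blast
      then have "ennreal (exp (real (M - j))) \<le> density s2 z"
        unfolding density_def M_def[symmetric] by (intro SUP_upper2[of "M - j"]) auto
      moreover have "1 \<le> ennreal (exp (real (M - j)))" by (simp add: one_le_exp_iff flip: ennreal_1)
      ultimately show ?thesis by (rule order_trans[rotated])
    qed
    define g :: "complex \<Rightarrow> ennreal" where "g = (\<lambda>z. ennreal (1 / (Im z)\<^sup>2) * indicator H z)"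
    have gm: "g \<in> borel_measurable lborel" unfolding g_def using Hb by measurable
    have le: "(\<integral>\<^sup>+z. g z \<partial>lborel) \<le> rho_area (density s2) F"
      unfolding rho_area_def
    proof (rule nn_integral_mono)
      fix z
      show "g z \<le> (density s2 z)\<^sup>2 * ennreal (1 / (Im z)\<^sup>2) * indicator F z"
      proof (cases "z \<in> H")
        case True
        have "1 \<le> (density s2 z)\<^sup>2" using dH[OF True] by (simp add: one_le_power)
        then have "1 * ennreal (1 / (Im z)\<^sup>2) \<le> (density s2 z)\<^sup>2 * ennreal (1 / (Im z)\<^sup>2)" by (rule mult_right_mono) simp
        then show ?thesis using True jH by (auto simp: g_def)
      qed (simp add: g_def)
    qed
    have "(\<integral>\<^sup>+z. g z \<partial>lborel) \<noteq> 0"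
    proof
      assume "(\<integral>\<^sup>+z. g z \<partial>lborel) = 0"
      then have "AE z in lborel. g z = 0" using nn_integral_0_iff_AE[OF gm] by simp
      then have "AE z in lborel. z \<notin> H"
      proof eventually_elim
        case (elim z)
        show "z \<notin> H"
        proof
          assume zH: "z \<in> H"
          then have "Im z > 0" using HN N_uhp by (auto simp: uhp_def)
          then have "g z > 0" using zH by (simp add: g_def)
          then show False using elim by simp
        qed
      qed
      then have "emeasure lborel H = 0" using Hb AE_iff_measurable[of H lborel "\<lambda>z. z \<notin> H"] by auto
      then show False using openin_N_emeasure_pos[OF jH(2,3)] by simp
    qed
    then show ?thesis using le by (metis le_zero_eq not_gr_zero)
  qed
  show ?thesis
  proof (intro exI[of _ F] conjI ballI impI)
    fix z assume "z \<in> R" "p z \<notin> alpha_circle"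
    then have "z \<in> (\<Union>i\<le>M + 1. O' i)" using Olast by blast
    then show "\<exists>!w. w \<in> F \<and> p w = p z" using ex1 by blast
  qed (use F(1) FR area pos in auto)
qed

end

section \<open>The lower bound\<close>

text \<open>The test density is that of the collars on either side of \<open>a\<close>, and infinite on the fibres over
  \<open>\<alpha>\<close>. This costs no area, as these fibres are represented by points of the null set \<open>a\<close>, and spares any
  estimate at the moments when a curve meets \<open>a\<close>. The fundamental set consists of one period of \<open>a\<close> and of the chosen points on both sides.\<close>

lemma glued_extremal_length_lower_bound:
  assumes glued: "glued_with_twist t cusp2 N p b cusp2' N' p' b' a l" and l2: "l \<ge> 2"
  shows "ennreal ((exp (-2) / 2)\<^sup>2 / (677376000 * exp 4) * exp (- ((1/2 - \<bar>t\<bar> / 2) * l)))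
     \<le> glued_extremal_length cusp2 N p b cusp2' N' p' b' a"
proof -
  have inter: "N \<inter> N' = range a" using glued unfolding glued_with_twist_def by (elim conjE)
  obtain s s' where col: "nonstandard_half_collar cusp2 N p a l s b"
    "nonstandard_half_collar cusp2' N' p' a l s' b'" and tw: "circle_dist l s s' = \<bar>t\<bar> * l"
    using glued unfolding glued_with_twist_def by (elim conjE exE) (rule that)
  have hp: "hyperbolic_pants cusp2 N p" "hyperbolic_pants cusp2' N' p'"
    using col by (simp_all add: nonstandard_half_collar_def)
  have "lifts_alpha N p a l" using col(1) unfolding nonstandard_half_collar_def by (elim conjE)
  then have ageo: "hgeodesic UNIV a" unfolding lifts_alpha_def by (elim conjE)
  obtain A B C D where det: "A * D - B * C = 1" and chart: "\<And>t. t \<in> UNIV \<Longrightarrow> a t = mob A B C D (iaxis t)"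
    by (rule hgeodesic_normal_form[OF ageo]) blast
  interpret L: collar_chart cusp2 N p a b l s A B C D
    by unfold_locales (use hp(1) col(1) det chart in simp_all)
  interpret R: collar_chart cusp2' N' p' a b' l s' A B C D
    by unfold_locales (use hp(2) col(2) det chart in simp_all)
  have l0: "l > 0" using l2 by simp
  define U where "U = glued_cover cusp2 N p b cusp2' N' p' b' a"
  define E where "E = glued_rel cusp2 N p b cusp2' N' p' b' a"
  have U: "U = L.R \<union> R.R" by (simp add: U_def glued_cover_def L.R_def R.R_def)
  have E: "(z, w) \<in> E \<longleftrightarrow> (z \<in> L.R \<and> w \<in> L.R \<and> p z = p w) \<or> (z \<in> R.R \<and> w \<in> R.R \<and> p' z = p' w)" for z w
    by (simp add: E_def glued_rel_def L.R_def R.R_def)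
  have RL: "z \<in> N" if "z \<in> L.R" for z using that L.R_subset by blast
  have RR: "z \<in> N'" if "z \<in> R.R" for z using that R.R_subset by blast
  have NN: "N \<subseteq> uhp" "N' \<subseteq> uhp" by (rule L.N_uhp, rule R.N_uhp)
  obtain F1 where F1: "F1 \<in> sets borel" "F1 \<subseteq> {z \<in> L.R. p z \<notin> alpha_circle}"
    "\<forall>z\<in>L.R. p z \<notin> alpha_circle \<longrightarrow> (\<exists>!w. w \<in> F1 \<and> p w = p z)"
    "rho_area (L.density s') F1 \<le> ennreal (338688000 * exp 4 * exp ((l - circle_dist l s s') / 2))"
    "0 < rho_area (L.density s') F1"
    using L.collar_fundamental_set[OF l2, of s'] by (elim exE conjE) (rule that)
  obtain F2 where F2: "F2 \<in> sets borel" "F2 \<subseteq> {z \<in> R.R. p' z \<notin> alpha_circle}"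
    "\<forall>z\<in>R.R. p' z \<notin> alpha_circle \<longrightarrow> (\<exists>!w. w \<in> F2 \<and> p' w = p' z)"
    "rho_area (R.density s) F2 \<le> ennreal (338688000 * exp 4 * exp ((l - circle_dist l s' s) / 2))"
    "0 < rho_area (R.density s) F2"
    using R.collar_fundamental_set[OF l2, of s] by (elim exE conjE) (rule that)
  define X where "X = (l - circle_dist l s s') / 2"
  define Z where "Z = N \<inter> p -` alpha_circle \<union> N' \<inter> p' -` alpha_circle"
  define \<rho> where "\<rho> = (\<lambda>z. if z \<in> Z then \<infinity> else if z \<in> N then L.density s' z else if z \<in> N' then R.density s z else 0)"
  define F where "F = a ` {0..<l} \<union> (F1 \<union> F2)"
  have acirc: "p (a x) \<in> alpha_circle" "p' (a x) \<in> alpha_circle" for x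
    using L.a_circle R.a_circle by blast+
  have off1: "z \<notin> Z \<and> z \<notin> N'" if "z \<in> N" "p z \<notin> alpha_circle" for z
  proof -
    have "z \<notin> range a" using that acirc by blast
    then have "z \<notin> N'" using that(1) inter by blast
    then show ?thesis using that by (simp add: Z_def)
  qed
  have off2: "z \<notin> Z \<and> z \<notin> N" if "z \<in> N'" "p' z \<notin> alpha_circle" for z
  proof -
    have "z \<notin> range a" using that acirc by blast
    then have "z \<notin> N" using that(1) inter by blast
    then show ?thesis using that by (simp add: Z_def)
  qed
  have \<rho>1: "\<rho> z = L.density s' z" if "z \<in> N" "p z \<notin> alpha_circle" for z
    using off1[OF that] that by (simp add: \<rho>_def)
  have \<rho>2: "\<rho> z = R.density s z" if "z \<in> N'" "p' z \<notin> alpha_circle" for z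
    using off2[OF that] that by (simp add: \<rho>_def)
  have Nb: "N \<in> sets borel" "N' \<in> sets borel"
    by (rule L.openin_N_borel, simp, rule R.openin_N_borel, simp)
  have Zb: "Z \<in> sets borel"
  proof -
    have "N \<inter> p -` (- alpha_circle) \<in> sets borel"
      by (rule L.openin_N_borel, rule continuous_openin_preimage_gen[OF L.p_cont]) (intro open_Compl closed_sphere)
    moreover have "N' \<inter> p' -` (- alpha_circle) \<in> sets borel"
      by (rule R.openin_N_borel, rule continuous_openin_preimage_gen[OF R.p_cont]) (intro open_Compl closed_sphere)
    moreover have "Z = (N - N \<inter> p -` (- alpha_circle)) \<union> (N' - N' \<inter> p' -` (- alpha_circle))"
      by (auto simp: Z_def)
    ultimately show ?thesis using Nb by auto
  qed
  have meas: "\<rho> \<in> borel_measurable borel"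
    unfolding \<rho>_def using Zb Nb L.density_measurable R.density_measurable by measurable
  have inv: "invariant_density U E \<rho>"
    unfolding invariant_density_def
  proof (intro conjI ballI impI meas)
    fix z w assume "(z, w) \<in> E"
    then consider "z \<in> L.R" "w \<in> L.R" "p z = p w" | "z \<in> R.R" "w \<in> R.R" "p' z = p' w" unfolding E by blast
    then show "\<rho> z = \<rho> w"
    proof cases
      case 1
      then have N: "z \<in> N" "w \<in> N" using RL by auto
      show ?thesis
      proof (cases "p z \<in> alpha_circle")
        case True
        then have "z \<in> Z" "w \<in> Z" using N 1(3) by (auto simp: Z_def)
        then show ?thesis by (simp add: \<rho>_def)
      next
        case False
        then show ?thesis using \<rho>1[OF N(1)] \<rho>1[OF N(2)] L.density_invariant[OF N 1(3)] 1(3) by simp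
      qed
    next
      case 2
      then have N: "z \<in> N'" "w \<in> N'" using RR by auto
      show ?thesis
      proof (cases "p' z \<in> alpha_circle")
        case True
        then have "z \<in> Z" "w \<in> Z" using N 2(3) by (auto simp: Z_def)
        then show ?thesis by (simp add: \<rho>_def)
      next
        case False
        then show ?thesis using \<rho>2[OF N(1)] \<rho>2[OF N(2)] R.density_invariant[OF N 2(3)] 2(3) by simp
      qed
    qed
  qed
  have arc_rep: "\<exists>x\<in>{0..<l}. \<exists>k::int. y - x = of_int k * l" for y
  proof -
    define k where "k = \<lfloor>y / l\<rfloor>"
    have "of_int k \<le> y / l" "y / l < of_int k + 1" unfolding k_def by linarith+
    then have "y - of_int k * l \<in> {0..<l}" using l0 by (simp add: field_simps)
    then show ?thesis by (intro bexI[of _ "y - of_int k * l"] exI[of _ k]) auto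
  qed
  have arc_unique: "x = y" if "x \<in> {0..<l}" "y \<in> {0..<l}" "y - x = of_int k * l" for x y and k :: int
  proof -
    have "\<bar>of_int k * l\<bar> < l" using that by auto
    then have "\<bar>of_int k :: real\<bar> < 1" using l0 by (simp add: abs_mult)
    then have "k = 0" by linarith
    then show ?thesis using that(3) by simp
  qed
  have fund: "fundamental_set U E F"
    unfolding fundamental_set_def
  proof (intro conjI ballI)
    have "a ` {0..<l} = a ` {0..l} - {a l}"
    proof -
      have "inj a" using hgeodesic_inj[OF ageo] .
      moreover have "{0..<l} = {0..l} - {l}" by auto
      ultimately show ?thesis by (simp add: image_set_diff)
    qed
    moreover have "compact (a ` {0..l})"
      by (intro compact_continuous_image continuous_on_subset[OF hgeodesic_continuous[OF ageo]]) auto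
    ultimately have "a ` {0..<l} \<in> sets borel" by (metis borel_compact borel_singleton sets.Diff sets.empty_sets)
    then show "F \<in> sets borel" using F1 F2 by (simp add: F_def)
    show "F \<subseteq> U" using F1(2) F2(2) L.a_in_R unfolding F_def U by blast
    fix z assume zU: "z \<in> U"
    \<comment> \<open>a class over \<open>\<alpha>\<close> is represented by one point of the chosen period of \<open>a\<close>, from whichever side it is seen\<close>
    have circ: "\<exists>!w. w \<in> F \<and> (z, w) \<in> E" if y: "(z \<in> L.R \<and> p z = p (a y)) \<or> (z \<in> R.R \<and> p' z = p' (a y))"
      for y
    proof -
      obtain x k where x: "x \<in> {0..<l}" "y - x = of_int (k::int) * l" using arc_rep by blast
      have px: "p (a x) = p (a y)" "p' (a x) = p' (a y)"
        using x(2) L.a_period[of x y] R.a_period[of x y] by blast+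
      have ax: "a x \<in> F" using x(1) by (simp add: F_def)
      have "(z, a x) \<in> E" using y px L.a_in_R[of x] R.a_in_R[of x] unfolding E by auto
      moreover have "w = a x" if w: "w \<in> F" "(z, w) \<in> E" for w
      proof -
        have zy: "p z = p (a y)" if "z \<in> L.R" using y
        proof
          assume "z \<in> R.R \<and> p' z = p' (a y)"
          then have "z \<in> range a" "p' z = p' (a y)" using RL[OF that] RR inter by auto
          then obtain r where "z = a r" "p' (a r) = p' (a y)" by auto
          then show ?thesis using L.a_period R.a_period by blast
        qed simp
        have zy': "p' z = p' (a y)" if "z \<in> R.R" using y
        proof
          assume "z \<in> L.R \<and> p z = p (a y)"
          then have "z \<in> range a" "p z = p (a y)" using RR[OF that] RL inter by auto
          then obtain r where "z = a r" "p (a r) = p (a y)" by auto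
          then show ?thesis using L.a_period R.a_period by blast
        qed simp
        have "w \<in> L.R \<and> p w = p (a y) \<or> w \<in> R.R \<and> p' w = p' (a y)"
          using w(2) zy zy' unfolding E by auto
        then have w': "w \<in> N \<and> p w = p (a y) \<or> w \<in> N' \<and> p' w = p' (a y)" using RL RR by blast
        have "w \<notin> F1"
        proof
          assume "w \<in> F1"
          then have "w \<in> N" "p w \<notin> alpha_circle" using F1(2) RL by auto
          then show False using w' off1[of w] acirc[of y] by auto
        qed
        moreover have "w \<notin> F2"
        proof
          assume "w \<in> F2"
          then have "w \<in> N'" "p' w \<notin> alpha_circle" using F2(2) RR by auto
          then show False using w' off2[of w] acirc[of y] by auto
        qed
        ultimately obtain x' where x': "x' \<in> {0..<l}" "w = a x'" using w(1) by (auto simp: F_def)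
        then have "p (a x') = p (a y) \<or> p' (a x') = p' (a y)" using w' by auto
        then have "p (a x') = p (a x)" using px L.a_period R.a_period by (metis (no_types))
        then obtain j :: int where "x - x' = of_int j * l" using L.a_period by blast
        then have "x' = x" using arc_unique x' x by blast
        then show "w = a x" using x' by simp
      qed
      ultimately show ?thesis using ax by blast
    qed
    from zU consider (c1) "z \<in> L.R" "p z \<in> alpha_circle" | (c2) "z \<in> R.R" "p' z \<in> alpha_circle"
      | (o1) "z \<in> L.R" "p z \<notin> alpha_circle" | (o2) "z \<in> R.R" "p' z \<notin> alpha_circle" unfolding U by blast
    then show "\<exists>!w. w \<in> F \<and> (z, w) \<in> E"
    proof cases
      case c1
      then obtain y where "p z = p (a y)" using L.a_circle by (metis imageE)
      then show ?thesis using circ c1 by blast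
    next
      case c2
      then obtain y where "p' z = p' (a y)" using R.a_circle by (metis imageE)
      then show ?thesis using circ c2 by blast
    next
      case o1
      obtain w where w: "w \<in> F1" "p w = p z" and un: "\<And>v. v \<in> F1 \<Longrightarrow> p v = p z \<Longrightarrow> v = w" using F1(3) o1 by metis
      have zE: "(z, v) \<in> E \<longleftrightarrow> v \<in> L.R \<and> p z = p v" for v
        using o1 off1[OF RL[OF o1(1)] o1(2)] RR unfolding E by blast
      have "v = w" if v: "v \<in> F" "(z, v) \<in> E" for v
      proof -
        have vL: "v \<in> L.R" "p v = p z" using v(2) zE by auto
        then have "v \<notin> range a" using o1(2) acirc(1) by (metis imageE)
        then have "v \<notin> a ` {0..<l}" by blast
        moreover have "v \<notin> F2" using F2(2) off2[of v] RR RL[OF vL(1)] by auto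
        ultimately show ?thesis using v(1) un vL(2) unfolding F_def by blast
      qed
      moreover have "w \<in> F" "(z, w) \<in> E" using w F1(2) zE unfolding F_def by auto
      ultimately show ?thesis by blast
    next
      case o2
      obtain w where w: "w \<in> F2" "p' w = p' z" and un: "\<And>v. v \<in> F2 \<Longrightarrow> p' v = p' z \<Longrightarrow> v = w" using F2(3) o2 by metis
      have zE: "(z, v) \<in> E \<longleftrightarrow> v \<in> R.R \<and> p' z = p' v" for v
        using o2 off2[OF RR[OF o2(1)] o2(2)] RL unfolding E by blast
      have "v = w" if v: "v \<in> F" "(z, v) \<in> E" for v
      proof -
        have vL: "v \<in> R.R" "p' v = p' z" using v(2) zE by auto
        then have "v \<notin> range a" using o2(2) acirc(2) by (metis imageE)
        then have "v \<notin> a ` {0..<l}" by blast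
        moreover have "v \<notin> F1" using F1(2) off1[of v] RL RR[OF vL(1)] by auto
        ultimately show ?thesis using v(1) un vL(2) unfolding F_def by blast
      qed
      moreover have "w \<in> F" "(z, w) \<in> E" using w F2(2) zE unfolding F_def by auto
      ultimately show ?thesis by blast
    qed
  qed
  let ?h = "\<lambda>z. ennreal (1 / (Im z)\<^sup>2)"
  have onF1: "z \<in> N \<and> p z \<notin> alpha_circle" if "z \<in> F1" for z using that F1(2) RL by auto
  have onF2: "z \<in> N' \<and> p' z \<notin> alpha_circle" if "z \<in> F2" for z using that F2(2) RR by auto
  have lower: "rho_area (L.density s') F1 \<le> rho_area \<rho> F"
    unfolding rho_area_def
  proof (rule nn_integral_mono)
    fix z
    show "(L.density s' z)\<^sup>2 * ?h z * indicator F1 z \<le> (\<rho> z)\<^sup>2 * ?h z * indicator F z"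
    proof (cases "z \<in> F1")
      case True
      then show ?thesis using \<rho>1[of z] onF1[of z] by (simp add: F_def)
    qed simp
  qed
  have upper: "rho_area \<rho> F \<le> rho_area (L.density s') F1 + rho_area (R.density s) F2"
  proof -
    have m1: "(\<lambda>z. (L.density s' z)\<^sup>2 * ?h z * indicator F1 z) \<in> borel_measurable lborel"
      using L.density_measurable[of s'] F1(1) by measurable
    have m2: "(\<lambda>z. (R.density s z)\<^sup>2 * ?h z * indicator F2 z) \<in> borel_measurable lborel"
      using R.density_measurable[of s] F2(1) by measurable
    have ae: "AE z in lborel. z \<notin> range a"
      by (rule AE_not_in, rule null_setsI) (use L.range_a_null in simp_all)
    have "rho_area \<rho> F \<le> (\<integral>\<^sup>+z. (L.density s' z)\<^sup>2 * ?h z * indicator F1 z + (R.density s z)\<^sup>2 * ?h z * indicator F2 z \<partial>lborel)"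
      unfolding rho_area_def
    proof (rule nn_integral_mono_AE)
      show "AE z in lborel. (\<rho> z)\<^sup>2 * ?h z * indicator F z
          \<le> (L.density s' z)\<^sup>2 * ?h z * indicator F1 z + (R.density s z)\<^sup>2 * ?h z * indicator F2 z"
        using ae
      proof eventually_elim
        case (elim z)
        show ?case
        proof (cases "z \<in> F1")
          case True
          then have "(\<rho> z)\<^sup>2 * ?h z * indicator F z = (L.density s' z)\<^sup>2 * ?h z * indicator F1 z"
            using \<rho>1[of z] onF1[of z] by (simp add: F_def)
          then show ?thesis by simp
        next
          case n1: False
          show ?thesis
          proof (cases "z \<in> F2")
            case True
            then have "(\<rho> z)\<^sup>2 * ?h z * indicator F z = (R.density s z)\<^sup>2 * ?h z * indicator F2 z"
              using \<rho>2[of z] onF2[of z] by (simp add: F_def)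
            then show ?thesis by simp
          next
            case False
            then have "z \<notin> F" using n1 elim by (auto simp: F_def)
            then show ?thesis by simp
          qed
        qed
      qed
    qed
    also have "\<dots> = rho_area (L.density s') F1 + rho_area (R.density s) F2"
      unfolding rho_area_def by (rule nn_integral_add[OF m1 m2])
    finally show ?thesis .
  qed
  define K where "K = 677376000 * exp 4 * exp X"
  have K0: "K > 0" by (simp add: K_def)
  have areaK: "rho_area \<rho> F \<le> ennreal K"
  proof -
    have "rho_area \<rho> F \<le> ennreal (338688000 * exp 4 * exp X) + ennreal (338688000 * exp 4 * exp X)"
      using upper F1(4) F2(4) unfolding X_def circle_dist_sym[OF l0, of s' s]
      by (meson add_mono order_trans)
    also have "\<dots> = ennreal K" by (simp add: K_def flip: ennreal_plus)
    finally show ?thesis .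
  qed
  have area0: "0 < rho_area \<rho> F" using lower F1(5) by (rule less_le_trans[rotated])
  have dens: "ennreal (exp (feet_dist l s s' (ln (cmod (L.m z))))) \<le> \<rho> z"
    if z: "z \<in> U" "z \<in> N \<Longrightarrow> L.beyond z < 0" "z \<in> N' \<Longrightarrow> R.beyond z < 0" for z
  proof (cases "z \<in> Z")
    case True
    then show ?thesis by (simp add: \<rho>_def)
  next
    case False
    consider "z \<in> L.R" | "z \<in> R.R" using z(1) unfolding U by blast
    then show ?thesis
    proof cases
      case 1
      have c: "z \<in> N" "p z \<notin> alpha_circle" using RL[OF 1] False unfolding Z_def by blast+
      have "ennreal (exp (feet_dist l s s' (L.pos z))) \<le> L.density s' z"
        by (rule L.density_lower[OF 1 c(2) z(2)[OF c(1)]])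
      then show ?thesis unfolding \<rho>1[OF c] L.pos_def .
    next
      case 2
      have c: "z \<in> N'" "p' z \<notin> alpha_circle" using RR[OF 2] False unfolding Z_def by blast+
      have "ennreal (exp (feet_dist l s' s (R.pos z))) \<le> R.density s z"
        by (rule R.density_lower[OF 2 c(2) z(3)[OF c(1)]])
      then show ?thesis unfolding \<rho>2[OF c] L.pos_def feet_dist_commute[of l s' s] .
    qed
  qed
  have len: "ennreal (exp (-2) / 2) \<le> rho_length \<rho> c"
    if cJ: "c \<in> joining_curves cusp2 N p b cusp2' N' p' b' a" for c
  proof -
    have c: "valid_path c" "c 0 \<in> N" "p (c 0) \<in> p ` range b" "c 1 \<in> N'" "p' (c 1) \<in> p' ` range b'"
      and cU: "c ` {0<..<1} \<subseteq> U"
      using cJ unfolding joining_curves_def U_def pathstart_def pathfinish_def by auto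
    have cNN: "c x \<in> N \<or> c x \<in> N'" if "x \<in> {0..1}" for x
    proof -
      consider "x = 0" | "x = 1" | "x \<in> {0<..<1}" using \<open>x \<in> {0..1}\<close> by force
      then show ?thesis
      proof cases
        case 3
        then have "c x \<in> U" using cU by blast
        then show ?thesis using RL RR unfolding U by blast
      qed (use c in auto)
    qed
    have cu: "c x \<in> uhp" if "x \<in> {0..1}" for x using cNN[OF that] NN by blast
    have pu: "path_image c \<subseteq> uhp" using cu by (auto simp: path_image_def)
    have cc: "continuous_on {0..1} c" using valid_path_imp_path[OF c(1)] by (simp add: path_def)
    obtain T where T: "closed T" "N = uhp \<inter> T" using L.N_closed by (auto simp: closedin_closed)
    obtain T' where T': "closed T'" "N' = uhp \<inter> T'" using R.N_closed by (auto simp: closedin_closed)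
    have inN: "c x \<in> N \<longleftrightarrow> c x \<in> T" "c x \<in> N' \<longleftrightarrow> c x \<in> T'" if "x \<in> {0..1}" for x
      using cu[OF that] T T' by auto
    \<comment> \<open>the times at which the curve is on the first side beyond the collar, and likewise for the second side;
      the interval from \<open>t1\<close> to \<open>t2\<close> below is a passage between them through both collars\<close>
    define P1 where "P1 = {0..1} \<inter> c -` T \<inter> ({0..1} \<inter> (\<lambda>x. L.beyond (c x)) -` {0..})"
    define P2 where "P2 = {0..1} \<inter> c -` T' \<inter> ({0..1} \<inter> (\<lambda>x. R.beyond (c x)) -` {0..})"
    have cb1: "continuous_on {0..1} (\<lambda>x. L.beyond (c x))"
      by (rule continuous_on_compose2[OF L.beyond_cont cc]) (use cu in auto)
    have cb2: "continuous_on {0..1} (\<lambda>x. R.beyond (c x))"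
      by (rule continuous_on_compose2[OF R.beyond_cont cc]) (use cu in auto)
    have cl1: "closed P1" unfolding P1_def
      by (intro closed_Int continuous_closed_preimage cc cb1 T) auto
    have cl2: "closed P2" unfolding P2_def
      by (intro closed_Int continuous_closed_preimage cc cb2 T') auto
    have far1: "L.beyond (c 0) \<ge> 0" using L.beta_far[OF c(2,3)] by (simp add: L.beyond_def L.pos_def)
    have far2: "R.beyond (c 1) \<ge> 0" using R.beta_far[OF c(4,5)] by (simp add: R.beyond_def R.pos_def)
    have m01: "0 \<in> P1" "1 \<in> P2" using far1 far2 c inN[of 0] inN[of 1] by (auto simp: P1_def P2_def)
    define t2 where "t2 = Inf P2"
    have bdd: "bdd_below P2" by (rule bdd_belowI[of _ 0]) (simp add: P2_def)
    have t2: "t2 \<in> P2" unfolding t2_def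
      by (rule closed_contains_Inf[OF _ bdd cl2]) (use m01 in blast)
    have t2min: "t2 \<le> x" if "x \<in> P2" for x unfolding t2_def
      by (rule cInf_lower[OF that bdd])
    define t1 where "t1 = Sup (P1 \<inter> {..t2})"
    have t201: "t2 \<in> {0..1}" using t2 by (simp add: P2_def)
    have bdd': "bdd_above (P1 \<inter> {..t2})" by (rule bdd_aboveI[of _ t2]) simp
    have t1: "t1 \<in> P1 \<inter> {..t2}" unfolding t1_def
      by (rule closed_contains_Sup[OF _ bdd' closed_Int[OF cl1 closed_atMost]]) (use m01 t201 in auto)
    have t1max: "x \<le> t1" if "x \<in> P1" "x \<le> t2" for x unfolding t1_def
      by (rule cSup_upper[OF _ bdd']) (use that in simp)
    have t12: "0 \<le> t1" "t1 \<le> t2" "t2 \<le> 1" using t1 t201 by (auto simp: P1_def)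
    have cN1: "c t1 \<in> N" "L.beyond (c t1) \<ge> 0" using t1 inN(1)[of t1] by (auto simp: P1_def)
    have cN2: "c t2 \<in> N'" "R.beyond (c t2) \<ge> 0" using t2 inN(2)[of t2] by (auto simp: P2_def)
    have between: "(c x \<in> N \<longrightarrow> L.beyond (c x) < 0) \<and> (c x \<in> N' \<longrightarrow> R.beyond (c x) < 0) \<and> c x \<in> U"
      if x: "t1 < x" "x < t2" for x
    proof -
      have x01: "x \<in> {0..1}" "x \<in> {0<..<1}" using x t12 by auto
      have "x \<notin> P1" using t1max[of x] x by auto
      moreover have "x \<notin> P2" using t2min[of x] x by auto
      moreover have "c x \<in> U" using cU x01(2) by blast
      ultimately show ?thesis using x01(1) inN[OF x01(1)] by (auto simp: P1_def P2_def)
    qed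
    \<comment> \<open>the two sides are relatively closed and meet only in \<open>a\<close>, so the connected curve meets \<open>a\<close> on the way\<close>
    have "\<exists>x\<in>{t1..t2}. c x \<in> range a"
    proof (rule ccontr)
      assume no: "\<not> ?thesis"
      let ?S = "c ` {t1..t2}"
      have sub: "{t1..t2} \<subseteq> {0..1}" using t12 by auto
      have "connected ?S" by (intro connected_continuous_image continuous_on_subset[OF cc sub]) simp
      moreover have "?S \<subseteq> T \<union> T'" using cNN inN sub by blast
      moreover have "T \<inter> T' \<inter> ?S = {}"
      proof -
        have "x \<in> {t1..t2} \<Longrightarrow> c x \<in> T \<Longrightarrow> c x \<in> T' \<Longrightarrow> False" for x
          using no inN[of x] sub inter by blast
        then show ?thesis by blast
      qed
      moreover have "T \<inter> ?S \<noteq> {}" using cN1(1) inN(1)[of t1] t12 by auto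
      moreover have "T' \<inter> ?S \<noteq> {}" using cN2(1) inN(2)[of t2] t12 by auto
      ultimately show False using connected_closedD[OF _ _ _ T(1) T'(1)] by metis
    qed
    then obtain t3 where t3: "t3 \<in> {t1..t2}" "c t3 \<in> range a" by blast
    show ?thesis
    proof (rule L.crossing_length[OF c(1) pu, of t1 t3 t2 s s'])
      show "0 \<le> t1" "t1 \<le> t3" "t3 \<le> t2" "t2 \<le> 1" using t12 t3 by auto
      show "ennreal (exp (feet_dist l s s' (ln (cmod (L.m (c x)))))) \<le> \<rho> (c x)" if "t1 < x" "x < t2" for x
        using between[OF that] by (intro dens) auto
      show "exp (- circle_dist l (ln (cmod (L.m (c t1)))) s) / 2 * cmod (L.m (c t1)) \<le> \<bar>Re (L.m (c t1))\<bar>"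
        using cN1(2) by (simp add: L.beyond_def L.pos_def)
      show "exp (- circle_dist l (ln (cmod (L.m (c t2)))) s') / 2 * cmod (L.m (c t2)) \<le> \<bar>Re (L.m (c t2))\<bar>"
        using cN2(2) by (simp add: R.beyond_def R.pos_def)
      show "c t3 \<in> range a" by (rule t3(2))
    qed
  qed
  define CC where "CC = joining_curves cusp2 N p b cusp2' N' p' b' a"
  have inf: "ennreal (exp (-2) / 2) \<le> (INF c\<in>CC. rho_length \<rho> c)"
    by (rule INF_greatest) (use len in \<open>simp add: CC_def\<close>)
  have fin: "rho_area \<rho> F < \<infinity>" using areaK by (rule le_less_trans) simp
  then obtain r where r: "r \<ge> 0" "rho_area \<rho> F = ennreal r" by (cases "rho_area \<rho> F") auto
  have r0: "r > 0" using area0 r by simp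
  have rK: "r \<le> K" using areaK K0 unfolding r(2) by simp
  have "ennreal ((exp (-2) / 2)\<^sup>2 / K) \<le> ennreal ((exp (-2) / 2)\<^sup>2 / r)"
    using rK r0 by (intro ennreal_leI divide_left_mono) auto
  also have "\<dots> = (ennreal (exp (-2) / 2))\<^sup>2 / rho_area \<rho> F"
    using r0 unfolding r(2) by (simp add: divide_ennreal ennreal_power)
  also have "\<dots> \<le> (INF c\<in>CC. rho_length \<rho> c)\<^sup>2 / rho_area \<rho> F"
    by (intro divide_right_mono_ennreal power_mono inf) simp
  also have "\<dots> \<le> extremal_length U E CC"
    unfolding extremal_length_def
    by (rule Sup_upper) (intro CollectI exI[of _ \<rho>] exI[of _ F] conjI refl inv fund area0 fin)
  also have "\<dots> = glued_extremal_length cusp2 N p b cusp2' N' p' b' a"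
    by (simp add: glued_extremal_length_def U_def E_def CC_def)
  finally have main: "ennreal ((exp (-2) / 2)\<^sup>2 / K) \<le> glued_extremal_length cusp2 N p b cusp2' N' p' b' a" .
  have X: "(1/2 - \<bar>t\<bar> / 2) * l = X" unfolding X_def tw by (simp add: field_simps)
  have "(exp (-2) / 2)\<^sup>2 / (677376000 * exp 4) * exp (- X) = (exp (-2) / 2)\<^sup>2 / K"
    unfolding K_def exp_minus[of X] by (simp only: divide_inverse inverse_mult_distrib mult.assoc)
  then show ?thesis unfolding X using main by (simp only:)
qed

theorem corollary6p3:
  fixes l0 :: real
  assumes "l0 \<ge> 2"
  shows "\<exists>C>0. \<forall>(l::real) (t::real) cusp2 N p b cusp2' N' p' b' a.
           glued_with_twist t cusp2 N p b cusp2' N' p' b' a l \<longrightarrow>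
           l0 \<le> l \<longrightarrow> - (1/2) \<le> t \<longrightarrow> t < 1/2 \<longrightarrow>
           ennreal (C * exp (- (1/2 - \<bar>t\<bar> / 2) * l))
             \<le> glued_extremal_length cusp2 N p b cusp2' N' p' b' a"
proof (intro exI[of _ "(exp (-2) / 2)\<^sup>2 / (677376000 * exp 4)"] conjI allI impI)
  show "(0::real) < (exp (-2) / 2)\<^sup>2 / (677376000 * exp 4)" by simp
  fix l t :: real and cusp2 N p b cusp2' N' p' b' a
  assume g: "glued_with_twist t cusp2 N p b cusp2' N' p' b' a l" and l: "l0 \<le> l"
  show "ennreal ((exp (-2) / 2)\<^sup>2 / (677376000 * exp 4) * exp (- (1/2 - \<bar>t\<bar> / 2) * l))
     \<le> glued_extremal_length cusp2 N p b cusp2' N' p' b' a"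
    unfolding mult_minus_left by (rule glued_extremal_length_lower_bound[OF g]) (use assms l in linarith)
qed

end
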